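(* $\mathbf{AGWP}(G)\in\mathbf{P}$ for every finitely generated hyperbolic group $G$.
   Context: For a group $G$ with a finite generating set $X$, the acyclic graph word problem $\mathbf{AGWP}(G)$ is the following decision problem. Input: a finite acyclic directed graph $\Gamma$ with edges labeled by letters in $X\cup X^{-1}\cup\{\varepsilon\}$ ($\varepsilon$ the empty word), with two marked vertices $\alpha$ and $\omega$. Question: is there an oriented path in $\Gamma$ from $\alpha$ to $\omega$ labeled by a word $w$ such that $w=1$ in $G$? The size of an instance is the number of vertices plus the number of edges plus the total length of edge labels. The complexity does not depend on the choice of finite $X$. $\mathbf{P}$ is the class of problems decidable in polynomial time. Hyperbolic means Gromov (word) hyperbolic. *)

theory Defs
  imports
    Complex_Main
    "HOL-Algebra.Generated_Groups"
    "Graph_Theory.Digraph"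
    "Graph_Theory.Arc_Walk"
begin

section \<open>Hyperbolic groups\<close>

definition word_length :: "('a, 'b) monoid_scheme \<Rightarrow> 'a set \<Rightarrow> 'a \<Rightarrow> nat" where
  "word_length G S g =
     (LEAST n. \<exists>ws. length ws = n \<and> set ws \<subseteq> S \<union> m_inv G ` S \<and> foldr (mult G) ws (one G) = g)"

definition word_dist :: "('a, 'b) monoid_scheme \<Rightarrow> 'a set \<Rightarrow> 'a \<Rightarrow> 'a \<Rightarrow> real" where
  "word_dist G S g h = real (word_length G S (mult G (m_inv G g) h))"

definition gromov_product :: "('a \<Rightarrow> 'a \<Rightarrow> real) \<Rightarrow> 'a \<Rightarrow> 'a \<Rightarrow> 'a \<Rightarrow> real" where
  "gromov_product d w x y = (d w x + d w y - d x y) / 2"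

definition gromov_hyperbolic :: "'a set \<Rightarrow> ('a \<Rightarrow> 'a \<Rightarrow> real) \<Rightarrow> real \<Rightarrow> bool" where
  "gromov_hyperbolic M d \<delta> \<longleftrightarrow>
     (\<forall>w\<in>M. \<forall>x\<in>M. \<forall>y\<in>M. \<forall>z\<in>M.
        gromov_product d w x z \<ge> min (gromov_product d w x y) (gromov_product d w y z) - \<delta>)"

text \<open>
  The word metric lives on the vertex set of the Cayley graph. Every point of the Cayley graph
  is within distance 1/2 of a vertex, so passing to the whole graph only changes the constant.
\<close>

definition hyperbolic_group :: "('a, 'b) monoid_scheme \<Rightarrow> bool" where
  "hyperbolic_group G \<longleftrightarrow>
     group G \<and>
     (\<exists>S. finite S \<and> S \<subseteq> carrier G \<and> generate G S = carrier G \<and>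
          (\<exists>\<delta>\<ge>0. gromov_hyperbolic (carrier G) (word_dist G S) \<delta>))"


section \<open>Multi-tape Turing machines and polynomial time\<close>

text \<open>
  Tapes are infinite to the right. A machine is the list of its transition functions, one for
  each non-halting state, and a state \<open>q \<ge> length M\<close> is halting: \<open>length M\<close> is the accepting
  state and \<open>Suc (length M)\<close> the rejecting one. A transition maps the list of scanned symbols to
  the next state and, for each tape, the symbol written and the head move. Only its values on
  lists of \<open>k\<close> symbols below \<open>K\<close> matter, so a machine is a finite object.
  Symbol 0 is the blank, symbol 1 initially marks the left end of every tape, and symbols 2 and 3
  are the input symbols.
\<close>

datatype direction = Left | Stay | Right

type_synonym tape = "(nat \<Rightarrow> nat) \<times> nat"
type_synonym config = "nat \<times> tape list"
type_synonym transition = "nat list \<Rightarrow> nat \<times> (nat \<times> direction) list"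
type_synonym machine = "transition list"

definition turing_machine :: "nat \<Rightarrow> nat \<Rightarrow> machine \<Rightarrow> bool" where
  "turing_machine k K M \<longleftrightarrow>
     k \<ge> 1 \<and> K \<ge> 4 \<and>
     (\<forall>\<tau>\<in>set M. \<forall>rs. length rs = k \<and> set rs \<subseteq> {..<K} \<longrightarrow>
        fst (\<tau> rs) \<le> Suc (length M) \<and>
        length (snd (\<tau> rs)) = k \<and>
        fst ` set (snd (\<tau> rs)) \<subseteq> {..<K})"

fun move :: "direction \<Rightarrow> nat \<Rightarrow> nat" where
  "move Left p = p - 1"
| "move Stay p = p"
| "move Right p = Suc p"

fun act :: "nat \<times> direction \<Rightarrow> tape \<Rightarrow> tape" where
  "act (s, dir) (f, p) = (f(p := s), move dir p)"

fun step :: "machine \<Rightarrow> config \<Rightarrow> config" where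
  "step M (q, tps) =
     (if q < length M
      then let (q', as) = (M ! q) (map (\<lambda>(f, p). f p) tps) in (q', map2 act as tps)
      else (q, tps))"

definition blank_tape :: tape where
  "blank_tape = ((\<lambda>_. 0)(0 := 1), 0)"

definition input_tape :: "bool list \<Rightarrow> tape" where
  "input_tape x =
     (\<lambda>i. if i = 0 then 1 else if i \<le> length x then (if x ! (i - 1) then 3 else 2) else 0, 0)"

definition start_config :: "nat \<Rightarrow> bool list \<Rightarrow> config" where
  "start_config k x = (0, input_tape x # replicate (k - 1) blank_tape)"

definition decides_in_time :: "nat \<Rightarrow> machine \<Rightarrow> bool list set \<Rightarrow> (nat \<Rightarrow> nat) \<Rightarrow> bool" where
  "decides_in_time k M L T \<longleftrightarrow>
     (\<forall>x. \<exists>t \<le> T (length x).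
        fst ((step M ^^ t) (start_config k x)) = (if x \<in> L then length M else Suc (length M)))"

definition class_P :: "bool list set set" where
  "class_P =
     {L. \<exists>k K M c d. turing_machine k K M \<and> decides_in_time k M L (\<lambda>n. c * n ^ d + c)}"


section \<open>The acyclic graph word problem\<close>

text \<open>
  The generating set is given as a list \<open>xs\<close>. \<open>Pos i\<close> and \<open>Neg i\<close> are the letters for \<open>xs ! i\<close>
  and its inverse, and \<open>None\<close> is the label \<open>\<epsilon>\<close>.
\<close>

datatype letter = Pos nat | Neg nat

fun letter_index :: "letter \<Rightarrow> nat" where
  "letter_index (Pos i) = i"
| "letter_index (Neg i) = i"

fun letter_val :: "('a, 'b) monoid_scheme \<Rightarrow> 'a list \<Rightarrow> letter \<Rightarrow> 'a" where
  "letter_val G xs (Pos i) = xs ! i"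
| "letter_val G xs (Neg i) = m_inv G (xs ! i)"

definition word_val :: "('a, 'b) monoid_scheme \<Rightarrow> 'a list \<Rightarrow> letter list \<Rightarrow> 'a" where
  "word_val G xs w = foldr (mult G) (map (letter_val G xs) w) (one G)"

fun label_word :: "letter option \<Rightarrow> letter list" where
  "label_word None = []"
| "label_word (Some l) = [l]"

text \<open>
  Vertices are \<open>0, ..., nverts - 1\<close>. Arcs are positions in the edge list, so parallel edges are
  allowed. Over an acyclic graph, an \<open>awalk\<close> visits no vertex twice.
\<close>

record instance_graph =
  nverts :: nat
  edges :: "(nat \<times> letter option \<times> nat) list"
  source :: nat
  target :: nat

definition digraph_of :: "instance_graph \<Rightarrow> (nat, nat) pre_digraph" where
  "digraph_of \<Gamma> =
     \<lparr> verts = {..<nverts \<Gamma>},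
       arcs = {..<length (edges \<Gamma>)},
       tail = (\<lambda>e. fst (edges \<Gamma> ! e)),
       head = (\<lambda>e. snd (snd (edges \<Gamma> ! e))) \<rparr>"

definition arc_label :: "instance_graph \<Rightarrow> nat \<Rightarrow> letter option" where
  "arc_label \<Gamma> e = fst (snd (edges \<Gamma> ! e))"

definition path_word :: "instance_graph \<Rightarrow> nat list \<Rightarrow> letter list" where
  "path_word \<Gamma> p = concat (map (\<lambda>e. label_word (arc_label \<Gamma> e)) p)"

definition valid_instance :: "nat \<Rightarrow> instance_graph \<Rightarrow> bool" where
  "valid_instance m \<Gamma> \<longleftrightarrow>
     fin_digraph (digraph_of \<Gamma>) \<and>
     (\<nexists>p. pre_digraph.cycle (digraph_of \<Gamma>) p) \<and>
     source \<Gamma> \<in> verts (digraph_of \<Gamma>) \<and>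
     target \<Gamma> \<in> verts (digraph_of \<Gamma>) \<and>
     (\<forall>e\<in>arcs (digraph_of \<Gamma>). \<forall>l. arc_label \<Gamma> e = Some l \<longrightarrow> letter_index l < m)"

definition yes_instance :: "('a, 'b) monoid_scheme \<Rightarrow> 'a list \<Rightarrow> instance_graph \<Rightarrow> bool" where
  "yes_instance G xs \<Gamma> \<longleftrightarrow>
     (\<exists>p. pre_digraph.awalk (digraph_of \<Gamma>) (source \<Gamma>) p (target \<Gamma>) \<and>
          word_val G xs (path_word \<Gamma> p) = one G)"

definition instance_size :: "instance_graph \<Rightarrow> nat" where
  "instance_size \<Gamma> =
     nverts \<Gamma> + length (edges \<Gamma>) +
     (\<Sum>e<length (edges \<Gamma>). length (label_word (arc_label \<Gamma> e)))"

text \<open>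
  Instances are encoded in binary strings with numbers in unary. The lemmas below show that the
  encoding is injective and that its length is polynomially related to \<^const>\<open>instance_size\<close>.
\<close>

fun label_code :: "letter option \<Rightarrow> nat" where
  "label_code None = 0"
| "label_code (Some (Pos i)) = 2 * i + 1"
| "label_code (Some (Neg i)) = 2 * i + 2"

definition encode_nats :: "nat list \<Rightarrow> bool list" where
  "encode_nats ns = concat (map (\<lambda>n. replicate n True @ [False]) ns)"

definition instance_nats :: "instance_graph \<Rightarrow> nat list" where
  "instance_nats \<Gamma> =
     [nverts \<Gamma>, source \<Gamma>, target \<Gamma>] @ concat (map (\<lambda>(u, l, v). [u, label_code l, v]) (edges \<Gamma>))"

definition encode_instance :: "instance_graph \<Rightarrow> bool list" where
  "encode_instance \<Gamma> = encode_nats (instance_nats \<Gamma>)"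

definition AGWP :: "('a, 'b) monoid_scheme \<Rightarrow> 'a list \<Rightarrow> bool list set" where
  "AGWP G xs =
     {encode_instance \<Gamma> | \<Gamma>. valid_instance (length xs) \<Gamma> \<and> yes_instance G xs \<Gamma>}"

lemma label_code_inject: "label_code l = label_code l' \<Longrightarrow> l = l'"
  by (cases l rule: label_code.cases; cases l' rule: label_code.cases) (auto, presburger+)

lemma encode_nats_inject: "encode_nats ms = encode_nats ns \<Longrightarrow> ms = ns"
proof (induction ms arbitrary: ns)
  case Nil
  then show ?case by (cases ns) (auto simp: encode_nats_def)
next
  case (Cons m ms)
  then obtain n ns' where ns: "ns = n # ns'"
    by (cases ns) (auto simp: encode_nats_def)
  have eq: "replicate m True @ False # encode_nats ms = replicate n True @ False # encode_nats ns'"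
    using Cons.prems by (simp add: ns encode_nats_def)
  have *: "i = j \<and> zs = zs'"
    if "replicate i True @ False # zs = replicate j True @ False # zs'" for i j zs zs'
    using that
  proof (induction i arbitrary: j)
    case 0
    then show ?case by (cases j) auto
  next
    case (Suc i)
    then show ?case by (cases j) auto
  qed
  show ?case using *[OF eq] Cons.IH ns by blast
qed

lemma inj_encode_instance: "inj encode_instance"
proof (rule injI)
  fix \<Gamma> \<Delta> :: instance_graph
  assume "encode_instance \<Gamma> = encode_instance \<Delta>"
  then have eq: "instance_nats \<Gamma> = instance_nats \<Delta>"
    unfolding encode_instance_def by (rule encode_nats_inject)
  have "es = fs"
    if "concat (map (\<lambda>(u, l, v). [u, label_code l, v]) es) =
        concat (map (\<lambda>(u, l, v). [u, label_code l, v]) fs)" for es fs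
    using that
  proof (induction es arbitrary: fs)
    case Nil
    then show ?case by (cases fs) auto
  next
    case (Cons e es)
    then show ?case by (cases e; cases fs) (auto dest: label_code_inject)
  qed
  with eq show "\<Gamma> = \<Delta>" by (auto simp: instance_nats_def)
qed

lemma length_encode_instance:
  "length (encode_instance \<Gamma>) =
     nverts \<Gamma> + source \<Gamma> + target \<Gamma> + 3 +
     (\<Sum>e<length (edges \<Gamma>).
        fst (edges \<Gamma> ! e) + label_code (arc_label \<Gamma> e) + snd (snd (edges \<Gamma> ! e)) + 3)"
proof -
  have len: "length (encode_nats ns) = (\<Sum>n\<leftarrow>ns. n + 1)" for ns
    by (induction ns) (auto simp: encode_nats_def)
  have "(\<Sum>n\<leftarrow>concat (map (\<lambda>(u, l, v). [u, label_code l, v]) es). n + 1) =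
        (\<Sum>(u, l, v)\<leftarrow>es. u + label_code l + v + 3)" for es
    by (induction es) auto
  moreover have "(\<Sum>(u, l, v)\<leftarrow>edges \<Gamma>. u + label_code l + v + 3) =
      (\<Sum>e<length (edges \<Gamma>).
        fst (edges \<Gamma> ! e) + label_code (arc_label \<Gamma> e) + snd (snd (edges \<Gamma> ! e)) + 3)"
    by (simp add: sum_list_sum_nth atLeast0LessThan case_prod_beta arc_label_def)
  ultimately show ?thesis
    by (simp add: encode_instance_def len instance_nats_def)
qed

lemma instance_size_le_length: "instance_size \<Gamma> \<le> length (encode_instance \<Gamma>)"
proof -
  have "length (label_word l) \<le> 1" for l by (cases l) auto
  then have "length (edges \<Gamma>) + (\<Sum>e<length (edges \<Gamma>). length (label_word (arc_label \<Gamma> e)))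
      \<le> length (edges \<Gamma>) + (\<Sum>e<length (edges \<Gamma>). 1)"
    by (intro add_left_mono sum_mono)
  also have "\<dots> \<le> (\<Sum>e<length (edges \<Gamma>). 3)" by simp
  also have "\<dots> \<le> (\<Sum>e<length (edges \<Gamma>).
      fst (edges \<Gamma> ! e) + label_code (arc_label \<Gamma> e) + snd (snd (edges \<Gamma> ! e)) + 3)"
    by (rule sum_mono) simp
  finally show ?thesis
    unfolding length_encode_instance instance_size_def by linarith
qed

lemma length_le_instance_size:
  assumes "valid_instance m \<Gamma>"
  shows "length (encode_instance \<Gamma>) \<le> (2 * m + 6) * (instance_size \<Gamma> + 1)\<^sup>2"
proof -
  define n where "n = nverts \<Gamma>"
  define E where "E = length (edges \<Gamma>)"
  define s where "s = instance_size \<Gamma>"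
  interpret fin_digraph "digraph_of \<Gamma>" using assms by (simp add: valid_instance_def)
  have st: "source \<Gamma> \<le> n" "target \<Gamma> \<le> n"
    using assms by (auto simp: valid_instance_def digraph_of_def n_def)
  have edge: "fst (edges \<Gamma> ! e) + label_code (arc_label \<Gamma> e) + snd (snd (edges \<Gamma> ! e)) + 3
      \<le> 2 * n + 2 * m + 3" if e: "e < E" for e
  proof -
    have "fst (edges \<Gamma> ! e) < n" "snd (snd (edges \<Gamma> ! e)) < n"
      using tail_in_verts[of e] head_in_verts[of e] e
      by (auto simp: digraph_of_def n_def E_def)
    moreover have "label_code (arc_label \<Gamma> e) \<le> 2 * m"
    proof -
      have "\<forall>l. arc_label \<Gamma> e = Some l \<longrightarrow> letter_index l < m"
        using assms e by (auto simp: valid_instance_def digraph_of_def E_def)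
      then show ?thesis by (cases "arc_label \<Gamma> e" rule: label_code.cases) auto
    qed
    ultimately show ?thesis by linarith
  qed
  have "(\<Sum>e<E. fst (edges \<Gamma> ! e) + label_code (arc_label \<Gamma> e) + snd (snd (edges \<Gamma> ! e)) + 3)
      \<le> (\<Sum>e<E. 2 * n + 2 * m + 3)"
    by (rule sum_mono) (use edge in auto)
  then have "length (encode_instance \<Gamma>) \<le> 3 * n + 3 + E * (2 * n + 2 * m + 3)"
    unfolding length_encode_instance using st by (simp add: n_def E_def)
  also have "\<dots> \<le> 3 * s + 3 + s * (2 * s + 2 * m + 3)"
  proof -
    have "n \<le> s" "E \<le> s" by (auto simp: s_def n_def E_def instance_size_def)
    then show ?thesis by (intro add_mono mult_mono) auto
  qed
  also have "\<dots> \<le> (2 * m + 6) * (s + 1)\<^sup>2"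
    by (simp add: power2_eq_square algebra_simps)
  finally show ?thesis by (simp add: s_def)
qed

end

theory Submission
  imports Defs "HOL-Library.Countable"
begin

text \<open>
  Let \<open>G\<close> be a hyperbolic group. Consider pairs \<open>(u, s)\<close> of a vertex \<open>u\<close> of the given graph and a word
  \<open>s\<close> over a fixed ball \<open>B\<close> of the Cayley graph; if a path reaches \<open>u\<close> with value \<open>x\<close>, such a pair
  stands for the point \<open>x s\<close>. Elementary links lead from \<open>(u, s)\<close> to \<open>(u, s b)\<close> and back, with
  value \<open>b \<in> B\<close> or its inverse, and from \<open>(u, [])\<close> to \<open>(v, [])\<close> for an edge, with the value of its
  label. Close them under those compositions whose values remain in \<open>B\<close>. A link from the source to the
  target (with empty words) and value \<open>\<one>\<close> obviously comes from a path with value \<open>\<one>\<close>. The point is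
  the converse, \<open>linked_trivial_walk\<close>: in a hyperbolic group, words of length logarithmic in the
  length of the path suffice. It is proved by bisection of the path (\<open>lift_geodesic\<close>). The
  geodesic between the ends of a path of length \<open>2 ^ k\<close> has the points of the geodesics of the two
  halves nearby, because triangles are thin; hence, by induction, it can be followed through links
  between pairs with words of length at most \<open>k + 1\<close>, one letter more than for the halves.

  So only polynomially many pairs matter, and \<open>B\<close> is finite with a fixed multiplication table. The
  links are the least solution of finitely many Horn clauses over the numbers up to some polynomial
  bound, words being represented by numbers. The parsing of the input is of this form as well, and
  acyclicity too: a finite graph has no cycle if and only if all vertices are in the accessible part
  of the reversed edge relation, which is defined inductively. The lemma \<open>AGWP_eq\<close> states that such a
  program accepts the right inputs.

  It remains to evaluate a Horn program on a Turing machine in polynomial time. A small language with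
  loops, in which head positions serve as counters, is compiled to machines (\<open>run_compile\<close>). All
  relations are stored in tables, one tape for each, and the rules are applied to all values of the
  variables, as often as there can be facts (\<open>derivable_in_class_P\<close>).
\<close>

section \<open>Compiling structured tape programs to Turing machines\<close>

datatype com =
    Skip
  | Write nat nat
  | Move nat direction
  | Seq com com
  | Cond nat nat com com
  | Until nat nat com

type_synonym store = "(nat \<Rightarrow> nat \<Rightarrow> nat) \<times> (nat \<Rightarrow> nat)"

text \<open>
  A store gives the contents and the head position of each tape. \<open>Cond i a\<close> and \<open>Until i a\<close> test
  whether tape \<open>i\<close> scans \<open>a\<close>. The number of steps in \<open>run\<close> is that of the compiled code: one
  for each test and one for each jump.
\<close>

inductive run :: "com \<Rightarrow> store \<Rightarrow> nat \<Rightarrow> store \<Rightarrow> bool" where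
  Skip: "run Skip s 0 s"
| Write: "run (Write i a) (C, h) 1 (C(i := (C i)(h i := a)), h)"
| Move: "run (Move i d) (C, h) 1 (C, h(i := move d (h i)))"
| Seq: "run c1 s t1 s' \<Longrightarrow> run c2 s' t2 s'' \<Longrightarrow> run (Seq c1 c2) s (t1 + t2) s''"
| CondTrue: "C i (h i) = a \<Longrightarrow> run c1 (C, h) t s' \<Longrightarrow> run (Cond i a c1 c2) (C, h) (t + 2) s'"
| CondFalse: "C i (h i) \<noteq> a \<Longrightarrow> run c2 (C, h) t s' \<Longrightarrow> run (Cond i a c1 c2) (C, h) (t + 1) s'"
| UntilExit: "C i (h i) = a \<Longrightarrow> run (Until i a c) (C, h) 1 (C, h)"
| UntilLoop: "C i (h i) \<noteq> a \<Longrightarrow> run c (C, h) t1 s' \<Longrightarrow> run (Until i a c) s' t2 s'' \<Longrightarrow>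
    run (Until i a c) (C, h) (t1 + t2 + 2) s''"

fun csize :: "com \<Rightarrow> nat" where
  "csize Skip = 0"
| "csize (Write i a) = 1"
| "csize (Move i d) = 1"
| "csize (Seq c1 c2) = csize c1 + csize c2"
| "csize (Cond i a c1 c2) = csize c1 + csize c2 + 2"
| "csize (Until i a c) = csize c + 2"

definition act_on :: "nat \<Rightarrow> nat \<times> direction \<Rightarrow> nat list \<Rightarrow> (nat \<times> direction) list" where
  "act_on i a rs = (map (\<lambda>r. (r, Stay)) rs)[i := a]"

definition still :: "nat list \<Rightarrow> (nat \<times> direction) list" where
  "still rs = map (\<lambda>r. (r, Stay)) rs"

text \<open>The argument \<open>p\<close> is the state in which the code starts; it ends in state \<open>p + csize c\<close>.\<close>

fun compile :: "com \<Rightarrow> nat \<Rightarrow> machine" where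
  "compile Skip p = []"
| "compile (Write i a) p = [\<lambda>rs. (Suc p, act_on i (a, Stay) rs)]"
| "compile (Move i d) p = [\<lambda>rs. (Suc p, act_on i (rs ! i, d) rs)]"
| "compile (Seq c1 c2) p = compile c1 p @ compile c2 (p + csize c1)"
| "compile (Cond i a c1 c2) p =
     (\<lambda>rs. (if rs ! i = a then Suc p else p + csize c1 + 2, still rs)) #
     compile c1 (Suc p) @ (\<lambda>rs. (p + csize c1 + csize c2 + 2, still rs)) #
     compile c2 (p + csize c1 + 2)"
| "compile (Until i a c) p =
     (\<lambda>rs. (if rs ! i = a then p + csize c + 2 else Suc p, still rs)) #
     compile c (Suc p) @ [\<lambda>rs. (p, still rs)]"

lemma length_compile [simp]: "length (compile c p) = csize c"
  by (induction c arbitrary: p) auto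

fun uses :: "com \<Rightarrow> nat set" where
  "uses Skip = {}"
| "uses (Write i a) = {i}"
| "uses (Move i d) = {i}"
| "uses (Seq c1 c2) = uses c1 \<union> uses c2"
| "uses (Cond i a c1 c2) = insert i (uses c1 \<union> uses c2)"
| "uses (Until i a c) = insert i (uses c)"

fun symbs :: "com \<Rightarrow> nat set" where
  "symbs Skip = {}"
| "symbs (Write i a) = {a}"
| "symbs (Move i d) = {}"
| "symbs (Seq c1 c2) = symbs c1 \<union> symbs c2"
| "symbs (Cond i a c1 c2) = symbs c1 \<union> symbs c2"
| "symbs (Until i a c) = symbs c"

definition tapes :: "nat \<Rightarrow> store \<Rightarrow> tape list" where
  "tapes k s = map (\<lambda>i. (fst s i, snd s i)) [0..<k]"

lemma scanned_tapes: "map (\<lambda>(f, p). f p) (tapes k (C, h)) = map (\<lambda>i. C i (h i)) [0..<k]"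
  by (simp add: tapes_def)

lemma act_still:
  "map2 act (still (map (\<lambda>i. C i (h i)) [0..<k])) (tapes k (C, h)) = tapes k (C, h)"
  by (auto simp: still_def tapes_def list_eq_iff_nth_eq)

lemma act_act_on:
  assumes "i < k"
  shows "map2 act (act_on i (a, d) (map (\<lambda>i. C i (h i)) [0..<k])) (tapes k (C, h)) =
    tapes k (C(i := (C i)(h i := a)), h(i := move d (h i)))"
  using assms by (auto simp: act_on_def tapes_def list_eq_iff_nth_eq nth_list_update)

definition code_at :: "machine \<Rightarrow> nat \<Rightarrow> machine \<Rightarrow> bool" where
  "code_at M p cs \<longleftrightarrow> p + length cs \<le> length M \<and> (\<forall>i < length cs. M ! (p + i) = cs ! i)"

lemma code_at_Nil [simp]: "code_at M p [] \<longleftrightarrow> p \<le> length M"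
  by (simp add: code_at_def)

lemma code_at_Cons [simp]:
  "code_at M p (c # cs) \<longleftrightarrow> p < length M \<and> M ! p = c \<and> code_at M (Suc p) cs"
  by (auto simp: code_at_def nth_Cons split: nat.splits)

lemma code_at_append [simp]:
  "code_at M p (cs @ ds) \<longleftrightarrow> code_at M p cs \<and> code_at M (p + length cs) ds"
proof (induction cs arbitrary: p)
  case Nil
  then show ?case by (auto simp: code_at_def)
qed auto

lemma funpow_step_comp:
  assumes "(step M ^^ t1) x = y" "(step M ^^ t2) y = z"
  shows "(step M ^^ (t1 + t2)) x = z"
  using assms by (simp add: add.commute[of t1] funpow_add)

text \<open>
  A run of a program is a computation of its code with the same number of steps, as the steps for
  tests and jumps are counted in \<open>run\<close>.
\<close>

lemma run_compile:
  assumes "run c s t s'" "code_at M p (compile c p)" "uses c \<subseteq> {..<k}"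
  shows "(step M ^^ t) (p, tapes k s) = (p + csize c, tapes k s')"
  using assms
proof (induction arbitrary: p rule: run.induct)
  case (Skip s)
  then show ?case by simp
next
  case (Write i a C h)
  then show ?case by (simp add: scanned_tapes act_act_on)
next
  case (Move i d C h)
  then show ?case by (simp add: scanned_tapes act_act_on)
next
  case (Seq c1 s t1 s' c2 t2 s'')
  have "(step M ^^ t1) (p, tapes k s) = (p + csize c1, tapes k s')"
    using Seq.IH(1)[of p] Seq.prems by simp
  moreover have "(step M ^^ t2) (p + csize c1, tapes k s') = (p + csize c1 + csize c2, tapes k s'')"
    using Seq.IH(2)[of "p + csize c1"] Seq.prems by simp
  ultimately show ?case
    using funpow_step_comp by (simp add: add.assoc)
next
  case (CondTrue C i h a c1 t s' c2)
  have "(step M ^^ 1) (p, tapes k (C, h)) = (Suc p, tapes k (C, h))"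
    using CondTrue.prems CondTrue.hyps by (simp add: scanned_tapes act_still)
  moreover have "(step M ^^ t) (Suc p, tapes k (C, h)) = (Suc p + csize c1, tapes k s')"
    using CondTrue.IH[of "Suc p"] CondTrue.prems by simp
  moreover have "(step M ^^ 1) (Suc p + csize c1, tapes k s') =
      (p + csize c1 + csize c2 + 2, tapes k s')"
    using CondTrue.prems by (cases s') (simp add: scanned_tapes act_still)
  ultimately have "(step M ^^ (1 + t + 1)) (p, tapes k (C, h)) =
      (p + csize c1 + csize c2 + 2, tapes k s')"
    by (intro funpow_step_comp)
  then show ?case by (simp add: add.assoc del: funpow.simps)
next
  case (CondFalse C i h a c2 t s' c1)
  have "(step M ^^ 1) (p, tapes k (C, h)) = (p + csize c1 + 2, tapes k (C, h))"
    using CondFalse.prems CondFalse.hyps by (simp add: scanned_tapes act_still)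
  moreover have "(step M ^^ t) (p + csize c1 + 2, tapes k (C, h)) =
      (p + csize c1 + 2 + csize c2, tapes k s')"
    using CondFalse.IH[of "p + csize c1 + 2"] CondFalse.prems by simp
  ultimately have "(step M ^^ (1 + t)) (p, tapes k (C, h)) =
      (p + csize c1 + 2 + csize c2, tapes k s')"
    by (intro funpow_step_comp)
  then show ?case by (simp add: ac_simps del: funpow.simps)
next
  case (UntilExit C i h a c)
  then show ?case by (simp add: scanned_tapes act_still)
next
  case (UntilLoop C i h a c t1 s' t2 s'')
  have "(step M ^^ 1) (p, tapes k (C, h)) = (Suc p, tapes k (C, h))"
    using UntilLoop.prems UntilLoop.hyps by (simp add: scanned_tapes act_still)
  moreover have "(step M ^^ t1) (Suc p, tapes k (C, h)) = (Suc p + csize c, tapes k s')"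
    using UntilLoop.IH(1)[of "Suc p"] UntilLoop.prems by simp
  moreover have "(step M ^^ 1) (Suc p + csize c, tapes k s') = (p, tapes k s')"
    using UntilLoop.prems by (cases s') (simp add: scanned_tapes act_still)
  moreover have "(step M ^^ t2) (p, tapes k s') = (p + csize (Until i a c), tapes k s'')"
    using UntilLoop.IH(2)[of p] UntilLoop.prems by simp
  ultimately have "(step M ^^ (1 + t1 + 1 + t2)) (p, tapes k (C, h)) =
      (p + csize (Until i a c), tapes k s'')"
    by (intro funpow_step_comp)
  moreover have "1 + t1 + 1 + t2 = t1 + t2 + 2" by simp
  ultimately show ?case by (simp del: funpow.simps)
qed

lemma compile_transition:
  assumes "\<tau> \<in> set (compile c p)" "uses c \<subseteq> {..<k}" "symbs c \<subseteq> {..<K}"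
    and "length rs = k" "set rs \<subseteq> {..<K}"
  shows "fst (\<tau> rs) \<le> p + csize c \<and> length (snd (\<tau> rs)) = k \<and> fst ` set (snd (\<tau> rs)) \<subseteq> {..<K}"
proof -
  have still: "length (still rs) = k" "fst ` set (still rs) \<subseteq> {..<K}"
    using assms by (auto simp: still_def)
  have act_on: "length (act_on i (a, d) rs) = k \<and> fst ` set (act_on i (a, d) rs) \<subseteq> {..<K}"
    if "a < K" for i a d
  proof -
    have "set (act_on i (a, d) rs) \<subseteq> insert (a, d) (set (still rs))"
      unfolding act_on_def still_def by (rule set_update_subset_insert)
    then have "fst ` set (act_on i (a, d) rs) \<subseteq> insert a (fst ` set (still rs))" by auto
    then show ?thesis using still(2) that assms(4) by (auto simp: act_on_def)
  qed
  from assms(1-3) show ?thesis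
  proof (induction c arbitrary: p)
    case (Move i d)
    have "rs ! i < K"
      using assms(4,5) Move by (metis lessThan_iff nth_mem subset_eq uses.simps(3) insertI1)
    then show ?case using act_on Move by auto
  next
    case (Seq c1 c2)
    then show ?case by fastforce
  next
    case (Cond i a c1 c2)
    then show ?case using still by fastforce
  next
    case (Until i a c)
    then show ?case using still by fastforce
  qed (use act_on in auto)
qed


section \<open>Polynomially bounded functions\<close>

text \<open>As the base \<open>n + 2\<close> is at least 1, its powers are monotone in the exponent for every \<open>n\<close>.\<close>

definition poly_bounded :: "(nat \<Rightarrow> nat) \<Rightarrow> bool" where
  "poly_bounded f \<longleftrightarrow> (\<exists>c d. \<forall>n. f n \<le> c * (n + 2) ^ d)"

lemma poly_boundedE:
  assumes "poly_bounded f"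
  obtains c d where "\<And>n. f n \<le> c * n ^ d + c"
proof -
  obtain c d where cd: "\<And>n. f n \<le> c * (n + 2) ^ d"
    using assms unfolding poly_bounded_def by blast
  have "f n \<le> (c * 3 ^ d) * n ^ d + c * 3 ^ d" for n
  proof -
    have "(n + 2) ^ d \<le> 3 ^ d * n ^ d + 3 ^ d"
    proof (cases "n = 0")
      case True
      have "(2::nat) ^ d \<le> 3 ^ d" by (rule power_mono) auto
      then show ?thesis using True by (simp only: add_0)
    next
      case False
      then have "(n + 2) ^ d \<le> (3 * n) ^ d" by (intro power_mono) auto
      then show ?thesis by (simp add: power_mult_distrib)
    qed
    then have "c * (n + 2) ^ d \<le> c * (3 ^ d * n ^ d + 3 ^ d)" by (rule mult_left_mono) simp
    then show ?thesis using cd[of n] by (simp add: algebra_simps)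
  qed
  then show thesis using that by blast
qed

lemma poly_bounded_const [simp, intro]: "poly_bounded (\<lambda>_. c)"
  unfolding poly_bounded_def by (intro exI[of _ c] exI[of _ 0]) simp

lemma poly_bounded_id [simp, intro]: "poly_bounded (\<lambda>n. n)"
  unfolding poly_bounded_def by (intro exI[of _ 1]) simp

lemma poly_bounded_add [intro]:
  assumes "poly_bounded f" "poly_bounded g"
  shows "poly_bounded (\<lambda>n. f n + g n)"
proof -
  obtain c d c' d' where cd: "\<And>n. f n \<le> c * (n + 2) ^ d" "\<And>n. g n \<le> c' * (n + 2) ^ d'"
    using assms unfolding poly_bounded_def by metis
  have "f n + g n \<le> (c + c') * (n + 2) ^ (d + d')" for n
  proof -
    have "c * (n + 2) ^ d \<le> c * (n + 2) ^ (d + d')" "c' * (n + 2) ^ d' \<le> c' * (n + 2) ^ (d + d')"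
      by (intro mult_left_mono power_increasing; simp)+
    then show ?thesis using cd[of n] by (simp only: distrib_right)
  qed
  then show ?thesis unfolding poly_bounded_def by blast
qed

lemma poly_bounded_mult [intro]:
  assumes "poly_bounded f" "poly_bounded g"
  shows "poly_bounded (\<lambda>n. f n * g n)"
proof -
  obtain c d c' d' where cd: "\<And>n. f n \<le> c * (n + 2) ^ d" "\<And>n. g n \<le> c' * (n + 2) ^ d'"
    using assms unfolding poly_bounded_def by metis
  have "f n * g n \<le> (c * c') * (n + 2) ^ (d + d')" for n
    using mult_mono[OF cd(1)[of n] cd(2)[of n]] by (simp add: power_add algebra_simps)
  then show ?thesis unfolding poly_bounded_def by blast
qed

lemma poly_bounded_power [intro]: "poly_bounded f \<Longrightarrow> poly_bounded (\<lambda>n. f n ^ k)"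
  by (induction k) auto

text \<open>
  A program decides a language if it ends with tape \<open>i\<close> scanning \<open>a\<close> exactly on the members:
  one more transition turns this into acceptance or rejection.
\<close>

lemma program_in_class_P:
  assumes uses: "uses c \<subseteq> {..<k}" "i < k" and symbs: "symbs c \<subseteq> {..<K}" "4 \<le> K"
    and init: "\<And>x. tapes k (s0 x) = input_tape x # replicate (k - 1) blank_tape"
    and T: "poly_bounded T"
    and run: "\<And>x. \<exists>t \<le> T (length x). \<exists>C h. run c (s0 x) t (C, h) \<and> (C i (h i) = a \<longleftrightarrow> x \<in> L)"
  shows "L \<in> class_P"
proof -
  define M where "M = compile c 0 @
    [\<lambda>rs. (if rs ! i = a then Suc (csize c) else Suc (Suc (csize c)), still rs)]"
  have len: "length M = Suc (csize c)" by (simp add: M_def)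
  have "fst (\<tau> rs) \<le> Suc (length M) \<and> length (snd (\<tau> rs)) = k \<and> fst ` set (snd (\<tau> rs)) \<subseteq> {..<K}"
    if "\<tau> \<in> set M" "length rs = k" "set rs \<subseteq> {..<K}" for \<tau> rs
  proof (cases "\<tau> \<in> set (compile c 0)")
    case True
    then show ?thesis using compile_transition[OF True uses(1) symbs(1) that(2,3)] len by auto
  next
    case False
    then have "\<tau> = (\<lambda>rs. (if rs ! i = a then Suc (csize c) else Suc (Suc (csize c)), still rs))"
      using that(1) by (auto simp: M_def)
    then show ?thesis using that(2,3) len by (auto simp: still_def)
  qed
  then have tm: "turing_machine k K M"
    unfolding turing_machine_def using uses(2) symbs(2) by auto
  have "poly_bounded (\<lambda>n. T n + 1)" by (intro poly_bounded_add T poly_bounded_const)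
  then obtain b d where bd: "\<And>n. T n + 1 \<le> b * n ^ d + b" by (rule poly_boundedE) blast
  have "\<exists>t \<le> b * length x ^ d + b.
      fst ((step M ^^ t) (start_config k x)) = (if x \<in> L then length M else Suc (length M))" for x
  proof -
    obtain t C h where t: "t \<le> T (length x)" "run c (s0 x) t (C, h)"
      "C i (h i) = a \<longleftrightarrow> x \<in> L"
      using run[of x] by blast
    have start: "start_config k x = (0, tapes k (s0 x))"
      by (simp add: start_config_def init)
    have code: "code_at M 0 M" by (simp add: code_at_def)
    have "(step M ^^ t) (0, tapes k (s0 x)) = (csize c, tapes k (C, h))"
      using run_compile[OF t(2) _ uses(1), of M 0] code unfolding M_def by auto
    moreover have "(step M ^^ 1) (csize c, tapes k (C, h)) =
        (if x \<in> L then length M else Suc (length M), tapes k (C, h))"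
      using code uses(2) t(3) len
      by (simp add: M_def scanned_tapes act_still nth_append)
    ultimately have "(step M ^^ (t + 1)) (start_config k x) =
        (if x \<in> L then length M else Suc (length M), tapes k (C, h))"
      unfolding start by (rule funpow_step_comp)
    then show ?thesis
      using t(1) bd[of "length x"] by (intro exI[of _ "t + 1"]) auto
  qed
  then have "decides_in_time k M L (\<lambda>n. b * n ^ d + b)"
    by (simp add: decides_in_time_def)
  then show ?thesis unfolding class_P_def using tm by blast
qed

section \<open>Counters, loops and array access\<close>

definition runs :: "com \<Rightarrow> store \<Rightarrow> nat \<Rightarrow> store \<Rightarrow> bool" where
  "runs c s T s' \<longleftrightarrow> (\<exists>t \<le> T. run c s t s')"

lemma runs_mono: "runs c s T s' \<Longrightarrow> T \<le> T' \<Longrightarrow> runs c s T' s'"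
  unfolding runs_def by (meson order_trans)

lemma runs_Skip: "runs Skip s T s"
  unfolding runs_def using run.Skip by blast

lemma runs_Write: "runs (Write i a) (C, h) 1 (C(i := (C i)(h i := a)), h)"
  unfolding runs_def using run.Write by blast

lemma runs_Move: "runs (Move i d) (C, h) 1 (C, h(i := move d (h i)))"
  unfolding runs_def using run.Move by blast

lemma runs_Seq:
  "runs c1 s T1 s' \<Longrightarrow> runs c2 s' T2 s'' \<Longrightarrow> runs (Seq c1 c2) s (T1 + T2) s''"
  unfolding runs_def using run.Seq by (meson add_mono)

lemma runs_Cond:
  assumes "C i (h i) = a \<Longrightarrow> runs c1 (C, h) T s'"
    and "C i (h i) \<noteq> a \<Longrightarrow> runs c2 (C, h) T s'"
  shows "runs (Cond i a c1 c2) (C, h) (T + 2) s'"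
proof (cases "C i (h i) = a")
  case True
  then show ?thesis using assms(1) run.CondTrue unfolding runs_def by (meson add_le_mono1)
next
  case False
  then obtain t where "t \<le> T" "run c2 (C, h) t s'"
    using assms(2) unfolding runs_def by blast
  then show ?thesis using run.CondFalse[where C = C and i = i and h = h, OF False, of c2 t s' c1]
    unfolding runs_def by (intro exI[of _ "t + 1"]) auto
qed

text \<open>The stores \<open>S 0, \<dots>, S b\<close> are those at which the test is made.\<close>

lemma runs_Until:
  assumes "\<And>v. v < b \<Longrightarrow> fst (S v) i (snd (S v) i) \<noteq> a"
    and "\<And>v. v < b \<Longrightarrow> runs c (S v) T (S (Suc v))"
    and "fst (S b) i (snd (S b) i) = a"
  shows "runs (Until i a c) (S 0) (b * (T + 2) + 1) (S b)"
  using assms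
proof (induction b arbitrary: S)
  case 0
  then show ?case using run.UntilExit[of "fst (S 0)" i "snd (S 0)" a c]
    unfolding runs_def by auto
next
  case (Suc b)
  have "runs (Until i a c) (S (Suc 0)) (b * (T + 2) + 1) (S (Suc b))"
    by (rule Suc.IH[of "\<lambda>v. S (Suc v)"]) (use Suc.prems in auto)
  then obtain t where t: "t \<le> b * (T + 2) + 1" "run (Until i a c) (S (Suc 0)) t (S (Suc b))"
    unfolding runs_def by blast
  obtain t' where t': "t' \<le> T" "run c (fst (S 0), snd (S 0)) t' (S (Suc 0))"
    using Suc.prems(2)[of 0] unfolding runs_def by auto
  have "run (Until i a c) (fst (S 0), snd (S 0)) (t' + t + 2) (S (Suc b))"
    by (rule run.UntilLoop[OF _ t'(2) t(2)]) (use Suc.prems(1)[of 0] in auto)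
  moreover have "t' + t + 2 \<le> Suc b * (T + 2) + 1" using t(1) t'(1) by auto
  ultimately show ?case unfolding runs_def by (metis prod.collapse)
qed

definition rewind :: "nat \<Rightarrow> com" where
  "rewind i = Until i 1 (Move i Left)"

lemma runs_rewind:
  assumes "C i 0 = 1" "\<And>p. 0 < p \<Longrightarrow> C i p \<noteq> 1"
  shows "runs (rewind i) (C, h) (3 * h i + 1) (C, h(i := 0))"
proof -
  define S where "S v = (C, h(i := h i - v))" for v
  have "runs (Until i 1 (Move i Left)) (S 0) (h i * (1 + 2) + 1) (S (h i))"
  proof (rule runs_Until)
    fix v assume "v < h i"
    then show "runs (Move i Left) (S v) 1 (S (Suc v))"
      using runs_Move[of i Left C "h(i := h i - v)"] by (simp add: S_def)
  qed (use assms in \<open>auto simp: S_def\<close>)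
  moreover have "h i * (1 + 2) + 1 = 3 * h i + 1" by simp
  ultimately show ?thesis unfolding rewind_def S_def by (metis diff_zero diff_self_eq_0 fun_upd_triv)
qed

text \<open>
  The head position of a counter tape is its value. The symbol 2 marks the bound \<open>b\<close>.
\<close>

definition counter :: "nat \<Rightarrow> nat \<Rightarrow> nat" where
  "counter b = (\<lambda>p. if p = 0 then 1 else if p = b then 2 else 0)"

text \<open>
  After its loop a counter is set back to 0, so that the loop can be run again inside of another.
\<close>

definition For :: "nat \<Rightarrow> com \<Rightarrow> com" where
  "For i c = Seq (Until i 2 (Seq c (Move i Right))) (rewind i)"

definition nest :: "nat list \<Rightarrow> com \<Rightarrow> com" where
  "nest js c = foldr For js c"

lemma nest_simps [simp]: "nest [] c = c" "nest (j # js) c = For j (nest js c)"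
  by (simp_all add: nest_def)

text \<open>
  The contents and heads before round \<open>v\<close> are \<open>C v\<close> and \<open>h v\<close>, except for the head of the counter.
\<close>

lemma runs_For:
  assumes "0 < b" and C: "\<And>v. v \<le> b \<Longrightarrow> C v i = counter b"
    and body: "\<And>v. v < b \<Longrightarrow> runs c (C v, (h v)(i := v)) T (C (Suc v), (h (Suc v))(i := v))"
  shows "runs (For i c) (C 0, (h 0)(i := 0)) (b * (T + 6) + 2) (C b, (h b)(i := 0))"
proof -
  define S where "S v = (C v, (h v)(i := v))" for v
  have "runs (Until i 2 (Seq c (Move i Right))) (S 0) (b * ((T + 1) + 2) + 1) (S b)"
  proof (rule runs_Until)
    fix v assume v: "v < b"
    have "runs (Move i Right) (C (Suc v), (h (Suc v))(i := v)) 1 (S (Suc v))"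
      using runs_Move[of i Right "C (Suc v)" "(h (Suc v))(i := v)"] by (simp add: S_def)
    then show "runs (Seq c (Move i Right)) (S v) (T + 1) (S (Suc v))"
      using body[OF v] runs_Seq unfolding S_def by blast
  qed (use C assms(1) in \<open>auto simp: S_def counter_def\<close>)
  moreover have "runs (rewind i) (S b) (3 * b + 1) (C b, (h b)(i := 0))"
    using runs_rewind[of "C b" i "(h b)(i := b)"] C[of b] assms(1)
    by (simp add: S_def counter_def)
  ultimately have "runs (For i c) (S 0)
      ((b * ((T + 1) + 2) + 1) + (3 * b + 1)) (C b, (h b)(i := 0))"
    unfolding For_def by (rule runs_Seq)
  then show ?thesis by (simp add: S_def algebra_simps)
qed

definition shift :: "nat set \<Rightarrow> nat \<Rightarrow> (nat \<Rightarrow> nat) \<Rightarrow> nat \<Rightarrow> nat" where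
  "shift B m h = (\<lambda>i. if i \<in> B then h i + m else h i)"

lemma shift_add: "shift B m (shift B m' h) = shift B (m + m') h"
  by (auto simp: shift_def)

lemma shift_zero [simp]: "shift B 0 h = h"
  by (auto simp: shift_def)

lemma shift_fun_upd: "i \<notin> B \<Longrightarrow> shift B m (h(i := v)) = (shift B m h)(i := v)"
  by (auto simp: shift_def)

definition advance :: "nat list \<Rightarrow> com" where
  "advance L = foldr (\<lambda>i. Seq (Move i Right)) L Skip"

lemma runs_advance:
  "distinct L \<Longrightarrow> runs (advance L) (C, h) (length L) (C, shift (set L) 1 h)"
proof (induction L arbitrary: h)
  case Nil
  then show ?case using runs_Skip by (simp add: advance_def shift_def)
next
  case (Cons i L)
  have "runs (Move i Right) (C, h) 1 (C, h(i := Suc (h i)))"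
    using runs_Move[of i Right] by simp
  moreover have "runs (advance L) (C, h(i := Suc (h i))) (length L)
      (C, shift (set L) 1 (h(i := Suc (h i))))"
    using Cons by simp
  moreover have "shift (set L) 1 (h(i := Suc (h i))) = shift (set (i # L)) 1 h"
    using Cons.prems by (auto simp: shift_def)
  ultimately show ?case using runs_Seq[of "Move i Right"] by (fastforce simp: advance_def)
qed

fun nest_time :: "nat \<Rightarrow> nat \<Rightarrow> nat \<Rightarrow> nat" where
  "nest_time m 0 b = m"
| "nest_time m (Suc d) b = b * (nest_time m d b + 6) + 2"

lemma poly_bounded_nest_time: "poly_bounded f \<Longrightarrow> poly_bounded (\<lambda>n. nest_time m d (f n))"
  by (induction d) (auto simp del: add_2_eq_Suc' intro!: poly_bounded_add poly_bounded_mult)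

text \<open>Nested loops carry heads by powers of the bound: this is how products are computed.\<close>

lemma runs_nest_advance:
  assumes "0 < b" "distinct L" "distinct js" "set js \<inter> set L = {}"
    and "\<And>j. j \<in> set js \<Longrightarrow> C j = counter b \<and> h j = 0"
  shows "runs (nest js (advance L)) (C, h) (nest_time (length L) (length js) b)
    (C, shift (set L) (b ^ length js) h)"
  using assms(3-)
proof (induction js arbitrary: h)
  case Nil
  then show ?case using runs_advance[OF assms(2)] by simp
next
  case (Cons j js)
  let ?m = "b ^ length js"
  have j: "j \<notin> set L" "j \<notin> set js" using Cons.prems by auto
  have "runs (For j (nest js (advance L))) (C, (shift (set L) (0 * ?m) h)(j := 0))
      (b * (nest_time (length L) (length js) b + 6) + 2) (C, (shift (set L) (b * ?m) h)(j := 0))"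
  proof (rule runs_For[OF assms(1), of "\<lambda>_. C" j _ "\<lambda>v. shift (set L) (v * ?m) h"])
    fix v assume "v < b"
    have "runs (nest js (advance L)) (C, (shift (set L) (v * ?m) h)(j := v))
      (nest_time (length L) (length js) b)
      (C, shift (set L) ?m ((shift (set L) (v * ?m) h)(j := v)))"
      by (rule Cons.IH) (use Cons.prems j in \<open>auto simp: shift_def\<close>)
    then show "runs (nest js (advance L)) (C, (shift (set L) (v * ?m) h)(j := v))
      (nest_time (length L) (length js) b)
      (C, (shift (set L) (Suc v * ?m) h)(j := v))"
      by (simp add: shift_fun_upd[OF j(1)] shift_add)
  qed (use Cons.prems in auto)
  moreover have "h(j := 0) = h" using Cons.prems by auto
  moreover have "(shift (set L) (b * ?m) h)(j := 0) = shift (set L) (b * ?m) h"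
    using Cons.prems j by (auto simp: shift_def)
  ultimately show ?case by simp
qed

text \<open>
  The body is run as many times as the value of tape \<open>v\<close>, which is moved to tape \<open>u\<close> and back.
\<close>

definition loop_times :: "nat \<Rightarrow> nat \<Rightarrow> com \<Rightarrow> com" where
  "loop_times v u c = Seq (Until v 1 (Seq (Move v Left) (Seq (Move u Right) c)))
     (Until u 1 (Seq (Move u Left) (Move v Right)))"

lemma runs_loop_times:
  assumes ne: "v \<noteq> u" "v \<noteq> A" "u \<noteq> A"
    and C: "C v 0 = 1" "\<And>p. 0 < p \<Longrightarrow> C v p \<noteq> 1" "C u 0 = 1" "\<And>p. 0 < p \<Longrightarrow> C u p \<noteq> 1"
    and hu: "h u = 0"
    and body: "\<And>h'. (\<And>i. i \<notin> {v, u, A} \<Longrightarrow> h' i = h i) \<Longrightarrow>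
      runs c (C, h') T (C, shift {A} m h')"
  shows "runs (loop_times v u c) (C, h) (h v * (T + 8) + 2) (C, shift {A} (h v * m) h)"
proof -
  let ?n = "h v"
  define S where "S w = (C, (shift {A} (w * m) h)(v := ?n - w, u := w))" for w
  define S' where "S' w = (C, (shift {A} (?n * m) h)(v := w, u := ?n - w))" for w
  have "runs (Until v 1 (Seq (Move v Left) (Seq (Move u Right) c))) (S 0)
      (?n * ((1 + (1 + T)) + 2) + 1) (S ?n)"
  proof (rule runs_Until)
    fix w assume w: "w < ?n"
    let ?h = "shift {A} (w * m) h"
    have "runs (Move v Left) (S w) 1 (C, ?h(v := ?n - Suc w, u := w))"
      using runs_Move[of v Left C "?h(v := ?n - w, u := w)"] ne w
      by (simp add: S_def fun_upd_twist)
    moreover have "runs (Move u Right) (C, ?h(v := ?n - Suc w, u := w)) 1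
        (C, ?h(v := ?n - Suc w, u := Suc w))"
      using runs_Move[of u Right C "?h(v := ?n - Suc w, u := w)"] by simp
    moreover have "runs c (C, ?h(v := ?n - Suc w, u := Suc w)) T (S (Suc w))"
    proof -
      have "shift {A} m (?h(v := ?n - Suc w, u := Suc w)) =
          (shift {A} (Suc w * m) h)(v := ?n - Suc w, u := Suc w)"
        using ne by (auto simp: shift_def)
      then show ?thesis
        using body[of "?h(v := ?n - Suc w, u := Suc w)"] by (simp add: S_def shift_def)
    qed
    ultimately show "runs (Seq (Move v Left) (Seq (Move u Right) c)) (S w)
        (1 + (1 + T)) (S (Suc w))"
      by (intro runs_Seq)
  qed (use C ne in \<open>auto simp: S_def\<close>)
  moreover have "runs (Until u 1 (Seq (Move u Left) (Move v Right))) (S' 0)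
      (?n * ((1 + 1) + 2) + 1) (S' ?n)"
  proof (rule runs_Until)
    fix w assume w: "w < ?n"
    let ?h = "shift {A} (?n * m) h"
    have "runs (Move u Left) (S' w) 1 (C, ?h(v := w, u := ?n - Suc w))"
      using runs_Move[of u Left C "?h(v := w, u := ?n - w)"] w
      by (simp add: S'_def)
    moreover have "runs (Move v Right) (C, ?h(v := w, u := ?n - Suc w)) 1 (S' (Suc w))"
      using runs_Move[of v Right C "?h(v := w, u := ?n - Suc w)"] ne
      by (simp add: S'_def fun_upd_twist)
    ultimately show "runs (Seq (Move u Left) (Move v Right)) (S' w) (1 + 1) (S' (Suc w))"
      by (intro runs_Seq)
  qed (use C ne in \<open>auto simp: S'_def\<close>)
  moreover have "S ?n = S' 0" by (simp add: S_def S'_def)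
  ultimately have "runs (loop_times v u c) (S 0)
      ((?n * ((1 + (1 + T)) + 2) + 1) + (?n * ((1 + 1) + 2) + 1)) (S' ?n)"
    unfolding loop_times_def by (metis runs_Seq)
  moreover have "S 0 = (C, h)" using hu by (auto simp: S_def)
  moreover have "S' ?n = (C, shift {A} (?n * m) h)"
    using hu ne by (auto simp: S'_def shift_def)
  moreover have "(?n * ((1 + (1 + T)) + 2) + 1) + (?n * ((1 + 1) + 2) + 1) = ?n * (T + 8) + 2"
    by (simp add: add_mult_distrib2)
  ultimately show ?thesis by metis
qed


section \<open>Horn programs\<close>

text \<open>
  The variables of a rule range over \<open>{..<N}\<close>, and terms over \<open>{..N}\<close>. Besides derived relations, a
  rule may test which symbol stands at a position of the input tape. The cell to the left of the
  input, with symbol 1, identifies the number 0.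
\<close>

datatype hterm = Var nat | Succ nat

fun tval :: "(nat \<Rightarrow> nat) \<Rightarrow> hterm \<Rightarrow> nat" where
  "tval \<sigma> (Var v) = \<sigma> v"
| "tval \<sigma> (Succ v) = Suc (\<sigma> v)"

fun tvar :: "hterm \<Rightarrow> nat" where
  "tvar (Var v) = v"
| "tvar (Succ v) = v"

type_synonym 'r hatom = "'r \<times> hterm list"
type_synonym 'r hrule = "'r hatom \<times> (nat \<times> nat) list \<times> 'r hatom list"

inductive derives :: "'r hrule list \<Rightarrow> nat \<Rightarrow> (nat \<Rightarrow> nat) \<Rightarrow> 'r \<Rightarrow> nat list \<Rightarrow> bool"
  for P N inp where
  rule: "((r, ts), ins, body) \<in> set P \<Longrightarrow> (\<And>v. \<sigma> v < N) \<Longrightarrow>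
    (\<forall>(s, v) \<in> set ins. inp (\<sigma> v) = s) \<Longrightarrow>
    (\<forall>b \<in> set body. derives P N inp (fst b) (map (tval \<sigma>) (snd b))) \<Longrightarrow>
    derives P N inp r (map (tval \<sigma>) ts)"

definition input_symbol :: "bool list \<Rightarrow> nat \<Rightarrow> nat" where
  "input_symbol x = fst (input_tape x)"

fun index :: "nat \<Rightarrow> nat list \<Rightarrow> nat" where
  "index b [] = 0"
| "index b (y # ys) = y * b ^ length ys + index b ys"

lemma index_less: "set ys \<subseteq> {..<b} \<Longrightarrow> index b ys < b ^ length ys"
proof (induction ys)
  case (Cons y ys)
  then have "Suc y * b ^ length ys \<le> b * b ^ length ys" by (intro mult_right_mono) auto
  then show ?case using Cons by simp
qed auto

lemma index_inject:
  assumes "length ys = length zs" "set ys \<subseteq> {..<b}" "set zs \<subseteq> {..<b}" "index b ys = index b zs"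
  shows "ys = zs"
  using assms
proof (induction ys zs rule: list_induct2)
  case (Cons y ys z zs)
  have l: "index b ys < b ^ length ys" "index b zs < b ^ length ys"
    using Cons.prems Cons.hyps index_less[of ys b] index_less[of zs b] by auto
  have e: "y * b ^ length ys + index b ys = z * b ^ length ys + index b zs"
    using Cons.prems Cons.hyps by simp
  have "index b ys = index b zs"
    using arg_cong[OF e, of "\<lambda>i. i mod b ^ length ys"] l by simp
  moreover have "y = z"
    using arg_cong[OF e, of "\<lambda>i. i div b ^ length ys"] l
    by (metis add.commute div_less div_mult_self3 add_0 less_nat_zero_code)
  ultimately show ?case using Cons by simp
qed auto

section \<open>Evaluating Horn programs in polynomial time\<close>

locale horn_machine =
  fixes P :: "'r::countable hrule list" and goal :: 'r and ar :: "'r \<Rightarrow> nat" and e nv a :: nat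
  assumes e_pos: "0 < e"
    and head_wf: "\<And>r ts ins body. ((r, ts), ins, body) \<in> set P \<Longrightarrow>
      length ts = ar r \<and> ar r \<le> a \<and> (\<forall>t \<in> set ts. tvar t < nv)"
    and body_wf: "\<And>hd ins body r ts. (hd, ins, body) \<in> set P \<Longrightarrow> (r, ts) \<in> set body \<Longrightarrow>
      length ts = ar r \<and> ar r \<le> a \<and> (\<forall>t \<in> set ts. tvar t < nv)"
    and ins_wf: "\<And>hd ins body s v. (hd, ins, body) \<in> set P \<Longrightarrow> (s, v) \<in> set ins \<Longrightarrow> v < nv"
    and goal_wf: "ar goal = 0"
begin

text \<open>
  Tape 0 is the input. Then come \<open>e\<close> counters with bound \<open>length x + 2\<close>, which serve to mark the
  bound \<open>N = (length x + 2) ^ e\<close> on the remaining counters: one for each variable, \<open>w\<close> for the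
  rounds, and \<open>2 * a\<close> for computing addresses. A scratch tape and one tape for each relation follow.
\<close>

definition w :: nat where "w = length P + 2 * a"
definition vt :: "nat \<Rightarrow> nat" where "vt v = e + 1 + v"
definition vars :: "nat list" where "vars = [e + 1..<e + 1 + nv]"
definition rounds :: "nat list" where "rounds = [e + 1 + nv..<e + 1 + nv + w]"
definition aux :: "nat list" where "aux = [e + 1 + nv + w..<e + 1 + nv + w + 2 * a]"
definition tmp :: nat where "tmp = e + 1 + nv + w + 2 * a"
definition rt :: "'r \<Rightarrow> nat" where "rt r = tmp + 1 + to_nat r"

definition bnd :: "nat \<Rightarrow> nat" where "bnd n = (n + 2) ^ e"

abbreviation N :: "bool list \<Rightarrow> nat" where "N x \<equiv> bnd (length x)"

lemma poly_bounded_bnd: "poly_bounded bnd"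
  unfolding bnd_def by (intro poly_bounded_power poly_bounded_add poly_bounded_id poly_bounded_const)

lemma N_ge2: "2 \<le> N x"
proof -
  have "2 ^ 1 \<le> (2::nat) ^ e" using e_pos by (intro power_increasing) auto
  also have "\<dots> \<le> N x" unfolding bnd_def by (rule power_mono) auto
  finally show ?thesis by simp
qed

text \<open>
  The fact \<open>(r, ys)\<close> is represented by the symbol 2 in the cell whose address has the digits \<open>ys\<close>
  in base \<open>N\<^sup>2\<close>; the base \<open>N\<close> is too small, as arguments range over \<open>{..N}\<close>.
\<close>

definition fact_cell :: "bool list \<Rightarrow> ('r \<times> nat list) set \<Rightarrow> nat \<Rightarrow> nat \<Rightarrow> bool" where
  "fact_cell x F i p \<longleftrightarrow> (\<exists>r ys. (r, ys) \<in> F \<and> rt r = i \<and> length ys = ar r \<and> set ys \<subseteq> {..N x} \<and>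
     p = Suc (index ((N x)\<^sup>2) ys))"

definition cont :: "bool list \<Rightarrow> ('r \<times> nat list) set \<Rightarrow> nat \<Rightarrow> nat \<Rightarrow> nat" where
  "cont x F i =
     (if i = 0 then input_symbol x
      else if i \<le> e then counter (length x + 2)
      else if i < tmp then counter (N x)
      else (\<lambda>p. if p = 0 then 1 else if fact_cell x F i p then 2 else 0))"

lemma cont_vt: "v < nv \<Longrightarrow> cont x F (vt v) = counter (N x)"
  by (simp add: cont_def vt_def tmp_def)

lemma cont_loop: "i \<in> set vars \<union> set rounds \<union> set aux \<Longrightarrow> cont x F i = counter (N x)"
  by (auto simp: cont_def tmp_def vars_def rounds_def aux_def)

lemma cont_tmp: "cont x F tmp = (\<lambda>_. 0)(0 := 1)"
  by (auto simp: cont_def tmp_def fact_cell_def rt_def)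

lemma cont_rt: "cont x F (rt r) = (\<lambda>p. if p = 0 then 1 else if fact_cell x F (rt r) p then 2 else 0)"
  by (simp add: cont_def) (simp add: rt_def tmp_def)

lemma inj_rt: "rt r = rt r' \<Longrightarrow> r = r'"
  by (simp add: rt_def)

lemma lt_N_sq: "y \<le> N x \<Longrightarrow> y < (N x)\<^sup>2"
proof -
  have "N x * 1 < N x * N x" using N_ge2[of x] by (intro mult_strict_left_mono) auto
  then show "y \<le> N x \<Longrightarrow> y < (N x)\<^sup>2" unfolding power2_eq_square by linarith
qed

lemma fact_cell_iff:
  assumes "length ys = ar r" "set ys \<subseteq> {..N x}"
  shows "fact_cell x F (rt r) (Suc (index ((N x)\<^sup>2) ys)) \<longleftrightarrow> (r, ys) \<in> F"
proof -
  have "ys = zs" if "length zs = ar r" "set zs \<subseteq> {..N x}"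
    "index ((N x)\<^sup>2) ys = index ((N x)\<^sup>2) zs" for zs
  proof (rule index_inject)
    show "set ys \<subseteq> {..<(N x)\<^sup>2}" "set zs \<subseteq> {..<(N x)\<^sup>2}"
      using that(2) assms(2) lt_N_sq[of _ x] by auto
  qed (use that assms in auto)
  then show ?thesis using assms unfolding fact_cell_def by (auto dest: inj_rt)
qed

lemma cont_insert:
  assumes "length ys = ar r" "set ys \<subseteq> {..N x}"
  shows "cont x (insert (r, ys) F) =
    (cont x F)(rt r := (cont x F (rt r))(Suc (index ((N x)\<^sup>2) ys) := 2))"
proof -
  have "fact_cell x (insert (r, ys) F) i p \<longleftrightarrow>
      fact_cell x F i p \<or> i = rt r \<and> p = Suc (index ((N x)\<^sup>2) ys)" for i p
    using assms by (auto simp: fact_cell_def)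
  moreover have "rt r \<noteq> 0" "\<not> rt r \<le> e" "\<not> rt r < tmp" by (auto simp: rt_def tmp_def)
  ultimately show ?thesis by (auto simp: cont_def fun_eq_iff)
qed

subsection \<open>Access to the relations\<close>

text \<open>
  To reach the cell of a fact, the head of \<open>A\<close> makes, for each digit \<open>y\<close>, \<open>y\<close> times the steps of a
  nest of loops with bound \<open>N\<close>, two for every digit to the right, as the base is \<open>N\<^sup>2\<close>.
\<close>

fun goto :: "nat \<Rightarrow> hterm list \<Rightarrow> com" where
  "goto A [] = Skip"
| "goto A (t # ts) =
     (let c = nest (take (2 * length ts) aux) (advance [A])
      in Seq (loop_times (vt (tvar t)) tmp c)
           (Seq (case t of Var _ \<Rightarrow> Skip | Succ _ \<Rightarrow> c) (goto A ts)))"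

fun goto_time :: "nat \<Rightarrow> nat \<Rightarrow> nat" where
  "goto_time 0 b = 0"
| "goto_time (Suc n) b =
     (b * (nest_time 1 (2 * n) b + 8) + 2) + (nest_time 1 (2 * n) b + goto_time n b)"

lemma poly_bounded_goto_time: "poly_bounded f \<Longrightarrow> poly_bounded (\<lambda>n. goto_time d (f n))"
  by (induction d)
     (auto simp del: add_2_eq_Suc' intro!: poly_bounded_add poly_bounded_mult poly_bounded_nest_time)

lemma runs_goto:
  assumes A: "A = 0 \<or> tmp < A" and "length ts \<le> a"
    and "\<And>i. i \<in> insert tmp (set aux) \<Longrightarrow> h i = 0"
    and "\<And>t. t \<in> set ts \<Longrightarrow> tvar t < nv \<and> h (vt (tvar t)) < N x"
  shows "runs (goto A ts) (cont x F, h) (goto_time (length ts) (N x))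
    (cont x F, shift {A} (index ((N x)\<^sup>2) (map (tval (\<lambda>v. h (vt v))) ts)) h)"
  using assms(2-)
proof (induction ts arbitrary: h)
  case Nil
  then show ?case using runs_Skip by simp
next
  case (Cons t ts)
  define js where "js = take (2 * length ts) aux"
  define c where "c = nest js (advance [A])"
  define m where "m = (N x)\<^sup>2 ^ length ts"
  have js: "set js \<subseteq> set aux" "distinct js" by (auto simp: js_def aux_def dest: in_set_takeD)
  have len: "length js = 2 * length ts" using Cons.prems(1) unfolding js_def aux_def length_take length_upt
    by (auto simp: min_def)
  have A_notin: "A \<notin> set aux" "A \<noteq> tmp" "A \<noteq> vt v" if "v < nv" for v
    using A that by (auto simp: aux_def tmp_def vt_def)
  let ?v = "tvar t"
  have v: "?v < nv" "h (vt ?v) < N x" using Cons.prems(3) by auto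
  note A_notin = A_notin(1)[OF v(1)] A_notin(2)[OF v(1)] A_notin(3)
  have vt_notin: "vt ?v \<noteq> tmp" "vt ?v \<notin> set aux" "tmp \<notin> set aux"
    using v by (auto simp: vt_def tmp_def aux_def)
  have c: "runs c (cont x F, h') (nest_time 1 (2 * length ts) (N x))
      (cont x F, shift {A} m h')" if "\<And>i. i \<in> set aux \<Longrightarrow> h' i = 0" for h'
  proof -
    have "runs (nest js (advance [A])) (cont x F, h')
        (nest_time (length [A]) (length js) (N x)) (cont x F, shift (set [A]) (N x ^ length js) h')"
    proof (rule runs_nest_advance)
      show "set js \<inter> set [A] = {}" using js A_notin by auto
      fix j assume "j \<in> set js"
      then show "cont x F j = counter (N x) \<and> h' j = 0"
        using js(1) that cont_loop by blast
    qed (use js N_ge2[of x] in auto)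
    then show ?thesis by (simp add: c_def len m_def power_mult)
  qed
  have 1: "runs (loop_times (vt ?v) tmp c) (cont x F, h)
      (N x * (nest_time 1 (2 * length ts) (N x) + 8) + 2)
      (cont x F, shift {A} (h (vt ?v) * m) h)"
  proof (rule runs_mono)
    show "runs (loop_times (vt ?v) tmp c) (cont x F, h)
      (h (vt ?v) * (nest_time 1 (2 * length ts) (N x) + 8) + 2)
      (cont x F, shift {A} (h (vt ?v) * m) h)"
    proof (rule runs_loop_times)
      fix h' assume h': "\<And>i. i \<notin> {vt ?v, tmp, A} \<Longrightarrow> h' i = h i"
      have "h' i = 0" if "i \<in> set aux" for i
      proof -
        have "i \<notin> {vt ?v, tmp, A}" using that A_notin vt_notin by auto
        then show ?thesis using h' Cons.prems(2) that by simp
      qed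
      then show "runs c (cont x F, h') (nest_time 1 (2 * length ts) (N x))
          (cont x F, shift {A} m h')" by (rule c)
    qed (use v A_notin vt_notin Cons.prems(2) in \<open>auto simp: cont_vt cont_tmp counter_def\<close>)
  qed (use v(2) in simp)
  define h1 where "h1 = shift {A} (h (vt ?v) * m) h"
  have h1_eq: "h1 i = h i" if "i \<noteq> A" for i using that by (simp add: h1_def shift_def)
  have h1_aux: "h1 i = 0" if "i \<in> insert tmp (set aux)" for i
  proof -
    have "i \<noteq> A" using that A_notin by auto
    then show ?thesis using that h1_eq Cons.prems(2) by simp
  qed
  define h2 where "h2 = shift {A} (tval (\<lambda>v. h (vt v)) t * m) h"
  have 2: "runs (case t of Var _ \<Rightarrow> Skip | Succ _ \<Rightarrow> c) (cont x F, h1)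
      (nest_time 1 (2 * length ts) (N x)) (cont x F, h2)"
  proof (cases t)
    case (Var v')
    then show ?thesis using runs_mono[OF runs_Skip le0] by (simp add: h1_def h2_def)
  next
    case (Succ v')
    then have "h2 = shift {A} m h1" by (simp add: h1_def h2_def shift_add)
    then show ?thesis using Succ c[of h1] h1_aux by simp
  qed
  have h2_eq: "h2 i = h i" if "i \<noteq> A" for i using that by (simp add: h2_def shift_def)
  have h2_aux: "h2 i = 0" if "i \<in> insert tmp (set aux)" for i
  proof -
    have "i \<noteq> A" using that A_notin by auto
    then show ?thesis using that h2_eq Cons.prems(2) by simp
  qed
  have eq: "map (tval (\<lambda>v. h2 (vt v))) ts = map (tval (\<lambda>v. h (vt v))) ts"
  proof (rule map_cong[OF refl])
    fix u assume "u \<in> set ts"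
    then have "h2 (vt (tvar u)) = h (vt (tvar u))" using Cons.prems(3) h2_eq A_notin(3) by (metis list.set_intros(2))
    then show "tval (\<lambda>v. h2 (vt v)) u = tval (\<lambda>v. h (vt v)) u" by (cases u) auto
  qed
  have "runs (goto A ts) (cont x F, h2) (goto_time (length ts) (N x))
    (cont x F, shift {A} (index ((N x)\<^sup>2) (map (tval (\<lambda>v. h2 (vt v))) ts)) h2)"
  proof (rule Cons.IH)
    fix u assume u: "u \<in> set ts"
    then have "h2 (vt (tvar u)) = h (vt (tvar u))" using Cons.prems(3) h2_eq A_notin(3) by (metis list.set_intros(2))
    then show "tvar u < nv \<and> h2 (vt (tvar u)) < N x" using Cons.prems(3) u by simp
  qed (use Cons.prems(1) h2_aux in auto)
  then have 3: "runs (goto A ts) (cont x F, h2) (goto_time (length ts) (N x))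
    (cont x F, shift {A} (index ((N x)\<^sup>2) (map (tval (\<lambda>v. h (vt v))) (t # ts))) h)"
    unfolding eq by (simp add: h2_def shift_add m_def add.commute)
  show ?case
    using runs_Seq[OF 1 runs_Seq[OF 2[unfolded h1_def] 3]]
    by (cases t) (simp_all add: Let_def c_def js_def)
qed

definition heads :: "nat set \<Rightarrow> bool list \<Rightarrow> (nat \<Rightarrow> nat) \<Rightarrow> bool" where
  "heads X x h \<longleftrightarrow> (\<forall>i. if i \<in> X then h i < N x else h i = 0)"

text \<open>
  A command that \<open>does\<close> \<open>g\<close> transforms the stored set of facts by \<open>g\<close>, in polynomial time, and
  returns all heads to where they were. The counters in \<open>X\<close> belong to enclosing loops.
\<close>

definition does :: "com \<Rightarrow> nat set \<Rightarrow>
    (bool list \<Rightarrow> (nat \<Rightarrow> nat) \<Rightarrow> ('r \<times> nat list) set \<Rightarrow> ('r \<times> nat list) set) \<Rightarrow> bool" where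
  "does c X g \<longleftrightarrow> (\<exists>T. poly_bounded T \<and>
     (\<forall>x F h. heads X x h \<longrightarrow>
        runs c (cont x F, h) (T (length x)) (cont x (g x h F), h)))"

lemma does_cong: "does c X g \<Longrightarrow> (\<And>x h F. heads X x h \<Longrightarrow> g x h F = g' x h F) \<Longrightarrow> does c X g'"
  unfolding does_def by metis

lemma does_Skip: "does Skip X (\<lambda>x h F. F)"
  unfolding does_def using runs_Skip poly_bounded_const runs_mono by blast

lemma does_Seq:
  assumes "does c1 X g1" "does c2 X g2"
  shows "does (Seq c1 c2) X (\<lambda>x h F. g2 x h (g1 x h F))"
proof -
  obtain T1 where T1: "poly_bounded T1" "\<And>x F h. heads X x h \<Longrightarrow>
      runs c1 (cont x F, h) (T1 (length x)) (cont x (g1 x h F), h)"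
    using assms(1) unfolding does_def by blast
  obtain T2 where T2: "poly_bounded T2" "\<And>x F h. heads X x h \<Longrightarrow>
      runs c2 (cont x F, h) (T2 (length x)) (cont x (g2 x h F), h)"
    using assms(2) unfolding does_def by blast
  show ?thesis unfolding does_def
    by (intro exI[of _ "\<lambda>n. T1 n + T2 n"] conjI poly_bounded_add T1(1) T2(1) allI impI
        runs_Seq[OF T1(2) T2(2)])
qed

lemma does_For:
  assumes "does c (insert i X) g" "i \<notin> X" "i \<in> set vars \<union> set rounds"
  shows "does (For i c) X (\<lambda>x h F. fold (\<lambda>v. g x (h(i := v))) [0..<N x] F)"
proof -
  obtain T where T: "poly_bounded T" "\<And>x F h. heads (insert i X) x h \<Longrightarrow>
      runs c (cont x F, h) (T (length x)) (cont x (g x h F), h)"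
    using assms(1) unfolding does_def by blast
  have "runs (For i c) (cont x F, h) (N x * (T (length x) + 6) + 2)
      (cont x (fold (\<lambda>v. g x (h(i := v))) [0..<N x] F), h)" if h: "heads X x h" for x F h
  proof -
    define S where "S v = fold (\<lambda>v. g x (h(i := v))) [0..<v] F" for v
    have "runs (For i c) (cont x (S 0), h(i := 0)) (N x * (T (length x) + 6) + 2)
      (cont x (S (N x)), h(i := 0))"
    proof (rule runs_For[where h = "\<lambda>_. h" and C = "\<lambda>v. cont x (S v)"])
      fix v assume "v < N x"
      then have "heads (insert i X) x (h(i := v))" using h unfolding heads_def by (metis fun_upd_apply insert_iff)
      from T(2)[OF this, of "S v"]
      show "runs c (cont x (S v), h(i := v)) (T (length x)) (cont x (S (Suc v)), h(i := v))"
        by (simp add: S_def)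
    qed (use assms(3) cont_loop N_ge2[of x] in auto)
    moreover have "h i = 0" using h assms(2) unfolding heads_def by metis
    then have "h(i := 0) = h" by auto
    ultimately show ?thesis by (simp add: S_def)
  qed
  moreover have "poly_bounded (\<lambda>n. bnd n * (T n + 6) + 2)"
    by (intro poly_bounded_add poly_bounded_mult poly_bounded_power poly_bounded_const T
        poly_bounded_bnd)
  ultimately show ?thesis unfolding does_def by fast
qed

fun gnest :: "nat list \<Rightarrow> (bool list \<Rightarrow> (nat \<Rightarrow> nat) \<Rightarrow> 'f \<Rightarrow> 'f) \<Rightarrow> bool list \<Rightarrow> (nat \<Rightarrow> nat) \<Rightarrow> 'f \<Rightarrow> 'f"
where
  "gnest [] g x h F = g x h F"
| "gnest (j # js) g x h F = fold (\<lambda>v. gnest js g x (h(j := v))) [0..<N x] F"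

lemma does_nest:
  assumes "does c (X \<union> set js) g" "set js \<inter> X = {}" "distinct js" "set js \<subseteq> set vars \<union> set rounds"
  shows "does (nest js c) X (gnest js g)"
  using assms
proof (induction js arbitrary: X)
  case Nil
  then show ?case by (simp add: does_cong)
next
  case (Cons j js)
  have "does (nest js c) (insert j X) (gnest js g)"
    by (rule Cons.IH) (use Cons.prems in auto)
  then have "does (For j (nest js c)) X (\<lambda>x h F. fold (\<lambda>v. gnest js g x (h(j := v))) [0..<N x] F)"
    by (rule does_For) (use Cons.prems in auto)
  then show ?case by (auto elim: does_cong)
qed

text \<open>The commands for a rule run inside of the loops over the variables.\<close>

definition outer :: "nat set \<Rightarrow> bool" where
  "outer X \<longleftrightarrow> vt ` {..<nv} \<subseteq> X \<and> X \<subseteq> set vars \<union> set rounds"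

definition atom_wf :: "'r hatom \<Rightarrow> bool" where
  "atom_wf b \<longleftrightarrow> length (snd b) = ar (fst b) \<and> ar (fst b) \<le> a \<and> (\<forall>t \<in> set (snd b). tvar t < nv)"

definition value_of :: "(nat \<Rightarrow> nat) \<Rightarrow> 'r hatom \<Rightarrow> 'r \<times> nat list" where
  "value_of \<sigma> b = (fst b, map (tval \<sigma>) (snd b))"

text \<open>The cell with address 0 is next to the left end, hence the first move.\<close>

definition seek :: "'r hatom \<Rightarrow> com" where
  "seek b = Seq (Move (rt (fst b)) Right) (goto (rt (fst b)) (snd b))"

definition cell :: "bool list \<Rightarrow> (nat \<Rightarrow> nat) \<Rightarrow> 'r hatom \<Rightarrow> nat" where
  "cell x h b = Suc (index ((N x)\<^sup>2) (snd (value_of (\<lambda>v. h (vt v)) b)))"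

lemma value_of_bounds:
  assumes "outer X" "heads X x h" "atom_wf b"
  shows "length (snd (value_of (\<lambda>v. h (vt v)) b)) = ar (fst b)"
    and "set (snd (value_of (\<lambda>v. h (vt v)) b)) \<subseteq> {..N x}"
proof -
  have "tval (\<lambda>v. h (vt v)) t \<le> N x" if "t \<in> set (snd b)" for t
  proof -
    have "vt (tvar t) \<in> X" using assms that unfolding outer_def atom_wf_def by auto
    then have "h (vt (tvar t)) < N x" using assms(2) unfolding heads_def by metis
    then show ?thesis by (cases t) auto
  qed
  then show "set (snd (value_of (\<lambda>v. h (vt v)) b)) \<subseteq> {..N x}" by (auto simp: value_of_def)
qed (use assms(3) in \<open>simp add: value_of_def atom_wf_def\<close>)

lemma cell_le:
  assumes "outer X" "heads X x h" "atom_wf b"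
  shows "cell x h b \<le> ((N x)\<^sup>2) ^ ar (fst b)"
proof -
  have "set (snd (value_of (\<lambda>v. h (vt v)) b)) \<subseteq> {..<(N x)\<^sup>2}"
    using value_of_bounds(2)[OF assms] lt_N_sq[of _ x] by auto
  from index_less[OF this] show ?thesis
    using value_of_bounds(1)[OF assms] by (simp add: cell_def)
qed

lemma runs_seek:
  assumes "outer X" "heads X x h" "atom_wf b"
  shows "runs (seek b) (cont x F, h) (1 + goto_time (ar (fst b)) (N x))
    (cont x F, h(rt (fst b) := cell x h b))"
proof -
  let ?A = "rt (fst b)"
  have A: "tmp < ?A" by (simp add: rt_def)
  have A_notin: "?A \<notin> X" "?A \<notin> set aux"
    using A assms(1) by (auto simp: outer_def vars_def rounds_def aux_def tmp_def)
  have zero: "h i = 0" if "i \<notin> X" for i using assms(2) that unfolding heads_def by metis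
  have vt: "vt v \<in> X" "vt v \<noteq> ?A" "h (vt v) < N x" if "v < nv" for v
  proof -
    show "vt v \<in> X" using assms(1) that unfolding outer_def by auto
    then show "vt v \<noteq> ?A" "h (vt v) < N x" using A_notin assms(2) unfolding heads_def by metis+
  qed
  let ?h = "h(?A := Suc 0)"
  have 1: "runs (Move ?A Right) (cont x F, h) 1 (cont x F, ?h)"
    using runs_Move[of ?A Right "cont x F" h] zero[OF A_notin(1)] by simp
  have "runs (goto ?A (snd b)) (cont x F, ?h) (goto_time (length (snd b)) (N x))
    (cont x F, shift {?A} (index ((N x)\<^sup>2) (map (tval (\<lambda>v. ?h (vt v))) (snd b))) ?h)"
  proof (rule runs_goto)
    fix i assume "i \<in> insert tmp (set aux)"
    then have "i \<notin> X" "i \<noteq> ?A"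
      using assms(1) A A_notin by (auto simp: outer_def vars_def rounds_def aux_def tmp_def)
    then show "?h i = 0" using zero by simp
  qed (use A assms(3) vt in \<open>auto simp: atom_wf_def\<close>)
  moreover have "map (tval (\<lambda>v. ?h (vt v))) (snd b) = snd (value_of (\<lambda>v. h (vt v)) b)"
    unfolding value_of_def snd_conv
  proof (rule map_cong[OF refl])
    fix t assume "t \<in> set (snd b)"
    then have "vt (tvar t) \<noteq> ?A" using assms(3) vt(2) unfolding atom_wf_def by blast
    then show "tval (\<lambda>v. ?h (vt v)) t = tval (\<lambda>v. h (vt v)) t" by (cases t) auto
  qed
  moreover have "shift {?A} m ?h = h(?A := Suc m)" for m by (auto simp: shift_def)
  ultimately have "runs (goto ?A (snd b)) (cont x F, ?h) (goto_time (ar (fst b)) (N x))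
    (cont x F, h(?A := cell x h b))"
    using assms(3) by (simp add: cell_def atom_wf_def)
  from runs_Seq[OF 1 this] show ?thesis by (simp add: seek_def)
qed

lemma runs_rewind_rt:
  assumes "outer X" "heads X x h"
  shows "runs (rewind (rt r)) (cont x F, h(rt r := p)) (3 * p + 1) (cont x F, h)"
proof -
  have "rt r \<notin> X" using assms(1) by (auto simp: outer_def vars_def rounds_def rt_def tmp_def)
  then have "h(rt r := 0) = h" using assms(2) unfolding heads_def by (metis fun_upd_triv)
  then show ?thesis
    using runs_rewind[of "cont x F" "rt r" "h(rt r := p)"] by (simp add: cont_rt)
qed

definition test_rel :: "'r hatom \<Rightarrow> com \<Rightarrow> com" where
  "test_rel b c = Seq (seek b)
     (Cond (rt (fst b)) 2 (Seq (rewind (rt (fst b))) c) (rewind (rt (fst b))))"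

lemma does_test_rel:
  assumes "does c X g" "outer X" "atom_wf b"
  shows "does (test_rel b c) X (\<lambda>x h F. if value_of (\<lambda>v. h (vt v)) b \<in> F then g x h F else F)"
proof -
  obtain T where T: "poly_bounded T" "\<And>x F h. heads X x h \<Longrightarrow>
      runs c (cont x F, h) (T (length x)) (cont x (g x h F), h)"
    using assms(1) unfolding does_def by blast
  define T' where "T' n = 1 + goto_time (ar (fst b)) (bnd n) +
    (3 * ((bnd n)\<^sup>2) ^ ar (fst b) + 1 + T n + 2)" for n
  have "poly_bounded T'" unfolding T'_def
    by (intro poly_bounded_add poly_bounded_mult poly_bounded_power poly_bounded_const T
        poly_bounded_bnd poly_bounded_goto_time)
  moreover have "runs (test_rel b c) (cont x F, h) (T' (length x))
      (cont x (if value_of (\<lambda>v. h (vt v)) b \<in> F then g x h F else F), h)"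
    if h: "heads X x h" for x F h
    unfolding test_rel_def T'_def
  proof (rule runs_Seq[OF runs_seek[OF assms(2) h assms(3)] runs_Cond])
    let ?h = "h(rt (fst b) := cell x h b)"
    have scan: "cont x F (rt (fst b)) (?h (rt (fst b))) = 2 \<longleftrightarrow> value_of (\<lambda>v. h (vt v)) b \<in> F"
      using fact_cell_iff[OF value_of_bounds[OF assms(2) h assms(3)]]
      by (simp add: cont_rt cell_def) (simp add: value_of_def)
    have rew: "runs (rewind (rt (fst b))) (cont x F, ?h)
        (3 * ((N x)\<^sup>2) ^ ar (fst b) + 1) (cont x F, h)"
      by (rule runs_mono[OF runs_rewind_rt[OF assms(2) h]])
         (use cell_le[OF assms(2) h assms(3)] in simp)
    show "runs (Seq (rewind (rt (fst b))) c) (cont x F, ?h)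
        (3 * ((N x)\<^sup>2) ^ ar (fst b) + 1 + T (length x))
        (cont x (if value_of (\<lambda>v. h (vt v)) b \<in> F then g x h F else F), h)"
      if "cont x F (rt (fst b)) (?h (rt (fst b))) = 2"
      using that runs_Seq[OF rew T(2)[OF h]] scan by simp
    show "runs (rewind (rt (fst b))) (cont x F, ?h)
        (3 * ((N x)\<^sup>2) ^ ar (fst b) + 1 + T (length x))
        (cont x (if value_of (\<lambda>v. h (vt v)) b \<in> F then g x h F else F), h)"
      if "cont x F (rt (fst b)) (?h (rt (fst b))) \<noteq> 2"
      using that runs_mono[OF rew] scan by simp
  qed
  ultimately show ?thesis unfolding does_def by blast
qed

definition set_rel :: "'r hatom \<Rightarrow> com" where
  "set_rel b = Seq (seek b) (Seq (Write (rt (fst b)) 2) (rewind (rt (fst b))))"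

lemma does_set_rel:
  assumes "outer X" "atom_wf b"
  shows "does (set_rel b) X (\<lambda>x h F. insert (value_of (\<lambda>v. h (vt v)) b) F)"
proof -
  define T' where "T' n = 1 + goto_time (ar (fst b)) (bnd n) +
    (1 + (3 * ((bnd n)\<^sup>2) ^ ar (fst b) + 1))" for n
  have "poly_bounded T'" unfolding T'_def
    by (intro poly_bounded_add poly_bounded_mult poly_bounded_power poly_bounded_const
        poly_bounded_bnd poly_bounded_goto_time)
  moreover have "runs (set_rel b) (cont x F, h) (T' (length x))
      (cont x (insert (value_of (\<lambda>v. h (vt v)) b) F), h)" if h: "heads X x h" for x F h
    unfolding set_rel_def T'_def
  proof (rule runs_Seq[OF runs_seek[OF assms(1) h assms(2)] runs_Seq])
    let ?F = "insert (value_of (\<lambda>v. h (vt v)) b) F" and ?h = "h(rt (fst b) := cell x h b)"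
    have "cont x ?F = (cont x F)(rt (fst b) := (cont x F (rt (fst b)))(cell x h b := 2))"
      using cont_insert[OF value_of_bounds[OF assms(1) h assms(2)], of F]
      by (simp add: cell_def value_of_def)
    then show "runs (Write (rt (fst b)) 2) (cont x F, ?h) 1 (cont x ?F, ?h)"
      using runs_Write[of "rt (fst b)" 2 "cont x F" ?h] by simp
    show "runs (rewind (rt (fst b))) (cont x ?F, ?h)
        (3 * ((N x)\<^sup>2) ^ ar (fst b) + 1) (cont x ?F, h)"
      by (rule runs_mono[OF runs_rewind_rt[OF assms(1) h]])
         (use cell_le[OF assms(1) h assms(2)] in simp)
  qed
  ultimately show ?thesis unfolding does_def by blast
qed

definition test_input :: "nat \<times> nat \<Rightarrow> com \<Rightarrow> com" where
  "test_input b c = Seq (loop_times (vt (snd b)) tmp (advance [0]))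
     (Cond 0 (fst b) (Seq (rewind 0) c) (rewind 0))"

lemma input_symbol_zero: "input_symbol x 0 = 1" "0 < p \<Longrightarrow> input_symbol x p \<noteq> 1"
  by (auto simp: input_symbol_def input_tape_def)

lemma does_test_input:
  assumes "does c X g" "outer X" "snd b < nv"
  shows "does (test_input b c) X
    (\<lambda>x h F. if input_symbol x (h (vt (snd b))) = fst b then g x h F else F)"
proof -
  obtain T where T: "poly_bounded T" "\<And>x F h. heads X x h \<Longrightarrow>
      runs c (cont x F, h) (T (length x)) (cont x (g x h F), h)"
    using assms(1) unfolding does_def by blast
  define T' where "T' n = bnd n * (1 + 8) + 2 +
    ((3 * bnd n + 1) + T n + 2)" for n
  have "poly_bounded T'" unfolding T'_def
    by (intro poly_bounded_add poly_bounded_mult poly_bounded_power poly_bounded_const T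
        poly_bounded_bnd)
  moreover have "runs (test_input b c) (cont x F, h) (T' (length x))
      (cont x (if input_symbol x (h (vt (snd b))) = fst b then g x h F else F), h)"
    if h: "heads X x h" for x F h
    unfolding test_input_def T'_def
  proof (rule runs_Seq[OF _ runs_Cond])
    let ?v = "vt (snd b)" and ?G = "if input_symbol x (h (vt (snd b))) = fst b then g x h F else F"
    have v: "?v \<in> X" "?v \<noteq> 0" "?v \<noteq> tmp" "tmp \<notin> X" "tmp \<noteq> 0" "0 \<notin> X"
      using assms(2,3) by (auto simp: outer_def vt_def tmp_def vars_def rounds_def)
    have hv: "h ?v < N x" "h tmp = 0" "h 0 = 0" using h v unfolding heads_def by metis+
    have cont0: "cont x F 0 = input_symbol x" by (simp add: cont_def)
    let ?h = "h(0 := h ?v)"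
    have "runs (loop_times ?v tmp (advance [0])) (cont x F, h) (h ?v * (1 + 8) + 2)
        (cont x F, shift {0} (h ?v * 1) h)"
    proof (rule runs_loop_times)
      show "runs (advance [0]) (cont x F, h') 1 (cont x F, shift {0} 1 h')" for h'
        using runs_advance[of "[0]"] by simp
    qed (use v hv assms(3) in \<open>auto simp: cont_vt cont_tmp counter_def\<close>)
    moreover have "shift {0} (h ?v * 1) h = ?h" using hv by (auto simp: shift_def)
    ultimately have "runs (loop_times ?v tmp (advance [0])) (cont x F, h)
        (h ?v * (1 + 8) + 2) (cont x F, ?h)" by simp
    then show "runs (loop_times ?v tmp (advance [0])) (cont x F, h)
        (N x * (1 + 8) + 2) (cont x F, ?h)"
      by (rule runs_mono) (use hv in simp)
    have "h(0 := 0) = h" using hv(3) by auto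
    then have rew: "runs (rewind 0) (cont x F, ?h) (3 * N x + 1) (cont x F, h)"
      using runs_mono[OF runs_rewind[of "cont x F" 0 ?h], of "3 * N x + 1"] hv(1)
      using input_symbol_zero(1)[of x] input_symbol_zero(2)[of _ x] by (simp add: cont0)
    show "runs (Seq (rewind 0) c) (cont x F, ?h) (3 * N x + 1 + T (length x)) (cont x ?G, h)"
      if "cont x F 0 (?h 0) = fst b"
      using that runs_Seq[OF rew T(2)[OF h]] by (simp add: cont0)
    show "runs (rewind 0) (cont x F, ?h) (3 * N x + 1 + T (length x)) (cont x ?G, h)"
      if "cont x F 0 (?h 0) \<noteq> fst b"
      using that runs_mono[OF rew] by (simp add: cont0)
  qed
  ultimately show ?thesis unfolding does_def by blast
qed

subsection \<open>One pass over all rules and valuations\<close>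

definition sat :: "(nat \<Rightarrow> nat) \<Rightarrow> (nat \<Rightarrow> nat) \<Rightarrow> ('r \<times> nat list) set \<Rightarrow>
    (nat \<times> nat) list \<Rightarrow> 'r hatom list \<Rightarrow> bool" where
  "sat inp \<sigma> F ins body \<longleftrightarrow>
     (\<forall>b \<in> set ins. inp (\<sigma> (snd b)) = fst b) \<and> (\<forall>b \<in> set body. value_of \<sigma> b \<in> F)"

definition apply_rule :: "(nat \<Rightarrow> nat) \<Rightarrow> (nat \<Rightarrow> nat) \<Rightarrow> 'r hrule \<Rightarrow>
    ('r \<times> nat list) set \<Rightarrow> ('r \<times> nat list) set" where
  "apply_rule inp \<sigma> rl F =
     (if sat inp \<sigma> F (fst (snd rl)) (snd (snd rl)) then insert (value_of \<sigma> (fst rl)) F else F)"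

definition rule_com :: "'r hrule \<Rightarrow> com" where
  "rule_com rl = foldr test_input (fst (snd rl)) (foldr test_rel (snd (snd rl)) (set_rel (fst rl)))"

lemma does_rule_com:
  assumes "outer X" "rl \<in> set P"
  shows "does (rule_com rl) X (\<lambda>x h. apply_rule (input_symbol x) (\<lambda>v. h (vt v)) rl)"
proof -
  obtain hd ins body where rl: "rl = (hd, ins, body)" by (cases rl)
  have wf: "atom_wf hd" "\<forall>b \<in> set body. atom_wf b" "\<forall>b \<in> set ins. snd b < nv"
    using assms(2) head_wf body_wf ins_wf unfolding rl atom_wf_def by (metis prod.collapse)+
  have body: "does (foldr test_rel bs (set_rel hd)) X (\<lambda>x h F.
      if sat (input_symbol x) (\<lambda>v. h (vt v)) F [] bs then insert (value_of (\<lambda>v. h (vt v)) hd) F else F)"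
    if "\<forall>b \<in> set bs. atom_wf b" for bs
    using that
  proof (induction bs)
    case Nil
    then show ?case using does_set_rel[OF assms(1) wf(1)] by (simp add: sat_def)
  next
    case (Cons b bs)
    then have "does (foldr test_rel bs (set_rel hd)) X (\<lambda>x h F.
      if sat (input_symbol x) (\<lambda>v. h (vt v)) F [] bs then insert (value_of (\<lambda>v. h (vt v)) hd) F else F)"
      "atom_wf b" by auto
    from does_test_rel[OF this(1) assms(1) this(2)] show ?case
      unfolding foldr.simps o_def by (rule does_cong) (auto simp: sat_def)
  qed
  have "does (foldr test_input is (foldr test_rel body (set_rel hd))) X (\<lambda>x h F.
      if sat (input_symbol x) (\<lambda>v. h (vt v)) F is body
      then insert (value_of (\<lambda>v. h (vt v)) hd) F else F)"
    if "\<forall>b \<in> set is. snd b < nv" for "is"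
    using that
  proof (induction "is")
    case Nil
    then show ?case using body[OF wf(2)] by simp
  next
    case (Cons b bs)
    then have "does (foldr test_input bs (foldr test_rel body (set_rel hd))) X (\<lambda>x h F.
      if sat (input_symbol x) (\<lambda>v. h (vt v)) F bs body
      then insert (value_of (\<lambda>v. h (vt v)) hd) F else F)" "snd b < nv" by auto
    from does_test_input[OF this(1) assms(1) this(2)] show ?case
      unfolding foldr.simps o_def by (rule does_cong) (auto simp: sat_def)
  qed
  from this[OF wf(3)] show ?thesis
    unfolding rl rule_com_def apply_rule_def[abs_def] fst_conv snd_conv .
qed

definition sweep :: "bool list \<Rightarrow> (nat \<Rightarrow> nat) \<Rightarrow> ('r \<times> nat list) set \<Rightarrow> ('r \<times> nat list) set" where
  "sweep x h F = fold (apply_rule (input_symbol x) (\<lambda>v. h (vt v))) P F"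

definition sweep_com :: com where
  "sweep_com = foldr Seq (map rule_com P) Skip"

lemma does_sweep_com:
  assumes "outer X"
  shows "does sweep_com X sweep"
proof -
  have "does (foldr Seq (map rule_com rs) Skip) X
      (\<lambda>x h. fold (apply_rule (input_symbol x) (\<lambda>v. h (vt v))) rs)"
    if "set rs \<subseteq> set P" for rs
    using that
  proof (induction rs)
    case Nil
    then show ?case using does_Skip by (simp add: id_def)
  next
    case (Cons rl rs)
    then have "does (foldr Seq (map rule_com rs) Skip) X
      (\<lambda>x h. fold (apply_rule (input_symbol x) (\<lambda>v. h (vt v))) rs)" by simp
    then show ?case
      using does_Seq[OF does_rule_com[OF assms, of rl]] Cons.prems by simp
  qed
  from this[of P] show ?thesis unfolding sweep_com_def sweep_def[abs_def] by simp
qed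

definition search :: com where
  "search = nest rounds (nest vars sweep_com)"

lemma does_search: "does search {} (gnest rounds (gnest vars sweep))"
proof -
  have vt: "vt ` {..<nv} = set vars"
  proof (intro equalityI subsetI)
    fix i assume "i \<in> set vars"
    then have "i = vt (i - (e + 1))" "i - (e + 1) < nv" by (auto simp: vars_def vt_def)
    then show "i \<in> vt ` {..<nv}" by blast
  qed (auto simp: vars_def vt_def)
  have disj: "set vars \<inter> set rounds = {}" "distinct vars" "distinct rounds"
    by (auto simp: vars_def rounds_def)
  have "does (nest vars sweep_com) (set rounds) (gnest vars sweep)"
    by (rule does_nest[OF does_sweep_com]) (use disj vt in \<open>auto simp: outer_def\<close>)
  then show ?thesis unfolding search_def
    by (rule does_nest[where X = "{}", simplified]) (use disj in auto)
qed

subsection \<open>Marking the bounds\<close>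

definition start :: "bool list \<Rightarrow> store" where
  "start x = (\<lambda>i. fst (if i = 0 then input_tape x else blank_tape), \<lambda>_. 0)"

definition mark :: "nat list \<Rightarrow> com" where
  "mark L = foldr (\<lambda>i c. Seq (Write i 2) (Seq (rewind i) c)) L Skip"

definition small :: "nat list" where "small = [1..<e + 1]"
definition big :: "nat list" where "big = [e + 1..<tmp]"

text \<open>
  Along with one passage over the input, the small counters reach \<open>length x + 2\<close>. Once this bound is
  marked, \<open>e\<close> nested loops over them bring the other counters to \<open>(length x + 2) ^ e\<close>.
\<close>

definition prepare :: com where
  "prepare = Seq (Until 0 0 (Seq (Move 0 Right) (advance small))) (Seq (advance small)
     (Seq (mark small) (Seq (rewind 0) (Seq (nest small (advance big)) (mark big)))))"

lemma runs_mark: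
  assumes "distinct L" "\<And>i. i \<in> set L \<Longrightarrow> C i = (\<lambda>_. 0)(0 := 1) \<and> h i = b" "0 < b"
  shows "runs (mark L) (C, h) (length L * (3 * b + 2))
    (\<lambda>i. if i \<in> set L then counter b else C i, \<lambda>i. if i \<in> set L then 0 else h i)"
  using assms(1,2)
proof (induction L arbitrary: C h)
  case Nil
  then show ?case using runs_Skip by (simp add: mark_def)
next
  case (Cons i L)
  let ?C = "C(i := counter b)" and ?h = "h(i := 0)"
  have "(C i)(h i := 2) = counter b" using Cons.prems(2)[of i] assms(3) by (auto simp: counter_def)
  then have 1: "runs (Write i 2) (C, h) 1 (?C, h)"
    using runs_Write[of i 2 C h] by simp
  have 2: "runs (rewind i) (?C, h) (3 * b + 1) (?C, ?h)"
    using runs_rewind[of ?C i h] Cons.prems(2)[of i] assms(3) by (simp add: counter_def)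
  have 3: "runs (mark L) (?C, ?h) (length L * (3 * b + 2))
    (\<lambda>j. if j \<in> set L then counter b else ?C j, \<lambda>j. if j \<in> set L then 0 else ?h j)"
    by (rule Cons.IH) (use Cons.prems in auto)
  have "(\<lambda>j. if j \<in> set L then counter b else ?C j) = (\<lambda>j. if j \<in> set (i # L) then counter b else C j)"
    "(\<lambda>j. if j \<in> set L then 0 else ?h j) = (\<lambda>j. if j \<in> set (i # L) then 0 else h j)"
    by auto
  with runs_Seq[OF 1 runs_Seq[OF 2 3]] show ?case
    by (simp add: mark_def algebra_simps)
qed

definition prepare_time :: "nat \<Rightarrow> nat" where
  "prepare_time n = ((n + 1) * ((1 + e) + 2) + 1) + (e + (e * (3 * (n + 2) + 2) + ((3 * (n + 1) + 1) +
     (nest_time (length big) e (n + 2) + length big * (3 * bnd n + 2)))))"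

lemma poly_bounded_prepare_time: "poly_bounded prepare_time"
  unfolding prepare_time_def
  by (intro poly_bounded_add poly_bounded_mult poly_bounded_const poly_bounded_id
      poly_bounded_nest_time poly_bounded_bnd)

lemma runs_prepare:
  "runs prepare (start x) (prepare_time (length x)) (cont x {}, \<lambda>_. 0)"
proof -
  let ?n = "length x"
  define B where "B = set small"
  define C where "C = fst (start x)"
  have len: "length small = e" and fin: "distinct small" "distinct big" "set small \<inter> set big = {}"
    by (auto simp: small_def big_def)
  have B: "i \<in> B \<longleftrightarrow> 1 \<le> i \<and> i \<le> e" for i by (auto simp: B_def small_def)
  define S where "S v = (C, shift (insert 0 B) v (\<lambda>_. 0))" for v
  have "runs (Until 0 0 (Seq (Move 0 Right) (advance small))) (S 0)
      ((?n + 1) * ((1 + e) + 2) + 1) (S (?n + 1))"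
  proof (rule runs_Until)
    fix v assume v: "v < ?n + 1"
    then show "fst (S v) 0 (snd (S v) 0) \<noteq> 0"
      by (auto simp: S_def C_def start_def shift_def input_tape_def)
    let ?h = "shift (insert 0 B) v (\<lambda>_. 0)"
    have "runs (Move 0 Right) (S v) 1 (C, ?h(0 := Suc (?h 0)))"
      using runs_Move[of 0 Right C ?h] by (simp add: S_def)
    moreover have "runs (advance small) (C, ?h(0 := Suc (?h 0))) e
        (C, shift B 1 (?h(0 := Suc (?h 0))))"
      using runs_advance[OF fin(1), of C "?h(0 := Suc (?h 0))"] by (simp add: len B_def)
    moreover have "shift B 1 (?h(0 := Suc (?h 0))) = shift (insert 0 B) (Suc v) (\<lambda>_. 0)"
      using B by (auto simp: shift_def)
    ultimately show "runs (Seq (Move 0 Right) (advance small)) (S v) (1 + e) (S (Suc v))"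
      by (simp only: S_def) (rule runs_Seq)
  qed (auto simp: S_def C_def start_def shift_def input_tape_def)
  moreover have "S 0 = start x" by (simp add: S_def C_def) (simp add: start_def)
  ultimately have 1: "runs (Until 0 0 (Seq (Move 0 Right) (advance small))) (start x)
      ((?n + 1) * ((1 + e) + 2) + 1) (S (?n + 1))" by simp
  define h2 where "h2 = shift B 1 (snd (S (?n + 1)))"
  have 2: "runs (advance small) (S (?n + 1)) e (C, h2)"
    using runs_advance[OF fin(1), of C "snd (S (?n + 1))"]
    by (simp add: len B_def[symmetric] h2_def) (simp add: S_def)
  have h2: "h2 i = (if i \<in> B then ?n + 2 else if i = 0 then ?n + 1 else 0)" for i
    using B[of 0] by (auto simp: h2_def S_def shift_def)
  define C3 where "C3 i = (if i \<in> B then counter (?n + 2) else C i)" for i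
  define h3 where "h3 i = (if i \<in> B then 0 else h2 i)" for i
  have "runs (mark small) (C, h2) (length small * (3 * (?n + 2) + 2))
      (\<lambda>i. if i \<in> set small then counter (?n + 2) else C i, \<lambda>i. if i \<in> set small then 0 else h2 i)"
  proof (rule runs_mark[OF fin(1)])
    fix i assume "i \<in> set small"
    then have "i \<in> B" by (simp add: B_def)
    then show "C i = (\<lambda>_. 0)(0 := 1) \<and> h2 i = ?n + 2"
      using B[of i] by (auto simp: h2 C_def start_def blank_tape_def)
  qed simp
  then have 3: "runs (mark small) (C, h2) (e * (3 * (?n + 2) + 2)) (C3, h3)"
    unfolding len B_def[symmetric] C3_def[abs_def] h3_def[abs_def] .
  have h3: "h3 0 = ?n + 1" "h3(0 := 0) = (\<lambda>_. 0)" using B[of 0] by (auto simp: h3_def h2)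
  have C30: "C3 0 = input_symbol x"
    using B[of 0] by (simp add: C3_def C_def start_def input_symbol_def)
  have 4: "runs (rewind 0) (C3, h3) (3 * (?n + 1) + 1) (C3, \<lambda>_. 0)"
    using runs_rewind[of C3 0 h3] input_symbol_zero(1)[of x] input_symbol_zero(2)[of _ x]
    by (simp add: h3 C30)
  have "runs (nest small (advance big)) (C3, \<lambda>_. 0)
    (nest_time (length big) (length small) (?n + 2))
    (C3, shift (set big) ((?n + 2) ^ length small) (\<lambda>_. 0))"
    by (rule runs_nest_advance) (use fin in \<open>auto simp: C3_def B_def\<close>)
  then have 5: "runs (nest small (advance big)) (C3, \<lambda>_. 0)
    (nest_time (length big) e (?n + 2)) (C3, shift (set big) (N x) (\<lambda>_. 0))"
    unfolding len bnd_def .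
  have 6: "runs (mark big) (C3, shift (set big) (N x) (\<lambda>_. 0))
      (length big * (3 * N x + 2))
      (\<lambda>i. if i \<in> set big then counter (N x) else C3 i,
       \<lambda>i. if i \<in> set big then 0 else shift (set big) (N x) (\<lambda>_. 0) i)"
  proof (rule runs_mark[OF fin(2)])
    fix i assume "i \<in> set big"
    moreover from this have "i \<notin> B" "i \<noteq> 0" using fin(3) by (auto simp: B_def big_def)
    ultimately show "C3 i = (\<lambda>_. 0)(0 := 1) \<and> shift (set big) (N x) (\<lambda>_. 0) i = N x"
      by (simp add: shift_def C3_def C_def start_def blank_tape_def)
  qed (use N_ge2[of x] in simp)
  have "(\<lambda>i. if i \<in> set big then counter (N x) else C3 i) = cont x {}"
    by (rule ext) (auto simp: cont_def big_def C3_def B C_def start_def input_symbol_def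
        blank_tape_def fact_cell_def)
  moreover have "(\<lambda>i. if i \<in> set big then 0 else shift (set big) (N x) (\<lambda>_. 0) i) = (\<lambda>_. 0)"
    by (auto simp: shift_def)
  ultimately have 6: "runs (mark big) (C3, shift (set big) (N x) (\<lambda>_. 0))
      (length big * (3 * N x + 2)) (cont x {}, \<lambda>_. 0)" using 6 by simp
  show ?thesis unfolding prepare_def prepare_time_def
    by (rule runs_Seq[OF 1 runs_Seq[OF 2 runs_Seq[OF 3
        runs_Seq[OF 4 runs_Seq[OF 5 6]]]]])
qed

subsection \<open>Reaching the least fixed point\<close>

definition ok :: "bool list \<Rightarrow> (nat \<Rightarrow> nat) \<Rightarrow> bool" where
  "ok x h \<longleftrightarrow> (\<forall>i. h i < N x)"

lemma ok_upd: "ok x h \<Longrightarrow> v < N x \<Longrightarrow> ok x (h(j := v))"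
  by (simp add: ok_def)

definition facts :: "bool list \<Rightarrow> ('r \<times> nat list) set" where
  "facts x = {(r, ys). derives P (N x) (input_symbol x) r ys}"

lemma fold_between:
  assumes "\<And>f F. f \<in> set fs \<Longrightarrow> F \<subseteq> L \<Longrightarrow> F \<subseteq> f F \<and> f F \<subseteq> L" "F \<subseteq> L"
  shows "F \<subseteq> fold (\<lambda>f. f) fs F \<and> fold (\<lambda>f. f) fs F \<subseteq> L"
  using assms
proof (induction fs arbitrary: F)
  case (Cons f fs)
  have "F \<subseteq> f F" "f F \<subseteq> L" using Cons.prems by auto
  then show ?case using Cons.IH[of "f F"] Cons.prems(1) by auto
qed auto

lemma fold_map_id: "fold g xs F = fold (\<lambda>f. f) (map g xs) F"
  by (induction xs arbitrary: F) auto

text \<open>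
  Each operation gets its turn at a set that contains the initial one. That is all one needs to know
  of the order of evaluation, since a rule that applies to a set applies to every larger one.
\<close>

lemma fold_reaches:
  assumes "\<And>f F. f \<in> set fs \<Longrightarrow> F \<subseteq> L \<Longrightarrow> F \<subseteq> f F \<and> f F \<subseteq> L" "F \<subseteq> L" "f \<in> set fs"
  shows "\<exists>F'. F \<subseteq> F' \<and> F' \<subseteq> L \<and> f F' \<subseteq> fold (\<lambda>f. f) fs F"
  using assms
proof (induction fs arbitrary: F)
  case (Cons g fs)
  have g: "F \<subseteq> g F" "g F \<subseteq> L" using Cons.prems(1,2) by auto
  show ?case
  proof (cases "f = g")
    case True
    have "f F \<subseteq> fold (\<lambda>f. f) fs (f F)"
      using fold_between[of fs L "f F"] Cons.prems(1) g True by auto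
    then show ?thesis using Cons.prems(2) True by auto
  next
    case False
    then show ?thesis using Cons.IH[of "g F"] Cons.prems(1,3) g by auto
  qed
qed auto

lemma apply_rule_between:
  assumes "rl \<in> set P" "\<And>v. \<sigma> v < N x" "F \<subseteq> facts x"
  shows "F \<subseteq> apply_rule (input_symbol x) \<sigma> rl F \<and> apply_rule (input_symbol x) \<sigma> rl F \<subseteq> facts x"
proof -
  obtain r ts ins body where rl: "rl = ((r, ts), ins, body)" by (metis prod.collapse)
  have "derives P (N x) (input_symbol x) r (map (tval \<sigma>) ts)"
    if "sat (input_symbol x) \<sigma> F ins body"
  proof (rule derives.rule)
    show "((r, ts), ins, body) \<in> set P" using assms(1) rl by simp
    show "\<forall>(s, v) \<in> set ins. input_symbol x (\<sigma> v) = s" using that by (auto simp: sat_def)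
    show "\<forall>b \<in> set body. derives P (N x) (input_symbol x) (fst b) (map (tval \<sigma>) (snd b))"
      using that assms(3) by (fastforce simp: sat_def value_of_def facts_def)
  qed (use assms(2) in auto)
  then show ?thesis using assms(3) by (auto simp: apply_rule_def rl value_of_def facts_def)
qed

text \<open>Operations of this kind only add facts, and only derivable ones.\<close>

definition tame :: "bool list \<Rightarrow> 'f set \<Rightarrow>
    (bool list \<Rightarrow> (nat \<Rightarrow> nat) \<Rightarrow> 'f set \<Rightarrow> 'f set) \<Rightarrow> bool" where
  "tame x L g \<longleftrightarrow> (\<forall>h F. ok x h \<longrightarrow> F \<subseteq> L \<longrightarrow> F \<subseteq> g x h F \<and> g x h F \<subseteq> L)"

lemma tameD: "tame x L g \<Longrightarrow> ok x h \<Longrightarrow> F \<subseteq> L \<Longrightarrow> F \<subseteq> g x h F \<and> g x h F \<subseteq> L"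
  by (simp add: tame_def)

lemma tame_sweep: "tame x (facts x) sweep"
  unfolding tame_def sweep_def
proof (intro allI impI)
  fix h F assume ok: "ok x h" and F: "F \<subseteq> facts x"
  let ?f = "apply_rule (input_symbol x) (\<lambda>v. h (vt v))"
  show "F \<subseteq> fold ?f P F \<and> fold ?f P F \<subseteq> facts x"
    unfolding fold_map_id[of ?f]
  proof (rule fold_between[OF _ F])
    fix f G assume "f \<in> set (map ?f P)" "G \<subseteq> facts x"
    then show "G \<subseteq> f G \<and> f G \<subseteq> facts x"
      using ok apply_rule_between[of _ "\<lambda>v. h (vt v)" x G] unfolding ok_def set_map by blast
  qed
qed

lemma tame_gnest:
  assumes "tame x L g"
  shows "tame x L (gnest js g)"
proof (induction js)
  case Nil
  then show ?case using assms by (simp add: tame_def)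
next
  case (Cons j js)
  show ?case unfolding tame_def gnest.simps
  proof (intro allI impI)
    fix h F assume ok: "ok x h" and F: "F \<subseteq> L"
    let ?f = "\<lambda>v. gnest js g x (h(j := v))"
    show "F \<subseteq> fold ?f [0..<N x] F \<and> fold ?f [0..<N x] F \<subseteq> L"
      unfolding fold_map_id[of ?f]
    proof (rule fold_between[OF _ F])
      fix f G assume "f \<in> set (map ?f [0..<N x])" "G \<subseteq> L"
      then obtain v where v: "v < N x" "f = ?f v" by auto
      show "G \<subseteq> f G \<and> f G \<subseteq> L"
        unfolding v(2) by (rule tameD[OF Cons ok_upd[OF ok v(1)] \<open>G \<subseteq> L\<close>])
    qed
  qed
qed

text \<open>In nested loops, likewise, every valuation \<open>vs\<close> of the loop variables gets its turn.\<close>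

lemma gnest_reaches:
  assumes "tame x L g" "ok x h" "F \<subseteq> L" and "\<And>j. vs j < N x" "distinct js"
  shows "\<exists>F'. F \<subseteq> F' \<and> F' \<subseteq> L \<and> g x (\<lambda>i. if i \<in> set js then vs i else h i) F' \<subseteq> gnest js g x h F"
  using assms(2,3,5)
proof (induction js arbitrary: h F)
  case Nil
  then show ?case by auto
next
  case (Cons j js)
  let ?f = "\<lambda>v. gnest js g x (h(j := v))"
  have "\<exists>F'. F \<subseteq> F' \<and> F' \<subseteq> L \<and> ?f (vs j) F' \<subseteq> fold (\<lambda>f. f) (map ?f [0..<N x]) F"
  proof (rule fold_reaches[OF _ Cons.prems(2)])
    fix f G assume "f \<in> set (map ?f [0..<N x])" "G \<subseteq> L"
    then obtain v where v: "v < N x" "f = ?f v" by auto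
    show "G \<subseteq> f G \<and> f G \<subseteq> L"
      unfolding v(2)
      by (rule tameD[OF tame_gnest[OF assms(1)] ok_upd[OF Cons.prems(1) v(1)] \<open>G \<subseteq> L\<close>])
  qed (use assms(4) in auto)
  then obtain F' where F': "F \<subseteq> F'" "F' \<subseteq> L" "?f (vs j) F' \<subseteq> gnest (j # js) g x h F"
    unfolding gnest.simps fold_map_id[of ?f] by blast
  obtain F'' where F'': "F' \<subseteq> F''" "F'' \<subseteq> L"
    "g x (\<lambda>i. if i \<in> set js then vs i else (h(j := vs j)) i) F'' \<subseteq> ?f (vs j) F'"
    using Cons.IH[OF ok_upd[OF Cons.prems(1) assms(4)[of j], of j] F'(2)] Cons.prems(3)
    by (auto simp del: fun_upd_apply)
  have eq: "(\<lambda>i. if i \<in> set js then vs i else (h(j := vs j)) i) =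
      (\<lambda>i. if i \<in> set (j # js) then vs i else h i)" using Cons.prems(3) by auto
  have "g x (\<lambda>i. if i \<in> set (j # js) then vs i else h i) F'' \<subseteq> gnest (j # js) g x h F"
    using F''(3) F'(3) unfolding eq by (rule subset_trans)
  then show ?case using subset_trans[OF F'(1) F''(1)] F''(2) by (intro exI[of _ F''] conjI)
qed

text \<open>A pass over all valuations that adds no fact has checked every instance of every rule.\<close>

lemma pass_fixed_point:
  assumes "ok x h" "F \<subseteq> facts x" "gnest vars sweep x h F = F"
  shows "F = facts x"
proof -
  have "(r, ys) \<in> F" if "derives P (N x) (input_symbol x) r ys" for r ys
    using that
  proof induction
    case (rule r ts ins body \<sigma>)
    define vs where "vs i = \<sigma> (i - (e + 1))" for i
    define h' where "h' = (\<lambda>i. if i \<in> set vars then vs i else h i)"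
    have "distinct vars" "vs j < N x" for j using rule(2) by (simp_all add: vars_def vs_def)
    then obtain F' where F': "F \<subseteq> F'" "F' \<subseteq> facts x" "sweep x h' F' \<subseteq> F"
      using gnest_reaches[OF tame_sweep assms(1,2), of vs vars] unfolding assms(3) h'_def by blast
    have ok': "ok x h'" using assms(1) rule(2) by (auto simp: ok_def h'_def vs_def)
    let ?\<sigma> = "\<lambda>v. h' (vt v)"
    have \<sigma>: "?\<sigma> v = \<sigma> v" if "v < nv" for v
      using that by (simp add: h'_def vs_def vt_def vars_def)
    have tval: "map (tval ?\<sigma>) us = map (tval \<sigma>) us" if "\<forall>t \<in> set us. tvar t < nv" for us
    proof (rule map_cong[OF refl])
      fix t assume "t \<in> set us"
      then have "?\<sigma> (tvar t) = \<sigma> (tvar t)" using that \<sigma> by blast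
      then show "tval ?\<sigma> t = tval \<sigma> t" by (cases t) auto
    qed
    have in_P: "((r, ts), ins, body) \<in> set P" by fact
    let ?f = "apply_rule (input_symbol x) ?\<sigma>"
    have "\<exists>F''. F' \<subseteq> F'' \<and> F'' \<subseteq> facts x \<and>
        ?f ((r, ts), ins, body) F'' \<subseteq> fold (\<lambda>f. f) (map ?f P) F'"
    proof (rule fold_reaches[OF _ F'(2)])
      fix f G assume "f \<in> set (map ?f P)" "G \<subseteq> facts x"
      then show "G \<subseteq> f G \<and> f G \<subseteq> facts x"
        using ok' apply_rule_between[of _ ?\<sigma> x G] unfolding ok_def set_map by blast
    qed (use in_P in auto)
    then obtain F'' where F'': "F' \<subseteq> F''" "?f ((r, ts), ins, body) F'' \<subseteq> F"
      using F'(3) unfolding sweep_def fold_map_id[symmetric] by blast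
    have "sat (input_symbol x) ?\<sigma> F'' ins body"
      unfolding sat_def
    proof (intro conjI ballI)
      fix b assume b: "b \<in> set ins"
      then have "snd b < nv" using ins_wf[OF in_P] by (metis prod.collapse)
      then show "input_symbol x (?\<sigma> (snd b)) = fst b" using rule(3) b \<sigma> by auto
    next
      fix b assume b: "b \<in> set body"
      then have "\<forall>t \<in> set (snd b). tvar t < nv" using body_wf[OF in_P] by (metis prod.collapse)
      then have "value_of ?\<sigma> b = (fst b, map (tval \<sigma>) (snd b))" using tval by (simp add: value_of_def)
      then show "value_of ?\<sigma> b \<in> F''" using rule(4) b F'(1) F''(1) by auto
    qed
    then have "value_of ?\<sigma> (r, ts) \<in> F" using F''(2) by (auto simp: apply_rule_def)
    then show ?case using tval head_wf[OF in_P] by (auto simp: value_of_def)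
  qed
  then show ?thesis using assms(2) by (auto simp: facts_def)
qed

lemma facts_shape:
  assumes "(r, ys) \<in> facts x"
  shows "r \<in> (\<lambda>rl. fst (fst rl)) ` set P" "set ys \<subseteq> {..N x}" "length ys \<le> a"
proof -
  have "derives P (N x) (input_symbol x) r ys" using assms by (simp add: facts_def)
  then have "r \<in> (\<lambda>rl. fst (fst rl)) ` set P \<and> set ys \<subseteq> {..N x} \<and> length ys \<le> a"
  proof cases
    case (rule ts ins body \<sigma>)
    have "tval \<sigma> t \<le> N x" for t using rule(3)[of "tvar t"] by (cases t) auto
    then show ?thesis using rule head_wf[OF rule(2)] by (force intro: image_eqI)
  qed
  then show "r \<in> (\<lambda>rl. fst (fst rl)) ` set P" "set ys \<subseteq> {..N x}" "length ys \<le> a" by auto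
qed

lemma derives_arity: "derives P m inp r ys \<Longrightarrow> length ys = ar r"
  by (cases rule: derives.cases) (auto dest: head_wf)

text \<open>
  There are at most \<open>length P\<close> derived relations with at most \<open>(N + 1) ^ a\<close> facts each. The number
  \<open>w\<close> of loops over the rounds is chosen such that \<open>N ^ w\<close> is at least as large.
\<close>

lemma card_facts: "finite (facts x) \<and> card (facts x) \<le> N x ^ w"
proof -
  define R where "R = (\<lambda>rl. fst (fst rl)) ` set P"
  define Y where "Y r = {ys. set ys \<subseteq> {..N x} \<and> length ys = ar r}" for r
  have sub: "facts x \<subseteq> Sigma {r \<in> R. ar r \<le> a} Y"
  proof
    fix f assume f: "f \<in> facts x"
    obtain r ys where rys: "f = (r, ys)" by (cases f)
    then have "length ys = ar r" using f derives_arity by (auto simp: facts_def)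
    then show "f \<in> Sigma {r \<in> R. ar r \<le> a} Y"
      using facts_shape[of r ys x] f rys by (auto simp: R_def Y_def)
  qed
  have fin: "finite {r \<in> R. ar r \<le> a}" "finite (Y r)" for r
    using finite_lists_length_eq[of "{..N x}"] by (auto simp: R_def Y_def)
  have card_Y: "card (Y r) \<le> N x ^ (2 * a)" if "ar r \<le> a" for r
  proof -
    have "card (Y r) = Suc (N x) ^ ar r"
      using card_lists_length_eq[of "{..N x}" "ar r"] by (simp add: Y_def)
    also have "\<dots> \<le> ((N x)\<^sup>2) ^ ar r"
      using lt_N_sq[of "N x" x] by (intro power_mono) auto
    also have "\<dots> = N x ^ (2 * ar r)" by (simp add: power_mult)
    also have "\<dots> \<le> N x ^ (2 * a)" using that N_ge2[of x] by (intro power_increasing) auto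
    finally show ?thesis .
  qed
  have "card (facts x) \<le> card (Sigma {r \<in> R. ar r \<le> a} Y)"
    by (rule card_mono[OF finite_SigmaI sub]) (use fin in auto)
  also have "\<dots> = (\<Sum>r \<in> {r \<in> R. ar r \<le> a}. card (Y r))"
    using fin by (simp add: card_SigmaI)
  also have "\<dots> \<le> card {r \<in> R. ar r \<le> a} * N x ^ (2 * a)"
    using sum_bounded_above[of "{r \<in> R. ar r \<le> a}" "\<lambda>r. card (Y r)" "N x ^ (2 * a)"] card_Y by simp
  also have "\<dots> \<le> N x ^ length P * N x ^ (2 * a)"
  proof (rule mult_right_mono)
    have "card {r \<in> R. ar r \<le> a} \<le> card R" by (rule card_mono) (auto simp: R_def)
    also have "\<dots> \<le> length P" unfolding R_def by (metis card_image_le card_length finite_set le_trans)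
    also have "\<dots> \<le> 2 ^ length P" using less_exp[of "length P"] by simp
    also have "\<dots> \<le> N x ^ length P" using N_ge2[of x] by (rule power_mono) simp
    finally show "card {r \<in> R. ar r \<le> a} \<le> N x ^ length P" .
  qed simp
  also have "\<dots> = N x ^ w" by (simp add: w_def power_add)
  finally show ?thesis using finite_subset[OF sub finite_SigmaI[OF fin]] by simp
qed

text \<open>Each pass adds a fact until all are there, so that \<open>N ^ w\<close> passes suffice.\<close>

lemma gnest_grows:
  assumes "tame x L g" and "\<And>h F. ok x h \<Longrightarrow> F \<subseteq> L \<Longrightarrow> g x h F = F \<Longrightarrow> F = L"
    and "finite L" "ok x h" "F \<subseteq> L"
  shows "gnest js g x h F = L \<or> card F + N x ^ length js \<le> card (gnest js g x h F)"
  using assms(4,5)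
proof (induction js arbitrary: h F)
  case Nil
  have sub: "F \<subseteq> g x h F" "g x h F \<subseteq> L" using tameD[OF assms(1) Nil] by auto
  show ?case
  proof (cases "g x h F = F")
    case True
    then show ?thesis using assms(2)[OF Nil True] by simp
  next
    case False
    then have "card F < card (g x h F)"
      using sub assms(3) by (intro psubset_card_mono) (auto intro: finite_subset)
    then show ?thesis by simp
  qed
next
  case (Cons j js)
  let ?f = "\<lambda>v. gnest js g x (h(j := v))"
  have "fold ?f [0..<n] F \<subseteq> L \<and>
      (fold ?f [0..<n] F = L \<or> card F + n * N x ^ length js \<le> card (fold ?f [0..<n] F))"
    if "n \<le> N x" for n
    using that
  proof (induction n)
    case 0
    then show ?case using Cons.prems by simp
  next
    case (Suc n)
    let ?G = "fold ?f [0..<n] F"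
    have G: "?G \<subseteq> L" "?G = L \<or> card F + n * N x ^ length js \<le> card ?G"
      using Suc.IH[OF Suc_leD[OF Suc.prems]] by blast+
    have "n < N x" using Suc.prems by simp
    note ok' = ok_upd[OF Cons.prems(1) this, of j]
    have sub: "?G \<subseteq> ?f n ?G" "?f n ?G \<subseteq> L"
      using tameD[OF tame_gnest[OF assms(1)] ok' G(1)] by auto
    have "?f n ?G = L \<or> card ?G + N x ^ length js \<le> card (?f n ?G)"
      by (rule Cons.IH[OF ok' G(1)])
    moreover have "fold ?f [0..<Suc n] F = ?f n ?G" by simp
    ultimately show ?case using G(2) sub by (auto simp del: fun_upd_apply)
  qed
  from this[of "N x"] show ?case by (simp add: mult.commute)
qed

lemma search_facts: "gnest rounds (gnest vars sweep) x (\<lambda>_. 0) {} = facts x"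
proof -
  have ok0: "ok x (\<lambda>_. 0)" using N_ge2[of x] by (simp add: ok_def)
  have b: "tame x (facts x) (gnest vars sweep)" by (rule tame_gnest[OF tame_sweep])
  have sub: "gnest rounds (gnest vars sweep) x (\<lambda>_. 0) {} \<subseteq> facts x"
    using tameD[OF tame_gnest[OF b] ok0] by auto
  have "gnest rounds (gnest vars sweep) x (\<lambda>_. 0) {} = facts x \<or>
      card ({} :: ('r \<times> nat list) set) + N x ^ length rounds \<le>
        card (gnest rounds (gnest vars sweep) x (\<lambda>_. 0) {})"
    by (rule gnest_grows[OF b]) (use ok0 card_facts[of x] pass_fixed_point in auto)
  moreover have "length rounds = w" by (simp add: rounds_def)
  ultimately show ?thesis
    using card_seteq[OF conjunct1[OF card_facts] sub] card_facts[of x] by auto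
qed

text \<open>The goal has no arguments, so its cell is the one next to the left end.\<close>

theorem derivable_in_class_P:
  "{x. derives P ((length x + 2) ^ e) (input_symbol x) goal []} \<in> class_P"
proof -
  define c where "c = Seq prepare (Seq search (Move (rt goal) Right))"
  have fin: "finite (uses c)" "finite (symbs c)" for c by (induction c) auto
  obtain k' where k': "insert (rt goal) (uses c) \<subseteq> {..<k'}"
    using fin(1)[of c] finite_nat_iff_bounded by (metis finite_insert)
  obtain K' where K': "symbs c \<subseteq> {..<K'}"
    using fin(2)[of c] finite_nat_iff_bounded by metis
  obtain T where T: "poly_bounded T" "\<And>x F h. heads {} x h \<Longrightarrow> runs search (cont x F, h)
      (T (length x)) (cont x (gnest rounds (gnest vars sweep) x h F), h)"
    using does_search unfolding does_def by blast
  show ?thesis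
  proof (rule program_in_class_P[where i = "rt goal" and a = 2])
    show "uses c \<subseteq> {..<Suc k'}" "rt goal < Suc k'" using k' by auto
    show "symbs c \<subseteq> {..<max 4 K'}" "4 \<le> max 4 K'" using K' by auto
    show "tapes (Suc k') (start x) = input_tape x # replicate (Suc k' - 1) blank_tape" for x
      by (rule nth_equalityI)
        (auto simp: tapes_def start_def input_tape_def blank_tape_def nth_Cons simp del: upt_Suc
          split: nat.splits)
    show "poly_bounded (\<lambda>n. prepare_time n + (T n + 1))"
      by (intro poly_bounded_add poly_bounded_prepare_time T poly_bounded_const)
    fix x
    have "heads {} x (\<lambda>_. 0)" by (simp add: heads_def)
    from T(2)[OF this] have "runs search (cont x {}, \<lambda>_. 0) (T (length x)) (cont x (facts x), \<lambda>_. 0)"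
      by (metis search_facts)
    moreover have "runs (Move (rt goal) Right) (cont x (facts x), \<lambda>_. 0) 1
        (cont x (facts x), (\<lambda>_. 0)(rt goal := move Right 0))"
      using runs_Move[of "rt goal" Right "cont x (facts x)" "\<lambda>_. 0"] .
    ultimately have "runs c (start x) (prepare_time (length x) + (T (length x) + 1))
        (cont x (facts x), (\<lambda>_. 0)(rt goal := move Right 0))"
      unfolding c_def by (intro runs_Seq[OF runs_prepare] runs_Seq)
    moreover have "cont x (facts x) (rt goal) (((\<lambda>_. 0)(rt goal := move Right 0)) (rt goal)) = 2 \<longleftrightarrow>
        x \<in> {x. derives P ((length x + 2) ^ e) (input_symbol x) goal []}"
      using fact_cell_iff[of "[]" goal x "facts x"] goal_wf
      by (simp add: cont_rt facts_def bnd_def)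
    ultimately show "\<exists>t \<le> prepare_time (length x) + (T (length x) + 1). \<exists>C h. run c (start x) t (C, h) \<and>
        (C (rt goal) (h (rt goal)) = 2 \<longleftrightarrow> x \<in> {x. derives P ((length x + 2) ^ e) (input_symbol x) goal []})"
      unfolding runs_def by blast
  qed
qed

end

section \<open>The word metric\<close>

locale word_metric = group G for G (structure) +
  fixes S :: "'a set"
  assumes finite_S: "finite S" and S_carrier: "S \<subseteq> carrier G" and generate_S: "generate G S = carrier G"
begin

abbreviation letters :: "'a set" where "letters \<equiv> S \<union> m_inv G ` S"

abbreviation prod :: "'a list \<Rightarrow> 'a" where "prod ws \<equiv> foldr (\<otimes>) ws \<one>"

abbreviation len :: "'a \<Rightarrow> nat" where "len \<equiv> word_length G S"

definition dst :: "'a \<Rightarrow> 'a \<Rightarrow> nat" where "dst x y = len (inv x \<otimes> y)"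

lemma word_dist_eq: "word_dist G S x y = real (dst x y)"
  by (simp add: word_dist_def dst_def)

lemma letters_carrier: "letters \<subseteq> carrier G"
  using S_carrier by auto

lemma prod_closed: "set ws \<subseteq> carrier G \<Longrightarrow> prod ws \<in> carrier G"
  by (induction ws) auto

lemma prod_append: "set us \<subseteq> carrier G \<Longrightarrow> set vs \<subseteq> carrier G \<Longrightarrow> prod (us @ vs) = prod us \<otimes> prod vs"
  by (induction us) (auto simp: m_assoc prod_closed)

lemma inv_letter: "a \<in> letters \<Longrightarrow> inv a \<in> letters"
  using S_carrier by auto

lemma prod_inverse:
  "set ws \<subseteq> carrier G \<Longrightarrow> prod (rev (map (m_inv G) ws)) = inv (prod ws)"
proof (induction ws)
  case (Cons w ws)
  have "set (rev (map (m_inv G) ws)) \<subseteq> carrier G" using Cons.prems by auto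
  then show ?case
    using Cons by (simp add: prod_append inv_mult_group prod_closed del: rev_map foldr_append)
qed simp

lemma ex_word: "g \<in> carrier G \<Longrightarrow> \<exists>ws. set ws \<subseteq> letters \<and> prod ws = g"
proof -
  have "\<exists>ws. set ws \<subseteq> letters \<and> prod ws = g" if "g \<in> generate G S" for g
    using that
  proof induction
    case one
    then show ?case by (intro exI[of _ "[]"]) simp
  next
    case (incl h)
    then show ?case using S_carrier by (intro exI[of _ "[h]"]) auto
  next
    case (inv h)
    then show ?case using S_carrier by (intro exI[of _ "[m_inv G h]"]) auto
  next
    case (eng h1 h2)
    then obtain us vs where "set us \<subseteq> letters" "prod us = h1" "set vs \<subseteq> letters" "prod vs = h2"
      by blast
    then show ?case
      using prod_append[of us vs] letters_carrier by (intro exI[of _ "us @ vs"]) (auto simp del: foldr_append)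
  qed
  then show "g \<in> carrier G \<Longrightarrow> ?thesis" using generate_S by simp
qed

lemma len_word:
  assumes "g \<in> carrier G"
  obtains ws where "length ws = len g" "set ws \<subseteq> letters" "prod ws = g"
proof -
  have "\<exists>n ws. length ws = n \<and> set ws \<subseteq> letters \<and> prod ws = g"
    using ex_word[OF assms] by blast
  from LeastI_ex[OF this] show thesis using that unfolding word_length_def by blast
qed

lemma len_le: "set ws \<subseteq> letters \<Longrightarrow> len (prod ws) \<le> length ws"
  unfolding word_length_def by (rule Least_le) blast

lemma len_one [simp]: "len \<one> = 0"
  using len_le[of "[]"] by simp

lemma len_mult: "g \<in> carrier G \<Longrightarrow> h \<in> carrier G \<Longrightarrow> len (g \<otimes> h) \<le> len g + len h"
proof -
  assume "g \<in> carrier G" "h \<in> carrier G"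
  then obtain us vs where us: "length us = len g" "set us \<subseteq> letters" "prod us = g"
    and vs: "length vs = len h" "set vs \<subseteq> letters" "prod vs = h"
    by (metis len_word)
  then have "prod (us @ vs) = g \<otimes> h" using prod_append[of us vs] letters_carrier by blast
  then show ?thesis using len_le[of "us @ vs"] us vs by auto
qed

lemma len_inv: "g \<in> carrier G \<Longrightarrow> len (inv g) = len g"
proof -
  have le: "len (inv g) \<le> len g" if g: "g \<in> carrier G" for g
  proof -
    obtain ws where ws: "length ws = len g" "set ws \<subseteq> letters" "prod ws = g"
      using len_word[OF g] by blast
    have "prod (rev (map (m_inv G) ws)) = inv g"
      using prod_inverse[of ws] ws letters_carrier by blast
    moreover have "set (rev (map (m_inv G) ws)) \<subseteq> letters" using ws inv_letter by auto
    ultimately show ?thesis using len_le[of "rev (map (m_inv G) ws)"] ws by simp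
  qed
  then show "g \<in> carrier G \<Longrightarrow> ?thesis" using le[of "inv g"] by force
qed

lemma finite_ball: "finite {g \<in> carrier G. len g \<le> n}"
proof (rule finite_surj)
  show "finite {ws. set ws \<subseteq> letters \<and> length ws \<le> n}"
    using finite_S by (intro finite_lists_length_le) auto
  show "{g \<in> carrier G. len g \<le> n} \<subseteq> prod ` {ws. set ws \<subseteq> letters \<and> length ws \<le> n}"
    by (auto elim!: len_word)
qed

lemma inv_mult_cancel: "x \<in> carrier G \<Longrightarrow> y \<in> carrier G \<Longrightarrow> z \<in> carrier G \<Longrightarrow>
    inv x \<otimes> y \<otimes> (inv y \<otimes> z) = inv x \<otimes> z"
  by (metis inv_closed m_assoc m_closed r_inv r_one)

lemma inv_diff: "x \<in> carrier G \<Longrightarrow> y \<in> carrier G \<Longrightarrow> inv (inv x \<otimes> y) = inv y \<otimes> x"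
  by (simp add: inv_mult_group)

lemma dst_self: "x \<in> carrier G \<Longrightarrow> dst x x = 0"
  by (simp add: dst_def)

lemma dst_commute: "x \<in> carrier G \<Longrightarrow> y \<in> carrier G \<Longrightarrow> dst x y = dst y x"
  unfolding dst_def by (metis inv_diff len_inv inv_closed m_closed)

lemma dst_triangle:
  "x \<in> carrier G \<Longrightarrow> y \<in> carrier G \<Longrightarrow> z \<in> carrier G \<Longrightarrow> dst x z \<le> dst x y + dst y z"
  unfolding dst_def by (metis inv_mult_cancel len_mult inv_closed m_closed)

lemma dst_mult_right: "x \<in> carrier G \<Longrightarrow> g \<in> carrier G \<Longrightarrow> dst x (x \<otimes> g) = len g"
  unfolding dst_def by (simp add: m_assoc[symmetric])

definition geodesic :: "(nat \<Rightarrow> 'a) \<Rightarrow> nat \<Rightarrow> 'a \<Rightarrow> 'a \<Rightarrow> bool" where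
  "geodesic \<gamma> m x y \<longleftrightarrow> \<gamma> 0 = x \<and> \<gamma> m = y \<and> (\<forall>i\<le>m. \<gamma> i \<in> carrier G) \<and>
     (\<forall>i j. i \<le> j \<longrightarrow> j \<le> m \<longrightarrow> dst (\<gamma> i) (\<gamma> j) = j - i)"

lemma geodesicD:
  assumes "geodesic \<gamma> m x y"
  shows "\<gamma> 0 = x" "\<gamma> m = y" "i \<le> m \<Longrightarrow> \<gamma> i \<in> carrier G" "x \<in> carrier G" "y \<in> carrier G"
    "i \<le> j \<Longrightarrow> j \<le> m \<Longrightarrow> dst (\<gamma> i) (\<gamma> j) = j - i" "dst x y = m"
  using assms unfolding geodesic_def by auto

lemma ex_geodesic:
  assumes "x \<in> carrier G" "y \<in> carrier G"
  shows "\<exists>\<gamma>. geodesic \<gamma> (dst x y) x y"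
proof -
  obtain ws where ws: "length ws = dst x y" "set ws \<subseteq> letters" "prod ws = inv x \<otimes> y"
    unfolding dst_def using assms by (metis len_word inv_closed m_closed)
  define \<gamma> where "\<gamma> i = x \<otimes> prod (take i ws)" for i
  let ?m = "dst x y"
  have sub: "set (take i ws) \<subseteq> carrier G" "set (drop i ws) \<subseteq> carrier G" for i
    using ws letters_carrier set_take_subset[of i ws] set_drop_subset[of i ws] by blast+
  have carrier: "\<gamma> i \<in> carrier G" for i
    using assms prod_closed[OF sub(1)] by (simp add: \<gamma>_def)
  have ends: "\<gamma> 0 = x" "\<gamma> ?m = y"
    using assms ws by (simp_all add: \<gamma>_def m_assoc[symmetric])
  have le: "dst (\<gamma> i) (\<gamma> j) \<le> j - i" if "i \<le> j" "j \<le> ?m" for i j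
  proof -
    let ?vs = "drop i (take j ws)"
    have vs: "set ?vs \<subseteq> letters" using ws set_drop_subset[of i "take j ws"] set_take_subset[of j ws] by blast
    have "take j ws = take i ws @ ?vs" using that by (metis append_take_drop_id min.absorb1 take_take)
    then have "prod (take j ws) = prod (take i ws) \<otimes> prod ?vs"
      using prod_append[of "take i ws" ?vs] sub(1) vs letters_carrier by (metis subset_trans)
    moreover have vs_prod: "prod ?vs \<in> carrier G" using prod_closed[of ?vs] vs letters_carrier by blast
    ultimately have "\<gamma> j = \<gamma> i \<otimes> prod ?vs"
      using assms prod_closed[OF sub(1)] by (simp add: \<gamma>_def m_assoc)
    then have "dst (\<gamma> i) (\<gamma> j) = len (prod ?vs)"
      using dst_mult_right[OF carrier vs_prod] by simp
    also have "\<dots> \<le> j - i" using len_le[OF vs] ws(1) that by simp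
    finally show ?thesis .
  qed
  have "dst (\<gamma> i) (\<gamma> j) = j - i" if ij: "i \<le> j" "j \<le> ?m" for i j
  proof -
    have "?m \<le> dst (\<gamma> 0) (\<gamma> i) + dst (\<gamma> i) (\<gamma> ?m)"
      using dst_triangle[OF assms(1) carrier[of i] assms(2)] ends by simp
    also have "dst (\<gamma> i) (\<gamma> ?m) \<le> dst (\<gamma> i) (\<gamma> j) + dst (\<gamma> j) (\<gamma> ?m)"
      using dst_triangle[OF carrier carrier carrier] .
    finally show ?thesis using le[of 0 i] le[of j ?m] le[OF ij] ij by linarith
  qed
  then show ?thesis using ends carrier unfolding geodesic_def by blast
qed

lemma geodesic_reverse:
  assumes "geodesic \<gamma> m x y"
  shows "geodesic (\<lambda>i. \<gamma> (m - i)) m y x"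
proof -
  have "dst (\<gamma> (m - i)) (\<gamma> (m - j)) = j - i" if "i \<le> j" "j \<le> m" for i j
    using geodesicD(6)[OF assms, of "m - j" "m - i"] that
      dst_commute[OF geodesicD(3)[OF assms, of "m - i"] geodesicD(3)[OF assms, of "m - j"]] by simp
  then show ?thesis using assms unfolding geodesic_def by auto
qed


section \<open>Lifting geodesics to chains of short words\<close>

text \<open>
  A node \<open>(u, s)\<close> is a vertex \<open>u\<close> of a labelled graph together with a word \<open>s\<close> of at most \<open>l\<close>
  elements of the ball of radius \<open>R\<close>; if \<open>u\<close> lies over the group element \<open>x\<close>, the node lies over
  \<open>x \<otimes> prod s\<close>. The relation \<open>linked a g b\<close> says that a passage from \<open>a\<close> to \<open>b\<close> with value \<open>g\<close> is
  obtained from elementary ones by compositions that never leave the ball.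
\<close>

inductive walk :: "(nat \<Rightarrow> 'a \<Rightarrow> nat \<Rightarrow> bool) \<Rightarrow> nat \<Rightarrow> nat \<Rightarrow> 'a \<Rightarrow> nat \<Rightarrow> bool" for E where
  walk_Nil: "walk E u 0 \<one> u"
| walk_Cons: "E u g v \<Longrightarrow> g \<in> carrier G \<Longrightarrow> walk E v n h w \<Longrightarrow> walk E u (Suc n) (g \<otimes> h) w"

lemma walk_carrier: "walk E u n g v \<Longrightarrow> g \<in> carrier G"
  by (induction rule: walk.induct) auto

lemma walk_split:
  assumes "walk E u n g w" "i \<le> n"
  shows "\<exists>v g1 g2. walk E u i g1 v \<and> walk E v (n - i) g2 w \<and> g = g1 \<otimes> g2"
  using assms
proof (induction arbitrary: i rule: walk.induct)
  case (walk_Nil u)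
  then show ?case using walk.walk_Nil by fastforce
next
  case (walk_Cons u g v n h w)
  show ?case
  proof (cases i)
    case 0
    have "walk E u (Suc n) (g \<otimes> h) w" using walk_Cons.hyps by (rule walk.walk_Cons)
    then show ?thesis using 0 walk.walk_Nil walk_carrier by (metis diff_zero l_one)
  next
    case (Suc i')
    then obtain v' g1 g2 where "walk E v i' g1 v'" "walk E v' (n - i') g2 w" "h = g1 \<otimes> g2"
      using walk_Cons.IH[of i'] walk_Cons.prems by auto
    then show ?thesis
      using walk.walk_Cons[of E u g v i' g1 v'] walk_Cons.hyps Suc walk_carrier
      by (metis diff_Suc_Suc m_assoc)
  qed
qed

type_synonym 'g node = "nat \<times> 'g list"

inductive linked :: "(nat \<Rightarrow> 'a \<Rightarrow> nat \<Rightarrow> bool) \<Rightarrow> nat \<Rightarrow> nat \<Rightarrow> 'a node \<Rightarrow> 'a \<Rightarrow> 'a node \<Rightarrow> bool"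
  for E R l where
  stay: "length s \<le> l \<Longrightarrow> linked E R l (u, s) \<one> (u, s)"
| push: "length s < l \<Longrightarrow> b \<in> carrier G \<Longrightarrow> len b \<le> R \<Longrightarrow> linked E R l (u, s) b (u, s @ [b])"
| pop: "length s < l \<Longrightarrow> b \<in> carrier G \<Longrightarrow> len b \<le> R \<Longrightarrow> linked E R l (u, s @ [b]) (inv b) (u, s)"
| arc: "E u g v \<Longrightarrow> g \<in> carrier G \<Longrightarrow> len g \<le> R \<Longrightarrow> linked E R l (u, []) g (v, [])"
| comp: "linked E R l a g b \<Longrightarrow> linked E R l b h c \<Longrightarrow> len (g \<otimes> h) \<le> R \<Longrightarrow> linked E R l a (g \<otimes> h) c"

text \<open>Nodes are placed over points, which makes the values of passages implicit.\<close>

definition joined :: "(nat \<Rightarrow> 'a \<Rightarrow> nat \<Rightarrow> bool) \<Rightarrow> nat \<Rightarrow> nat \<Rightarrow> 'a node \<Rightarrow> 'a \<Rightarrow> 'a node \<Rightarrow> 'a \<Rightarrow> bool" where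
  "joined E R l a x b y \<longleftrightarrow> x \<in> carrier G \<and> y \<in> carrier G \<and> linked E R l a (inv x \<otimes> y) b"

lemma joined_trans:
  assumes "joined E R l a x b y" "joined E R l b y c z" "dst x z \<le> R"
  shows "joined E R l a x c z"
proof -
  have eq: "inv x \<otimes> y \<otimes> (inv y \<otimes> z) = inv x \<otimes> z"
    using assms inv_mult_cancel by (auto simp: joined_def)
  have "linked E R l a (inv x \<otimes> y \<otimes> (inv y \<otimes> z)) c"
    by (rule linked.comp) (use assms eq in \<open>auto simp: joined_def dst_def\<close>)
  then show ?thesis using assms eq by (simp add: joined_def)
qed

definition extend :: "'a node \<Rightarrow> 'a \<Rightarrow> 'a \<Rightarrow> 'a node" where
  "extend a x y = (fst a, snd a @ [inv x \<otimes> y])"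

lemma joined_extend:
  assumes "length (snd a) < l" "x \<in> carrier G" "y \<in> carrier G" "dst x y \<le> R"
  shows "joined E R l a x (extend a x y) y" "joined E R l (extend a x y) y a x"
  using linked.push[of "snd a" l "inv x \<otimes> y" R E "fst a"]
    linked.pop[of "snd a" l "inv x \<otimes> y" R E "fst a"] assms
  by (auto simp: joined_def extend_def dst_def inv_diff)

lemma joined_refl: "length (snd a) \<le> l \<Longrightarrow> x \<in> carrier G \<Longrightarrow> joined E R l a x a x"
  using linked.stay[of "snd a" l E R "fst a"] by (simp add: joined_def)

end

locale hyperbolic_word_metric = word_metric +
  fixes \<delta> :: real
  assumes hyperbolic: "gromov_hyperbolic (carrier G) (word_dist G S) \<delta>"
begin

definition thin :: nat where "thin = nat \<lceil>4 * \<delta>\<rceil>"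

text \<open>
  Two geodesics from \<open>x\<close> to \<open>y\<close> and to \<open>z\<close> stay close up to the Gromov product of \<open>y\<close> and \<open>z\<close>, by
  the four point condition on \<open>\<gamma> t, y, z\<close> and then on \<open>\<gamma> t, z, \<gamma>' t\<close>.
\<close>

lemma fellow_travel:
  assumes \<gamma>: "geodesic \<gamma> m x y" and \<gamma>': "geodesic \<gamma>' m' x z"
    and t: "t \<le> m" "t \<le> m'" "2 * t + dst y z \<le> m + m'"
  shows "dst (\<gamma> t) (\<gamma>' t) \<le> thin"
proof -
  let ?gp = "gromov_product (word_dist G S) x"
  have car: "x \<in> carrier G" "y \<in> carrier G" "z \<in> carrier G" "\<gamma> t \<in> carrier G" "\<gamma>' t \<in> carrier G"
    using geodesicD[OF \<gamma>] geodesicD[OF \<gamma>'] t by auto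
  have four: "min (?gp a b) (?gp b c) - \<delta> \<le> ?gp a c"
    if "a \<in> carrier G" "b \<in> carrier G" "c \<in> carrier G" for a b c
    using hyperbolic that car(1) unfolding gromov_hyperbolic_def by blast
  have d: "dst x (\<gamma> t) = t" "dst (\<gamma> t) y = m - t" "dst x y = m"
    using geodesicD(6)[OF \<gamma>, of 0 t] geodesicD(6)[OF \<gamma>, of t m] geodesicD[OF \<gamma>] t by auto
  have d': "dst x (\<gamma>' t) = t" "dst z (\<gamma>' t) = m' - t" "dst x z = m'"
    using geodesicD(6)[OF \<gamma>', of 0 t] geodesicD(6)[OF \<gamma>', of t m'] geodesicD[OF \<gamma>'] t
      dst_commute[OF car(3,5)] by auto
  have "?gp (\<gamma> t) y = t" "?gp z (\<gamma>' t) = t"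
    using d d' t by (auto simp: gromov_product_def word_dist_eq of_nat_diff)
  moreover have "t \<le> ?gp y z"
  proof -
    have "real (2 * t + dst y z) \<le> real (m + m')" using t(3) by (simp only: of_nat_le_iff)
    then show ?thesis using d d' by (simp add: gromov_product_def word_dist_eq field_simps)
  qed
  ultimately have "t - 2 * \<delta> \<le> ?gp (\<gamma> t) (\<gamma>' t) \<or> t - \<delta> \<le> ?gp (\<gamma> t) (\<gamma>' t)"
    using four[OF car(4,2,3)] four[OF car(4,3,5)] by linarith
  moreover have "0 \<le> \<delta>"
  proof -
    have "min (?gp x x) (?gp x x) - \<delta> \<le> ?gp x x" using four car by blast
    then show ?thesis by simp
  qed
  ultimately have "t - 2 * \<delta> \<le> ?gp (\<gamma> t) (\<gamma>' t)" by linarith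
  then have "real (dst (\<gamma> t) (\<gamma>' t)) \<le> 4 * \<delta>"
    using d d' by (simp add: gromov_product_def word_dist_eq field_simps)
  then show ?thesis unfolding thin_def by linarith
qed


text \<open>
  The geodesic from the start to the end of a walk lifts to a chain of nodes, with words whose
  length is logarithmic in the length of the walk. The walk is cut in the middle. The geodesics of
  the halves form a triangle with the one to be lifted, and each point of the latter is close to
  a point of one of the former (tripod comparison), so one more letter reaches it from a node that
  lies over that point. At the centre of the tripod the chain changes from the first half to the
  second: the two halves are joined at their common end \<open>y\<close>, and this link is carried outwards
  along the two geodesics that leave \<open>y\<close>, which travel together up to the centre.
\<close>

lemma lift_geodesic:
  assumes R: "2 * thin + 3 \<le> R" and E: "\<And>u g v. E u g v \<Longrightarrow> len g \<le> R"
    and "walk E u n g v" "n \<le> 2 ^ k" "k < l" "geodesic \<gamma> m x (x \<otimes> g)"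
  shows "\<exists>a. joined E R l (u, []) x (a 0) x \<and> joined E R l (a m) (x \<otimes> g) (v, []) (x \<otimes> g) \<and>
    (\<forall>i\<le>m. length (snd (a i)) \<le> Suc k) \<and>
    (\<forall>i<m. joined E R l (a i) (\<gamma> i) (a (Suc i)) (\<gamma> (Suc i)))"
  using assms(3-)
proof (induction k arbitrary: u n g v \<gamma> m x)
  case 0
  note \<gamma> = geodesicD[OF 0(4)]
  consider "n = 0" | "n = Suc 0" using 0(2) by force
  then show ?case
  proof cases
    case 1
    then have "g = \<one>" "u = v" using 0(1) by (auto elim: walk.cases)
    moreover from this have "m = 0" using \<gamma> dst_self by simp
    ultimately show ?thesis using joined_refl[of "(u, [])"] \<gamma> by (intro exI[of _ "\<lambda>_. (u, [])"]) simp
  next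
    case 2
    then obtain g' v' h where w: "E u g' v'" "g' \<in> carrier G" "walk E v' 0 h v" "g = g' \<otimes> h"
      using 0(1) by (auto elim: walk.cases)
    then have "h = \<one>" "v' = v" by (auto elim: walk.cases)
    then have arc: "E u g v" "g \<in> carrier G" using w by auto
    have m: "m \<le> R" using \<gamma>(7) dst_mult_right[OF \<gamma>(4) arc(2)] E[OF arc(1)] by simp
    \<comment> \<open>A single edge is short enough for one letter to reach every point of the geodesic from \<open>x\<close>.\<close>
    define a where "a i = extend (u, []) x (\<gamma> i)" for i
    have a: "joined E R l (u, []) x (a i) (\<gamma> i)" "joined E R l (a i) (\<gamma> i) (u, []) x"
      if "i \<le> m" for i
      unfolding a_def using joined_extend[of "(u, [])" l x "\<gamma> i" R E] \<gamma>(1,3,4) that m 0(3)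
        \<gamma>(6)[of 0 i] by auto
    have "joined E R l (u, []) x (v, []) (x \<otimes> g)"
      using linked.arc[of E u g v R l] arc E[OF arc(1)] \<gamma>(4)
      by (simp add: joined_def m_assoc[symmetric])
    then have "joined E R l (a m) (x \<otimes> g) (v, []) (x \<otimes> g)"
      using joined_trans[OF a(2)[of m]] \<gamma>(2,5) dst_self by simp
    moreover have "joined E R l (a i) (\<gamma> i) (a (Suc i)) (\<gamma> (Suc i))" if "i < m" for i
      by (rule joined_trans[OF a(2) a(1)]) (use that \<gamma>(6)[of i "Suc i"] R in auto)
    moreover have "length (snd (a i)) \<le> Suc 0" for i by (simp add: a_def extend_def)
    ultimately show ?thesis using a(1)[of 0] \<gamma>(1) by (intro exI[of _ a]) auto
  qed
next
  case (Suc k)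
  let ?j = "joined E R l"
  note \<gamma> = geodesicD[OF Suc.prems(4)]
  obtain v' g1 g2 where w: "walk E u (min n (2 ^ k)) g1 v'" "walk E v' (n - min n (2 ^ k)) g2 v"
    "g = g1 \<otimes> g2"
    using walk_split[OF Suc.prems(1), of "min n (2 ^ k)"] by auto
  have g: "g1 \<in> carrier G" "g2 \<in> carrier G" using w walk_carrier by auto
  define y z where "y = x \<otimes> g1" and "z = x \<otimes> g"
  have car: "x \<in> carrier G" "y \<in> carrier G" "z \<in> carrier G" and z: "z = y \<otimes> g2"
    using \<gamma>(4,5) g w(3) by (auto simp: y_def z_def m_assoc)
  define m1 m2 where "m1 = dst x y" and "m2 = dst y z"
  obtain \<gamma>1 \<gamma>2 where geo: "geodesic \<gamma>1 m1 x y" "geodesic \<gamma>2 m2 y z"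
    using ex_geodesic[OF car(1,2)] ex_geodesic[OF car(2,3)] unfolding m1_def m2_def by metis
  note \<gamma>1 = geodesicD[OF geo(1)] and \<gamma>2 = geodesicD[OF geo(2)]
  obtain a where a: "?j (u, []) x (a 0) x" "?j (a m1) y (v', []) y"
    "\<And>i. i \<le> m1 \<Longrightarrow> length (snd (a i)) \<le> Suc k"
    "\<And>i. i < m1 \<Longrightarrow> ?j (a i) (\<gamma>1 i) (a (Suc i)) (\<gamma>1 (Suc i))"
    using Suc.IH[OF w(1) _ _ geo(1)[unfolded y_def]] Suc.prems(3) unfolding y_def by auto
  have half: "n - min n (2 ^ k) \<le> 2 ^ k" using Suc.prems(2) by (auto simp: min_def)
  obtain b where b: "?j (v', []) y (b 0) y" "?j (b m2) z (v, []) z"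
    "\<And>i. i \<le> m2 \<Longrightarrow> length (snd (b i)) \<le> Suc k"
    "\<And>i. i < m2 \<Longrightarrow> ?j (b i) (\<gamma>2 i) (b (Suc i)) (\<gamma>2 (Suc i))"
    using Suc.IH[OF w(2) half _ geo(2)[unfolded z]] Suc.prems(3) unfolding z by auto
  have geo0: "geodesic \<gamma> m x z" using Suc.prems(4) by (simp add: z_def)
  have m: "dst x z = m" using geodesicD(7)[OF geo0] .
  have tri: "m \<le> m1 + m2" "m1 \<le> m + m2" "m2 \<le> m1 + m"
    using dst_triangle[of x y z] dst_triangle[of x z y] dst_triangle[of y x z] dst_commute[of z y]
      dst_commute[of x y] car m by (auto simp: m1_def m2_def)
  \<comment> \<open>The centre of the tripod is at distance \<open>t\<close> from \<open>x\<close>, up to rounding.\<close>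
  define t where "t = (m1 + m - m2) div 2"
  have t: "2 * t \<le> m1 + m - m2" "m1 + m - m2 \<le> 2 * t + 1" by (auto simp: t_def)
  have tm: "t \<le> m" "t \<le> m1" "m1 - t \<le> m2" using t tri by linarith+
  have near1: "dst (\<gamma>1 i) (\<gamma> i) \<le> thin" if "i \<le> t" for i
    by (rule fellow_travel[OF geo(1) geo0]) (use that t tm tri m2_def in linarith)+
  have near2: "dst (\<gamma>2 (m2 - i)) (\<gamma> (m - i)) \<le> thin" if "i < m - t" for i
  proof (rule fellow_travel[OF geodesic_reverse[OF geo(2)] geodesic_reverse[OF geo0]])
    show "2 * i + dst y x \<le> m2 + m"
      using that t tm tri dst_commute[OF car(1,2)] unfolding m1_def[symmetric] by linarith
  qed (use that t tm tri in linarith)+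
  have near_y: "dst (\<gamma>1 (m1 - q)) (\<gamma>2 q) \<le> thin" if "q \<le> m1" "q \<le> m2" "2 * q + m \<le> m1 + m2" for q
    by (rule fellow_travel[OF geodesic_reverse[OF geo(1)] geo(2)]) (use that m in auto)
  \<comment> \<open>The last rung may lie beyond the centre by half a unit, which costs one step on each side.\<close>
  have rung: "dst (\<gamma>1 (m1 - q)) (\<gamma>2 q) \<le> thin + 2" if q: "q \<le> m1 - t" for q
  proof (cases q)
    case 0
    then show ?thesis using \<gamma>1(2) \<gamma>2(1) dst_self car by simp
  next
    case (Suc q')
    have q': "Suc q' \<le> m1" "Suc q' \<le> m2" "2 * q' + m \<le> m1 + m2" using q Suc t tm tri by linarith+
    have c: "\<gamma>1 (m1 - Suc q') \<in> carrier G" "\<gamma>1 (m1 - q') \<in> carrier G" "\<gamma>2 q' \<in> carrier G"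
      "\<gamma>2 (Suc q') \<in> carrier G" using \<gamma>1(3) \<gamma>2(3) q' by auto
    have "dst (\<gamma>1 (m1 - Suc q')) (\<gamma>1 (m1 - q')) = 1" "dst (\<gamma>2 q') (\<gamma>2 (Suc q')) = 1"
      using \<gamma>1(6)[of "m1 - Suc q'" "m1 - q'"] \<gamma>2(6)[of q' "Suc q'"] q' by auto
    then show ?thesis
      using near_y[of q'] q' dst_triangle[OF c(1,2,4)] dst_triangle[OF c(2,3,4)] Suc by simp
  qed
  have link: "?j (a (m1 - q)) (\<gamma>1 (m1 - q)) (b q) (\<gamma>2 q)" if "q \<le> m1 - t" for q
    using that
  proof (induction q)
    case 0
    show ?case using joined_trans[OF a(2) b(1)] \<gamma>1(2) \<gamma>2(1) dst_self car by simp
  next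
    case (Suc q)
    have q: "Suc q \<le> m1" "Suc q \<le> m2" "Suc (m1 - Suc q) = m1 - q" using Suc.prems tm by linarith+
    have c: "\<gamma>1 (m1 - Suc q) \<in> carrier G" "\<gamma>1 (m1 - q) \<in> carrier G" "\<gamma>2 q \<in> carrier G"
      using \<gamma>1(3) \<gamma>2(3) q by auto
    have "dst (\<gamma>1 (m1 - Suc q)) (\<gamma>1 (m1 - q)) = 1"
      using \<gamma>1(6)[of "m1 - Suc q" "m1 - q"] q by auto
    then have "dst (\<gamma>1 (m1 - Suc q)) (\<gamma>2 q) \<le> R"
      using dst_triangle[OF c] rung[of q] Suc.prems R by simp
    moreover have "?j (a (m1 - Suc q)) (\<gamma>1 (m1 - Suc q)) (a (m1 - q)) (\<gamma>1 (m1 - q))"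
      using a(4)[of "m1 - Suc q"] q by simp
    ultimately have "?j (a (m1 - Suc q)) (\<gamma>1 (m1 - Suc q)) (b q) (\<gamma>2 q)"
      using joined_trans Suc.IH Suc.prems by (meson Suc_leD)
    then show ?case
      by (rule joined_trans[OF _ b(4)]) (use q rung[OF Suc.prems] R in auto)
  qed
  define c where "c i = (if i \<le> t then extend (a i) (\<gamma>1 i) (\<gamma> i)
     else extend (b (m2 - (m - i))) (\<gamma>2 (m2 - (m - i))) (\<gamma> i))" for i
  have c1: "?j (a i) (\<gamma>1 i) (c i) (\<gamma> i)" "?j (c i) (\<gamma> i) (a i) (\<gamma>1 i)" if "i \<le> t" for i
    unfolding c_def
    using joined_extend[of "a i" l "\<gamma>1 i" "\<gamma> i" R E] a(3)[of i] near1[of i] \<gamma>1(3)[of i] \<gamma>(3)[of i]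
      that tm Suc.prems(3) R by auto
  have c2: "?j (b (m2 - (m - i))) (\<gamma>2 (m2 - (m - i))) (c i) (\<gamma> i)"
    "?j (c i) (\<gamma> i) (b (m2 - (m - i))) (\<gamma>2 (m2 - (m - i)))" if "t < i" "i \<le> m" for i
  proof -
    let ?i = "m2 - (m - i)"
    have "length (snd (b ?i)) < l" using b(3)[of ?i] Suc.prems(3) by simp
    moreover have "m - i < m - t" using that by linarith
    then have "dst (\<gamma>2 ?i) (\<gamma> i) \<le> R" using near2[of "m - i"] that R by simp
    moreover have "\<gamma>2 ?i \<in> carrier G" "\<gamma> i \<in> carrier G" using \<gamma>2(3) \<gamma>(3) that by auto
    ultimately show "?j (b ?i) (\<gamma>2 ?i) (c i) (\<gamma> i)" "?j (c i) (\<gamma> i) (b ?i) (\<gamma>2 ?i)"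
      using joined_extend[of "b ?i" l "\<gamma>2 ?i" "\<gamma> i" R E] that by (simp_all add: c_def)
  qed
  have step1: "dst (\<gamma>1 i) (\<gamma>1 (Suc i)) = 1" if "i < m1" for i using \<gamma>1(6)[of i "Suc i"] that by simp
  have step2: "dst (\<gamma>2 i) (\<gamma>2 (Suc i)) = 1" if "i < m2" for i using \<gamma>2(6)[of i "Suc i"] that by simp
  have step: "dst (\<gamma> i) (\<gamma> (Suc i)) = 1" if "i < m" for i using \<gamma>(6)[of i "Suc i"] that by simp
  let ?r = "m1 - t"
  have "dst (\<gamma> t) (\<gamma>1 t) \<le> thin"
    using near1[of t] dst_commute[OF \<gamma>(3) \<gamma>1(3), of t t] tm by simp
  then have centre_dst: "dst (\<gamma> t) (\<gamma>2 ?r) \<le> 2 * thin + 2"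
    using dst_triangle[of "\<gamma> t" "\<gamma>1 t" "\<gamma>2 ?r"] rung[of ?r] \<gamma>(3)[of t] \<gamma>1(3)[of t] \<gamma>2(3)[of ?r] tm
    by simp
  then have centre: "?j (c t) (\<gamma> t) (b ?r) (\<gamma>2 ?r)"
    using joined_trans[OF c1(2)[of t]] link[of ?r] tm R by simp
  have chain: "?j (c i) (\<gamma> i) (c (Suc i)) (\<gamma> (Suc i))" if i: "i < m" for i
  proof -
    consider "Suc i \<le> t" | "i = t" | "t < i" by linarith
    then show ?thesis
    proof cases
      case 1
      have cc: "\<gamma> i \<in> carrier G" "\<gamma>1 i \<in> carrier G" "\<gamma>1 (Suc i) \<in> carrier G"
        using \<gamma>(3) \<gamma>1(3) i 1 tm by auto
      have "dst (\<gamma> i) (\<gamma>1 (Suc i)) \<le> R"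
        using dst_triangle[OF cc] dst_commute[OF cc(1,2)] near1[of i] step1[of i] 1 tm R by simp
      then have "?j (c i) (\<gamma> i) (a (Suc i)) (\<gamma>1 (Suc i))"
        using joined_trans[OF c1(2)[of i] a(4)[of i]] 1 tm by simp
      then show ?thesis using joined_trans[OF _ c1(1)[OF 1]] step[OF i] R by simp
    next
      case 3
      let ?i = "m2 - (m - i)"
      have i': "?i < m2" "m2 - (m - Suc i) = Suc ?i" using t tri 3 i by linarith+
      have cc: "\<gamma> i \<in> carrier G" "\<gamma>2 ?i \<in> carrier G" "\<gamma>2 (Suc ?i) \<in> carrier G"
        using \<gamma>(3) \<gamma>2(3) i i' by auto
      have "dst (\<gamma> i) (\<gamma>2 ?i) \<le> thin"
        using near2[of "m - i"] dst_commute[OF cc(1,2)] i 3 by simp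
      then have "dst (\<gamma> i) (\<gamma>2 (Suc ?i)) \<le> R"
        using dst_triangle[OF cc] step2[OF i'(1)] R by simp
      then have "?j (c i) (\<gamma> i) (b (Suc ?i)) (\<gamma>2 (Suc ?i))"
        using joined_trans[OF c2(2)[of i] b(4)[of ?i]] 3 i i' by simp
      moreover have "?j (b (Suc ?i)) (\<gamma>2 (Suc ?i)) (c (Suc i)) (\<gamma> (Suc i))"
        using c2(1)[of "Suc i"] i' 3 i by simp
      ultimately show ?thesis using joined_trans step[OF i] R by fastforce
    next
      case 2
      \<comment> \<open>Because of rounding, the second half can enter at two positions.\<close>
      let ?i = "m2 - (m - Suc t)"
      have "?i = ?r \<or> ?i = Suc ?r" using t tri tm i 2 by linarith
      moreover have "?i \<le> m2" by simp
      moreover have "?j (c t) (\<gamma> t) (b (Suc ?r)) (\<gamma>2 (Suc ?r))" if r: "Suc ?r \<le> m2"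
      proof (rule joined_trans[OF centre b(4)])
        show "dst (\<gamma> t) (\<gamma>2 (Suc ?r)) \<le> R"
          using dst_triangle[of "\<gamma> t" "\<gamma>2 ?r" "\<gamma>2 (Suc ?r)"] centre_dst step2[of ?r] r R
            \<gamma>(3)[of t] \<gamma>2(3)[of ?r] \<gamma>2(3)[of "Suc ?r"] tm by simp
      qed (use r in simp)
      ultimately have "?j (c t) (\<gamma> t) (b ?i) (\<gamma>2 ?i)" using centre by metis
      then show ?thesis
        using joined_trans[OF _ c2(1)[of "Suc t"]] step[OF i] 2 i R by simp
    qed
  qed
  have first: "?j (u, []) x (c 0) x"
    using joined_trans[OF a(1)] c1(1)[of 0] \<gamma>1(1) \<gamma>(1) dst_self car by simp
  have last: "?j (c m) z (v, []) z"
  proof (cases "t < m")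
    case True
    have "\<gamma> m = z" using \<gamma>(2) by (simp add: z_def)
    then show ?thesis
      using joined_trans[OF _ b(2)] c2(2)[of m] True \<gamma>2(2) dst_self car by simp
  next
    case False
    then have "t = m" "?r = m2" using tm t tri by linarith+
    then show ?thesis
      using joined_trans[OF _ b(2)] centre \<gamma>2(2) \<gamma>(2) dst_self car by (simp add: z_def)
  qed
  have "length (snd (c i)) \<le> Suc (Suc k)" if "i \<le> m" for i
    using a(3)[of i] b(3)[of "m2 - (m - i)"] tm that by (auto simp: c_def extend_def)
  then show ?case using first last chain unfolding z_def by (intro exI[of _ c]) auto
qed

text \<open>A walk with value \<open>\<one>\<close> lifts the geodesic of length 0.\<close>

theorem linked_trivial_walk:
  assumes "2 * thin + 3 \<le> R" "\<And>u g v. E u g v \<Longrightarrow> len g \<le> R"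
    and "walk E u n \<one> v" "n \<le> 2 ^ k" "k < l"
  shows "linked E R l (u, []) \<one> (v, [])"
proof -
  have geo: "geodesic (\<lambda>_. \<one>) 0 \<one> (\<one> \<otimes> \<one>)"
    by (simp add: geodesic_def dst_self)
  obtain a where "joined E R l (u, []) \<one> (a 0) \<one>" "joined E R l (a 0) \<one> (v, []) \<one>"
    using lift_geodesic[of R E u n "\<one>" v k l "\<lambda>_. \<one>" 0 "\<one>"] assms geo by auto
  then have "joined E R l (u, []) \<one> (v, []) \<one>"
    by (rule joined_trans) (simp add: dst_self)
  then show ?thesis by (simp add: joined_def)
qed

end

section \<open>Reading instances\<close>

lemma encode_nats_simps [simp]:
  "encode_nats [] = []" "encode_nats (n # ns) = replicate n True @ False # encode_nats ns"
  by (simp_all add: encode_nats_def)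

lemma encode_nats_append [simp]: "encode_nats (ms @ ns) = encode_nats ms @ encode_nats ns"
  by (simp add: encode_nats_def)

text \<open>The numbers \<open>ns\<close> stand on the input tape from position \<open>p\<close> on, up to before \<open>q\<close>.\<close>

definition reads :: "bool list \<Rightarrow> nat \<Rightarrow> nat list \<Rightarrow> nat \<Rightarrow> bool" where
  "reads x p ns q \<longleftrightarrow> 1 \<le> p \<and> q = p + length (encode_nats ns) \<and>
     drop (p - 1) x = encode_nats ns @ drop (q - 1) x"

lemma reads_append: "reads x p ms q \<Longrightarrow> reads x q ns r \<Longrightarrow> reads x p (ms @ ns) r"
  by (auto simp: reads_def)

lemma reads_appendD:
  assumes "reads x p (ms @ ns) r"
  shows "reads x p ms (p + length (encode_nats ms))" "reads x (p + length (encode_nats ms)) ns r"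
proof -
  have p: "1 \<le> p" and r: "r = p + length (encode_nats ms) + length (encode_nats ns)"
    and eq: "drop (p - 1) x = encode_nats ms @ encode_nats ns @ drop (r - 1) x"
    using assms by (auto simp: reads_def)
  have "drop (p + length (encode_nats ms) - 1) x = drop (length (encode_nats ms)) (drop (p - 1) x)"
    using p by (simp add: add.commute)
  then have "drop (p + length (encode_nats ms) - 1) x = encode_nats ns @ drop (r - 1) x"
    unfolding eq by simp
  then show "reads x p ms (p + length (encode_nats ms))"
    "reads x (p + length (encode_nats ms)) ns r"
    using p r eq by (auto simp: reads_def)
qed

lemma encode_nats_prefix_unique:
  assumes "length ms = length ns" "encode_nats ms @ r = encode_nats ns @ r'"
  shows "ms = ns"
  using assms
proof (induction ms ns rule: list_induct2)
  case (Cons m ms n ns)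
  have *: "m = n \<and> zs = zs'" if "replicate m True @ False # zs = replicate n True @ False # zs'"
    for zs zs'
    using that
  proof (induction m arbitrary: n)
    case 0
    then show ?case by (cases n) auto
  next
    case (Suc m)
    then show ?case by (cases n) auto
  qed
  have "replicate m True @ False # encode_nats ms @ r = replicate n True @ False # encode_nats ns @ r'"
    using Cons.prems by simp
  from *[OF this] show ?case using Cons.IH by simp
qed simp

lemma reads_unique:
  assumes "reads x p ms q" "reads x p ns r" "length ms = length ns"
  shows "ms = ns" "q = r"
proof -
  have "encode_nats ms @ drop (q - 1) x = drop (p - 1) x" "drop (p - 1) x = encode_nats ns @ drop (r - 1) x"
    using assms(1,2) unfolding reads_def by argo+
  from encode_nats_prefix_unique[OF assms(3) trans[OF this]] show "ms = ns" .
  then show "q = r" using assms(1,2) unfolding reads_def by argo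
qed

lemma input_symbol_cases:
  "input_symbol x p = 2 \<longleftrightarrow> 1 \<le> p \<and> p \<le> length x \<and> \<not> x ! (p - 1)"
  "input_symbol x p = 3 \<longleftrightarrow> 1 \<le> p \<and> p \<le> length x \<and> x ! (p - 1)"
  "input_symbol x p = 1 \<longleftrightarrow> p = 0"
  "input_symbol x p = 0 \<longleftrightarrow> length x < p"
  by (auto simp: input_symbol_def input_tape_def)

lemma drop_pred: "1 \<le> p \<Longrightarrow> p \<le> length x \<Longrightarrow> drop (p - 1) x = x ! (p - 1) # drop p x"
  using Cons_nth_drop_Suc[of "p - 1" x] by simp

lemma reads_number:
  "reads x p [k] q \<longleftrightarrow>
     q = p + k + 1 \<and> (\<forall>i. p \<le> i \<and> i < p + k \<longrightarrow> input_symbol x i = 3) \<and> input_symbol x (p + k) = 2"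
proof (induction k arbitrary: p)
  case 0
  show ?case
  proof (cases "1 \<le> p \<and> p \<le> length x")
    case True
    have "reads x p [0] q \<longleftrightarrow> q = p + 0 + 1 \<and> drop (p - 1) x = False # drop p x"
      using True by (auto simp: reads_def)
    also have "\<dots> \<longleftrightarrow> q = p + 0 + 1 \<and> \<not> x ! (p - 1)"
      unfolding drop_pred[OF conjunct1[OF True] conjunct2[OF True]] by blast
    finally show ?thesis using True by (simp add: input_symbol_cases(1))
  next
    case False
    then show ?thesis by (auto simp: reads_def input_symbol_cases(1))
  qed
next
  case (Suc k)
  have "p \<le> i \<and> i < p + Suc k \<longleftrightarrow> i = p \<or> Suc p \<le> i \<and> i < Suc p + k" for i by auto
  then have all: "(\<forall>i. p \<le> i \<and> i < p + Suc k \<longrightarrow> P i) \<longleftrightarrow>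
      P p \<and> (\<forall>i. Suc p \<le> i \<and> i < Suc p + k \<longrightarrow> P i)" for P by auto
  have "reads x p [Suc k] q \<longleftrightarrow> input_symbol x p = 3 \<and> reads x (Suc p) [k] q"
  proof (cases "1 \<le> p \<and> p \<le> length x")
    case True
    have "reads x p [Suc k] q \<longleftrightarrow> q = Suc p + k + 1 \<and>
        drop (p - 1) x = True # replicate k True @ False # drop (q - 1) x"
      using True by (auto simp: reads_def)
    also have "\<dots> \<longleftrightarrow> q = Suc p + k + 1 \<and> x ! (p - 1) \<and>
        drop p x = replicate k True @ False # drop (q - 1) x"
      unfolding drop_pred[OF conjunct1[OF True] conjunct2[OF True]] by blast
    also have "\<dots> \<longleftrightarrow> input_symbol x p = 3 \<and> reads x (Suc p) [k] q"
      using True unfolding input_symbol_cases(2) by (auto simp: reads_def)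
    finally show ?thesis .
  next
    case False
    then show ?thesis by (auto simp: reads_def input_symbol_cases(2))
  qed
  then show ?case using Suc[of "Suc p"] all[of "\<lambda>i. input_symbol x i = 3"] by auto
qed


section \<open>A Horn program for the acyclic graph word problem\<close>

text \<open>
  \<open>Number p k q\<close>, \<open>Header n s t p\<close> and \<open>Edge j p u v q\<close> hold if the input has a number \<open>k\<close>, a header
  and an edge with label code \<open>j\<close> at the positions given. \<open>Parsed n s t p\<close> holds if all up to \<open>p\<close> is a
  header with well-formed edges. \<open>Scanned v p\<close> holds if the edges from \<open>v\<close> that are listed
  before \<open>p\<close> lead to grounded vertices, and a vertex is \<open>Grounded\<close> if all its edges do so: this is
  how acyclicity is expressed without negation. \<open>Times j a b\<close> stands for \<open>b = \<beta> * a + j\<close>, and \<open>Link d u s v t\<close> for a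
  passage whose value is the group element number \<open>d\<close>.
\<close>

datatype rel =
  Count | Number | Less | Constant nat | Header | Edge nat | Parsed | Scanned | Grounded | Below |
  Times nat | Link nat | Accept

instance rel :: countable
  by countable_datatype

text \<open>
  In the tests of input symbols, 2 and 3 are the two bits, 1 forces a variable to be 0, and 0 places
  it beyond the end of the input.
\<close>

definition parse_rules :: "rel hrule list" where
  "parse_rules =
    [((Count, [Var 0, Var 1, Var 0]), [(1, 1)], []),
     ((Count, [Var 0, Succ 1, Succ 2]), [(3, 2)], [(Count, [Var 0, Var 1, Var 2])]),
     ((Number, [Var 0, Var 1, Succ 2]), [(2, 2)], [(Count, [Var 0, Var 1, Var 2])]),
     ((Less, [Var 0, Succ 0]), [], []),
     ((Less, [Var 0, Succ 1]), [], [(Less, [Var 0, Var 1])]),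
     ((Constant 0, [Var 0]), [(1, 0)], []),
     ((Header, [Var 0, Var 1, Var 2, Var 3]), [(1, 4)],
       [(Number, [Succ 4, Var 0, Var 5]), (Number, [Var 5, Var 1, Var 6]),
        (Number, [Var 6, Var 2, Var 3]), (Less, [Var 1, Var 0]), (Less, [Var 2, Var 0])]),
     ((Parsed, [Var 0, Var 1, Var 2, Var 3]), [], [(Header, [Var 0, Var 1, Var 2, Var 3])])]"

definition constant_rules :: "nat \<Rightarrow> rel hrule list" where
  "constant_rules c = map (\<lambda>j. ((Constant (Suc j), [Succ 0]), [], [(Constant j, [Var 0])])) [0..<c]"

definition edge_rules :: "nat \<Rightarrow> rel hrule list" where
  "edge_rules j =
    [((Edge j, [Var 0, Var 1, Var 2, Var 3]), [],
       [(Number, [Var 0, Var 1, Var 4]), (Number, [Var 4, Var 5, Var 6]),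
        (Number, [Var 6, Var 2, Var 3]), (Constant j, [Var 5])]),
     ((Parsed, [Var 0, Var 1, Var 2, Var 6]), [],
       [(Parsed, [Var 0, Var 1, Var 2, Var 3]), (Edge j, [Var 3, Var 4, Var 5, Var 6]),
        (Less, [Var 4, Var 0]), (Less, [Var 5, Var 0])])]"

definition grounded_rules :: "rel hrule list" where
  "grounded_rules =
    [((Scanned, [Var 4, Var 3]), [], [(Header, [Var 0, Var 1, Var 2, Var 3])]),
     ((Grounded, [Var 0]), [(0, 4)],
       [(Scanned, [Var 0, Var 4]), (Parsed, [Var 1, Var 2, Var 3, Var 4])]),
     ((Below, [Var 0]), [(1, 0)], []),
     ((Below, [Succ 0]), [], [(Below, [Var 0]), (Grounded, [Var 0])])]"

definition scan_rules :: "nat \<Rightarrow> rel hrule list" where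
  "scan_rules j =
    [((Scanned, [Var 0, Var 4]), [],
       [(Scanned, [Var 0, Var 1]), (Edge j, [Var 1, Var 2, Var 3, Var 4]), (Less, [Var 0, Var 2])]),
     ((Scanned, [Var 0, Var 4]), [],
       [(Scanned, [Var 0, Var 1]), (Edge j, [Var 1, Var 2, Var 3, Var 4]), (Less, [Var 2, Var 0])]),
     ((Scanned, [Var 0, Var 4]), [],
       [(Scanned, [Var 0, Var 1]), (Edge j, [Var 1, Var 0, Var 3, Var 4]), (Grounded, [Var 3])])]"

definition times_rules :: "nat \<Rightarrow> rel hrule list" where
  "times_rules \<beta> =
    ((Times 0, [Var 0, Var 0]), [(1, 0)], []) #
    ((Times 0, [Succ 0, Var 1]), [], [(Times \<beta>, [Var 0, Var 1])]) #
    map (\<lambda>j. ((Times (Suc j), [Var 0, Succ 1]), [], [(Times j, [Var 0, Var 1])])) [0..<\<beta>]"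

text \<open>
  The finite tables of the rules for \<open>Link\<close>: \<open>ones\<close> lists the numbers of the identity, \<open>invs\<close> the
  pairs of inverse elements, \<open>labs\<close> the label codes with their elements, \<open>mults\<close> the products.
\<close>

definition link_rules :: "nat \<Rightarrow> nat list \<Rightarrow> (nat \<times> nat) list \<Rightarrow> (nat \<times> nat) list \<Rightarrow>
    (nat \<times> nat \<times> nat) list \<Rightarrow> rel hrule list" where
  "link_rules \<beta> ones invs labs mults =
     map (\<lambda>d. ((Link d, [Var 0, Var 1, Var 0, Var 1]), [], [])) ones @
     map (\<lambda>d. ((Link d, [Var 0, Var 1, Var 0, Var 2]), [], [(Times (Suc d), [Var 1, Var 2])])) [0..<\<beta>] @
     map (\<lambda>(b, d). ((Link d, [Var 0, Var 2, Var 0, Var 1]), [], [(Times (Suc b), [Var 1, Var 2])])) invs @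
     map (\<lambda>(j, d). ((Link d, [Var 1, Var 4, Var 2, Var 4]), [(1, 4)],
       [(Parsed, [Var 5, Var 6, Var 7, Var 0]), (Edge j, [Var 0, Var 1, Var 2, Var 3])])) labs @
     map (\<lambda>(d, g, f). ((Link f, [Var 0, Var 1, Var 4, Var 5]), [],
       [(Link d, [Var 0, Var 1, Var 2, Var 3]), (Link g, [Var 2, Var 3, Var 4, Var 5])])) mults"

definition accept_rules :: "nat list \<Rightarrow> rel hrule list" where
  "accept_rules ones = map (\<lambda>d. ((Accept, []), [(0, 3), (1, 4)],
     [(Parsed, [Var 0, Var 1, Var 2, Var 3]), (Below, [Var 0]),
      (Link d, [Var 1, Var 4, Var 2, Var 4])])) ones"

definition program :: "nat \<Rightarrow> nat \<Rightarrow> nat list \<Rightarrow> (nat \<times> nat) list \<Rightarrow> (nat \<times> nat) list \<Rightarrow>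
    (nat \<times> nat \<times> nat) list \<Rightarrow> rel hrule list" where
  "program c \<beta> ones invs labs mults =
     parse_rules @ constant_rules c @ concat (map edge_rules [0..<Suc c]) @
     grounded_rules @ concat (map scan_rules [0..<Suc c]) @ times_rules \<beta> @
     link_rules \<beta> ones invs labs mults @ accept_rules ones"

lemma ball_program:
  "(\<forall>rl \<in> set (program c \<beta> ones invs labs mults). Q rl) \<longleftrightarrow>
     (\<forall>rl \<in> set parse_rules. Q rl) \<and> (\<forall>rl \<in> set (constant_rules c). Q rl) \<and>
     (\<forall>j \<le> c. \<forall>rl \<in> set (edge_rules j). Q rl) \<and> (\<forall>rl \<in> set grounded_rules. Q rl) \<and>
     (\<forall>j \<le> c. \<forall>rl \<in> set (scan_rules j). Q rl) \<and> (\<forall>rl \<in> set (times_rules \<beta>). Q rl) \<and>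
     (\<forall>rl \<in> set (link_rules \<beta> ones invs labs mults). Q rl) \<and>
     (\<forall>rl \<in> set (accept_rules ones). Q rl)"
proof -
  have "(\<forall>rl \<in> set (concat (map f [0..<Suc c])). Q rl) \<longleftrightarrow> (\<forall>j \<le> c. \<forall>rl \<in> set (f j). Q rl)" for f
  proof -
    have "set (concat (map f [0..<Suc c])) = (\<Union>j \<in> {..c}. set (f j))"
      by (simp add: atLeast0LessThan lessThan_Suc_atMost del: upt_Suc)
    then show ?thesis by (simp only:) blast
  qed
  then show ?thesis unfolding program_def set_append ball_Un by simp
qed

fun arity :: "rel \<Rightarrow> nat" where
  "arity Count = 3"
| "arity Number = 3"
| "arity Less = 2"
| "arity (Constant j) = 1"
| "arity Header = 4"
| "arity (Edge j) = 4"
| "arity Parsed = 4"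
| "arity Scanned = 2"
| "arity Grounded = 1"
| "arity Below = 1"
| "arity (Times j) = 2"
| "arity (Link d) = 4"
| "arity Accept = 0"

definition rule_wf :: "rel hrule \<Rightarrow> bool" where
  "rule_wf rl \<longleftrightarrow> (\<forall>b \<in> insert (fst rl) (set (snd (snd rl))).
     length (snd b) = arity (fst b) \<and> arity (fst b) \<le> 4 \<and> (\<forall>t \<in> set (snd b). tvar t < 8)) \<and>
     (\<forall>b \<in> set (fst (snd rl)). snd b < 8)"

lemma program_wf: "\<forall>rl \<in> set (program c \<beta> ones invs labs mults). rule_wf rl"
proof -
  have "\<forall>rl \<in> set parse_rules. rule_wf rl" "\<forall>rl \<in> set (constant_rules c). rule_wf rl"
    "\<forall>rl \<in> set (edge_rules j). rule_wf rl" "\<forall>rl \<in> set grounded_rules. rule_wf rl"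
    "\<forall>rl \<in> set (scan_rules j). rule_wf rl" "\<forall>rl \<in> set (times_rules \<beta>). rule_wf rl"
    "\<forall>rl \<in> set (link_rules \<beta> ones invs labs mults). rule_wf rl"
    "\<forall>rl \<in> set (accept_rules ones). rule_wf rl" for j
    by (auto simp: rule_wf_def parse_rules_def constant_rules_def edge_rules_def grounded_rules_def
        scan_rules_def times_rules_def link_rules_def accept_rules_def)
  then show ?thesis unfolding ball_program by blast
qed

lemma horn_machine_program:
  assumes "0 < e"
  shows "horn_machine (program c \<beta> ones invs labs mults) Accept arity e 8 4"
proof
  fix r ts ins body assume "((r, ts), ins, body) \<in> set (program c \<beta> ones invs labs mults)"
  then show "length ts = arity r \<and> arity r \<le> 4 \<and> (\<forall>t \<in> set ts. tvar t < 8)"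
    using program_wf unfolding rule_wf_def by (metis fst_conv insertI1 snd_conv)
next
  fix hd ins body and r :: rel and ts
  assume "(hd, ins, body) \<in> set (program c \<beta> ones invs labs mults)" "(r, ts) \<in> set body"
  then show "length ts = arity r \<and> arity r \<le> 4 \<and> (\<forall>t \<in> set ts. tvar t < 8)"
    using program_wf unfolding rule_wf_def by (metis fst_conv insertI2 snd_conv)
next
  fix hd ins body s v
  assume "(hd, ins, body) \<in> set (program c \<beta> ones invs labs mults)" "(s, v) \<in> set ins"
  then show "v < 8"
    using program_wf unfolding rule_wf_def by (metis fst_conv snd_conv)
qed (use assms in auto)


section \<open>Soundness: accepted inputs encode instances\<close>

text \<open>
  A predicate on facts that all rules preserve holds of what is derived. The second predicate is
  one that is already known to hold.
\<close>

definition preserves :: "(nat \<Rightarrow> nat) \<Rightarrow> ('r \<Rightarrow> nat list \<Rightarrow> bool) \<Rightarrow> ('r \<Rightarrow> nat list \<Rightarrow> bool) \<Rightarrow>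
    'r hrule \<Rightarrow> bool" where
  "preserves inp known sem rl \<longleftrightarrow> (\<forall>\<sigma>.
     (\<forall>b \<in> set (fst (snd rl)). inp (\<sigma> (snd b)) = fst b) \<longrightarrow>
     (\<forall>b \<in> set (snd (snd rl)). known (fst b) (map (tval \<sigma>) (snd b)) \<and> sem (fst b) (map (tval \<sigma>) (snd b))) \<longrightarrow>
     sem (fst (fst rl)) (map (tval \<sigma>) (snd (fst rl))))"

lemma derives_sound:
  assumes "derives P N inp r ys" "\<forall>rl \<in> set P. preserves inp known sem rl"
    and "\<And>r ys. derives P N inp r ys \<Longrightarrow> known r ys"
  shows "sem r ys"
  using assms(1)
proof induction
  case (rule r ts ins body \<sigma>)
  have "preserves inp known sem ((r, ts), ins, body)" using rule(1) assms(2) by blast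
  then show ?case using rule(3,4) assms(3) unfolding preserves_def by fastforce
qed

definition edges_ok :: "nat \<Rightarrow> nat \<Rightarrow> (nat \<times> letter option \<times> nat) list \<Rightarrow> bool" where
  "edges_ok c n es \<longleftrightarrow> (\<forall>(u, l, v) \<in> set es. u < n \<and> v < n \<and> label_code l \<le> c)"

definition well_formed :: "nat \<Rightarrow> instance_graph \<Rightarrow> bool" where
  "well_formed c \<Gamma> \<longleftrightarrow> source \<Gamma> < nverts \<Gamma> \<and> target \<Gamma> < nverts \<Gamma> \<and> edges_ok c (nverts \<Gamma>) (edges \<Gamma>)"

lemma ex_label: "\<exists>l. label_code l = j"
proof (cases "j = 0")
  case True
  then show ?thesis by (intro exI[of _ None]) simp
next
  case False
  then consider i where "j = 2 * i + 1" | i where "j = 2 * i + 2"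
    by (cases "even j") (auto elim!: evenE oddE, metis Suc_pred mult_Suc_right add_2_eq_Suc)
  then show ?thesis
  proof cases
    case (1 i)
    then show ?thesis by (intro exI[of _ "Some (Pos i)"]) simp
  next
    case (2 i)
    then show ?thesis by (intro exI[of _ "Some (Neg i)"]) simp
  qed
qed

text \<open>
  What the facts say about an arbitrary input. The facts on vertices, words and links are interpreted
  later, when the input is known to encode an instance.
\<close>

definition meaning :: "bool list \<Rightarrow> nat \<Rightarrow> rel \<Rightarrow> nat list \<Rightarrow> bool" where
  "meaning x c r ys = (case r of
     Count \<Rightarrow> ys ! 2 = ys ! 0 + ys ! 1 \<and> (\<forall>i. ys ! 0 \<le> i \<and> i < ys ! 2 \<longrightarrow> input_symbol x i = 3)
   | Number \<Rightarrow> reads x (ys ! 0) [ys ! 1] (ys ! 2)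
   | Less \<Rightarrow> ys ! 0 < ys ! 1
   | Constant j \<Rightarrow> ys ! 0 = j
   | Header \<Rightarrow> reads x 1 [ys ! 0, ys ! 1, ys ! 2] (ys ! 3) \<and> ys ! 1 < ys ! 0 \<and> ys ! 2 < ys ! 0
   | Edge j \<Rightarrow> reads x (ys ! 0) [ys ! 1, j, ys ! 2] (ys ! 3)
   | Parsed \<Rightarrow> (\<exists>\<Gamma>. well_formed c \<Gamma> \<and> nverts \<Gamma> = ys ! 0 \<and> source \<Gamma> = ys ! 1 \<and> target \<Gamma> = ys ! 2 \<and>
       reads x 1 (instance_nats \<Gamma>) (ys ! 3))
   | Accept \<Rightarrow> (\<exists>\<Gamma>. well_formed c \<Gamma> \<and> x = encode_instance \<Gamma>)
   | _ \<Rightarrow> True)"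

lemma parse_rules_preserve: "\<forall>rl \<in> set parse_rules. preserves (input_symbol x) known (meaning x c) rl"
proof -
  have header: "reads x 1 [n, s, t] p"
    if "reads x 1 [n] q" "reads x q [s] r" "reads x r [t] p" for n s t p q r
    using reads_append[OF that(1) reads_append[OF that(2,3)]] by simp
  have parsed: "\<exists>\<Gamma>. well_formed c \<Gamma> \<and> nverts \<Gamma> = n \<and> source \<Gamma> = s \<and> target \<Gamma> = t \<and>
      reads x 1 (instance_nats \<Gamma>) p" if "reads x 1 [n, s, t] p" "s < n" "t < n" for n s t p
    using that
    by (intro exI[of _ "\<lparr>nverts = n, edges = [], source = s, target = t\<rparr>"])
      (simp add: well_formed_def edges_ok_def instance_nats_def)
  show ?thesis
    unfolding parse_rules_def preserves_def meaning_def
    by (auto simp: input_symbol_cases(3)[unfolded One_nat_def] reads_number[of x _ _ "Suc _"]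
        less_Suc_eq intro: parsed[unfolded One_nat_def] header[unfolded One_nat_def])
qed

lemma constant_rules_preserve: "\<forall>rl \<in> set (constant_rules j). preserves (input_symbol x) known (meaning x c) rl"
  unfolding constant_rules_def preserves_def meaning_def by auto

lemma edge_rules_preserve:
  assumes "j \<le> c"
  shows "\<forall>rl \<in> set (edge_rules j). preserves (input_symbol x) known (meaning x c) rl"
proof -
  have edge: "reads x p [u, l, v] q" if "reads x p [u] a" "reads x a [l] b" "reads x b [v] q" for p u l v q a b
    using reads_append[OF that(1) reads_append[OF that(2,3)]] by simp
  have parsed: "\<exists>\<Delta>. well_formed c \<Delta> \<and> nverts \<Delta> = nverts \<Gamma> \<and> source \<Delta> = source \<Gamma> \<and>
      target \<Delta> = target \<Gamma> \<and> reads x 1 (instance_nats \<Delta>) q"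
    if "well_formed c \<Gamma>" "reads x 1 (instance_nats \<Gamma>) p" "reads x p [u, j, v] q" "u < nverts \<Gamma>"
      "v < nverts \<Gamma>" for \<Gamma> p u v q
  proof -
    obtain l where l: "label_code l = j" using ex_label by blast
    let ?\<Delta> = "\<Gamma>\<lparr>edges := edges \<Gamma> @ [(u, l, v)]\<rparr>"
    have "instance_nats ?\<Delta> = instance_nats \<Gamma> @ [u, j, v]" by (simp add: instance_nats_def l)
    then have "reads x 1 (instance_nats ?\<Delta>) q" using reads_append[OF that(2,3)] by simp
    then show ?thesis using that(1,4,5) l assms
      by (intro exI[of _ ?\<Delta>]) (auto simp: well_formed_def edges_ok_def)
  qed
  have "preserves (input_symbol x) known (meaning x c) (edge_rules j ! 0)"
    unfolding edge_rules_def preserves_def meaning_def using edge by auto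
  moreover have "preserves (input_symbol x) known (meaning x c) (edge_rules j ! 1)"
    unfolding edge_rules_def preserves_def meaning_def using parsed by fastforce
  ultimately show ?thesis by (simp add: edge_rules_def)
qed

lemma trivial_rules_preserve:
  "\<forall>rl \<in> set grounded_rules. preserves (input_symbol x) known (meaning x c) rl"
  "\<forall>rl \<in> set (scan_rules j). preserves (input_symbol x) known (meaning x c) rl"
  "\<forall>rl \<in> set (times_rules \<beta>). preserves (input_symbol x) known (meaning x c) rl"
  "\<forall>rl \<in> set (link_rules \<beta> ones invs labs mults). preserves (input_symbol x) known (meaning x c) rl"
  unfolding grounded_rules_def scan_rules_def times_rules_def link_rules_def preserves_def meaning_def
  by auto

lemma accept_rules_preserve:
  "\<forall>rl \<in> set (accept_rules ones). preserves (input_symbol x) known (meaning x c) rl"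
proof -
  have "x = encode_instance \<Gamma>" if "reads x 1 (instance_nats \<Gamma>) p" "length x < p" for \<Gamma> p
    using that by (simp add: reads_def encode_instance_def)
  then show ?thesis
    unfolding accept_rules_def preserves_def meaning_def
    by (auto simp: input_symbol_cases(4))
qed

lemma derives_meaning:
  assumes "derives (program c \<beta> ones invs labs mults) N (input_symbol x) r ys"
  shows "meaning x c r ys"
proof (rule derives_sound[OF assms, where known = "\<lambda>_ _. True"])
  show "\<forall>rl \<in> set (program c \<beta> ones invs labs mults).
      preserves (input_symbol x) (\<lambda>_ _. True) (meaning x c) rl"
    unfolding ball_program
    by (intro conjI allI impI parse_rules_preserve constant_rules_preserve edge_rules_preserve
        trivial_rules_preserve accept_rules_preserve)
qed simp

section \<open>Soundness: accepted instances are acyclic and have a trivial path\<close>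

locale acyclic_graph_word_problem = hyperbolic_word_metric +
  fixes xs :: "'a list"
  assumes xs_carrier: "set xs \<subseteq> carrier G"
begin

text \<open>
  The radius is large enough for the lifting of geodesics, and the ball contains the values of all
  labels. The largest label code is \<open>c\<close>.
\<close>

definition R :: nat where "R = 2 * thin + 3 + (\<Sum>g \<in> set xs. len g)"

definition ball :: "'a list" where
  "ball = (SOME bs. distinct bs \<and> set bs = {g \<in> carrier G. len g \<le> R})"

definition \<beta> :: nat where "\<beta> = length ball"

definition label_val :: "letter option \<Rightarrow> 'a" where
  "label_val l = word_val G xs (label_word l)"

definition c :: nat where "c = 2 * length xs"

definition ones :: "nat list" where
  "ones = filter (\<lambda>d. ball ! d = \<one>) [0..<\<beta>]"

definition invs :: "(nat \<times> nat) list" where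
  "invs = filter (\<lambda>(b, d). ball ! d = inv (ball ! b)) (List.product [0..<\<beta>] [0..<\<beta>])"

definition labs :: "(nat \<times> nat) list" where
  "labs = filter (\<lambda>(j, d). ball ! d = label_val (the_inv label_code j))
     (List.product [0..<Suc c] [0..<\<beta>])"

definition mults :: "(nat \<times> nat \<times> nat) list" where
  "mults = filter (\<lambda>(d, g, f). ball ! f = ball ! d \<otimes> ball ! g)
     (List.product [0..<\<beta>] (List.product [0..<\<beta>] [0..<\<beta>]))"

definition rules :: "rel hrule list" where "rules = program c \<beta> ones invs labs mults"

lemma ball: "distinct ball" "set ball = {g \<in> carrier G. len g \<le> R}"
proof -
  have "\<exists>bs. distinct bs \<and> set bs = {g \<in> carrier G. len g \<le> R}"
    using finite_distinct_list[OF finite_ball[of R]] by blast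
  from someI_ex[OF this] show "distinct ball" "set ball = {g \<in> carrier G. len g \<le> R}"
    unfolding ball_def by auto
qed

lemma ball_nth: "d < \<beta> \<Longrightarrow> ball ! d \<in> carrier G"
  using ball nth_mem[of d ball] by (auto simp: \<beta>_def)

lemma \<beta>_pos: "0 < \<beta>"
proof -
  have "\<one> \<in> set ball" using ball(2) by simp
  then show ?thesis by (auto simp: \<beta>_def)
qed

text \<open>The words over the ball are numbered in such a way that \<open>\<beta> * i + b + 1\<close> extends \<open>i\<close> by \<open>b\<close>.\<close>

function place :: "nat \<Rightarrow> 'a" where
  "place 0 = \<one>"
| "place (Suc i) = place (i div \<beta>) \<otimes> ball ! (i mod \<beta>)"
  by pat_completeness auto
termination by (relation "measure id") (auto simp: le_imp_less_Suc)

lemma place_carrier: "place i \<in> carrier G"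
  by (induction i rule: place.induct) (use \<beta>_pos in \<open>auto intro!: m_closed ball_nth mod_less_divisor\<close>)

lemma place_extend: "b < \<beta> \<Longrightarrow> place (Suc (\<beta> * i + b)) = place i \<otimes> ball ! b"
  by simp

text \<open>The labelled graph on which walks are considered.\<close>

definition edge :: "instance_graph \<Rightarrow> nat \<Rightarrow> 'a \<Rightarrow> nat \<Rightarrow> bool" where
  "edge \<Gamma> u g v \<longleftrightarrow> (\<exists>l. (u, l, v) \<in> set (edges \<Gamma>) \<and> g = label_val l)"

lemma label_val_cases:
  assumes "label_code l \<le> c"
  shows "label_val l \<in> carrier G \<and> len (label_val l) \<le> R"
proof (cases l rule: label_code.cases)
  case 1
  then show ?thesis by (simp add: label_val_def word_val_def)
next
  case (2 i)
  then have i: "xs ! i \<in> set xs" using assms by (auto simp: c_def)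
  then have "len (xs ! i) \<le> (\<Sum>g \<in> set xs. len g)" by (intro member_le_sum) auto
  moreover have "xs ! i \<in> carrier G" using i xs_carrier by auto
  ultimately show ?thesis using 2 by (simp add: label_val_def word_val_def R_def)
next
  case (3 i)
  then have i: "xs ! i \<in> set xs" using assms by (auto simp: c_def)
  then have "len (xs ! i) \<le> (\<Sum>g \<in> set xs. len g)" by (intro member_le_sum) auto
  moreover have "xs ! i \<in> carrier G" using i xs_carrier by auto
  ultimately show ?thesis using 3 by (simp add: label_val_def word_val_def R_def len_inv)
qed

lemma walk_append: "walk E u m g v \<Longrightarrow> walk E v n h w \<Longrightarrow> walk E u (m + n) (g \<otimes> h) w"
proof (induction rule: walk.induct)
  case (walk_Nil u)
  then show ?case using walk_carrier by simp
next
  case (walk_Cons u g v m g' w')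
  then have "walk E u (Suc (m + n)) (g \<otimes> (g' \<otimes> h)) w" by (intro walk.walk_Cons)
  moreover have "g' \<in> carrier G" "h \<in> carrier G" using walk_Cons walk_carrier by auto
  ultimately show ?case using walk_Cons by (simp add: m_assoc)
qed

end

definition edge_rel :: "instance_graph \<Rightarrow> (nat \<times> nat) set" where
  "edge_rel \<Gamma> = {(u, v). \<exists>l. (u, l, v) \<in> set (edges \<Gamma>)}"

locale agwp_instance = acyclic_graph_word_problem +
  fixes \<Gamma> :: instance_graph
  assumes well_formed: "well_formed c \<Gamma>"
begin

abbreviation x :: "bool list" where "x \<equiv> encode_instance \<Gamma>"

text \<open>The position on the input tape where edge number \<open>j\<close> starts.\<close>

definition pos :: "nat \<Rightarrow> nat" where
  "pos j = 1 + length (encode_nats (instance_nats (\<Gamma>\<lparr>edges := take j (edges \<Gamma>)\<rparr>)))"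

lemma reads_all: "reads x 1 (instance_nats \<Gamma>) (Suc (length x))"
  by (simp add: reads_def encode_instance_def)

lemma pos_end: "pos (length (edges \<Gamma>)) = Suc (length x)"
  by (simp add: pos_def encode_instance_def)

lemma reads_pos: "reads x 1 (instance_nats (\<Gamma>\<lparr>edges := take j (edges \<Gamma>)\<rparr>)) (pos j)"
proof -
  have "instance_nats \<Gamma> = instance_nats (\<Gamma>\<lparr>edges := take j (edges \<Gamma>)\<rparr>) @
      concat (map (\<lambda>(u, l, v). [u, label_code l, v]) (drop j (edges \<Gamma>)))"
    by (simp add: instance_nats_def flip: concat_append map_append)
  from reads_appendD(1)[OF reads_all[unfolded this]] show ?thesis by (simp add: pos_def)
qed

lemma reads_edge:
  assumes "j < length (edges \<Gamma>)" "edges \<Gamma> ! j = (u, l, v)"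
  shows "reads x (pos j) [u, label_code l, v] (pos (Suc j))"
proof -
  have "instance_nats (\<Gamma>\<lparr>edges := take (Suc j) (edges \<Gamma>)\<rparr>) =
      instance_nats (\<Gamma>\<lparr>edges := take j (edges \<Gamma>)\<rparr>) @ [u, label_code l, v]"
    using assms by (simp add: instance_nats_def take_Suc_conv_app_nth)
  from reads_appendD(2)[OF reads_pos[of "Suc j", unfolded this]] show ?thesis
    by (simp add: pos_def)
qed

lemma reads_le: "reads x p ns q \<Longrightarrow> ns \<noteq> [] \<Longrightarrow> q \<le> Suc (length x)"
proof -
  assume r: "reads x p ns q" and "ns \<noteq> []"
  then have "0 < length (encode_nats ns)" by (cases ns) auto
  moreover have "drop (p - 1) x = encode_nats ns @ drop (q - 1) x"
    and q: "q = p + length (encode_nats ns)" "1 \<le> p" using r unfolding reads_def by blast+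
  then have "length (drop (p - 1) x) = length (encode_nats ns @ drop (q - 1) x)"
    by (intro arg_cong[where f = length])
  ultimately show ?thesis using q unfolding length_append length_drop by linarith
qed

lemma pos_less: "j < length (edges \<Gamma>) \<Longrightarrow> pos j < pos (Suc j)"
  using reads_edge[of j] by (cases "edges \<Gamma> ! j") (auto simp: reads_def)

lemma pos_le: "j \<le> length (edges \<Gamma>) \<Longrightarrow> pos j \<le> Suc (length x)"
  using reads_le[OF reads_pos[of j]] by (simp add: instance_nats_def)

text \<open>As numbers have a prefix code, no other edge is read at this position.\<close>

lemma edge_at_pos:
  assumes "reads x (pos j) [u, a, v] q" "j \<le> length (edges \<Gamma>)"
  shows "j < length (edges \<Gamma>)" "q = pos (Suc j)" "\<exists>l. edges \<Gamma> ! j = (u, l, v) \<and> label_code l = a"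
proof -
  show j: "j < length (edges \<Gamma>)"
  proof (rule ccontr)
    assume "\<not> ?thesis"
    then have "pos j = Suc (length x)" using assms(2) pos_end by simp
    moreover have "pos j < q" using assms(1) by (auto simp: reads_def)
    ultimately show False using reads_le[OF assms(1)] by simp
  qed
  obtain u' l v' where e: "edges \<Gamma> ! j = (u', l, v')" by (metis prod.collapse)
  have "[u, a, v] = [u', label_code l, v']" "q = pos (Suc j)"
    using reads_unique[OF assms(1) reads_edge[OF j e]] by simp_all
  then show "q = pos (Suc j)" "\<exists>l. edges \<Gamma> ! j = (u, l, v) \<and> label_code l = a" using e by auto
qed

definition grounded :: "nat set" where
  "grounded = Wellfounded.acc ((edge_rel \<Gamma>)\<inverse>)"

text \<open>
  For an encoded instance, \<open>Link\<close> facts record the values of walks, shifted by the words at both ends.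
\<close>

definition instance_meaning :: "rel \<Rightarrow> nat list \<Rightarrow> bool" where
  "instance_meaning r ys = (case r of
     Parsed \<Rightarrow> nverts \<Gamma> = ys ! 0 \<and> source \<Gamma> = ys ! 1 \<and> target \<Gamma> = ys ! 2 \<and>
       (\<exists>j \<le> length (edges \<Gamma>). ys ! 3 = pos j)
   | Scanned \<Rightarrow> (\<exists>j \<le> length (edges \<Gamma>). ys ! 1 = pos j \<and>
       (\<forall>i<j. fst (edges \<Gamma> ! i) = ys ! 0 \<longrightarrow> snd (snd (edges \<Gamma> ! i)) \<in> grounded))
   | Grounded \<Rightarrow> ys ! 0 \<in> grounded
   | Below \<Rightarrow> (\<forall>v < ys ! 0. v \<in> grounded)
   | Times j \<Rightarrow> ys ! 1 = \<beta> * ys ! 0 + j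
   | Link d \<Rightarrow> d < \<beta> \<and> (\<exists>k g. walk (edge \<Gamma>) (ys ! 0) k g (ys ! 2) \<and>
       ball ! d = inv (place (ys ! 1)) \<otimes> g \<otimes> place (ys ! 3))
   | Accept \<Rightarrow> (\<forall>v < nverts \<Gamma>. v \<in> grounded) \<and> (\<exists>k. walk (edge \<Gamma>) (source \<Gamma>) k \<one> (target \<Gamma>))
   | _ \<Rightarrow> True)"

abbreviation sound :: "rel hrule \<Rightarrow> bool" where
  "sound \<equiv> preserves (input_symbol x) (meaning x c) instance_meaning"

lemma header_unique:
  assumes "reads x 1 [n, s, t] p"
  shows "nverts \<Gamma> = n" "source \<Gamma> = s" "target \<Gamma> = t" "p = pos 0"
proof -
  have "reads x 1 [nverts \<Gamma>, source \<Gamma>, target \<Gamma>] (pos 0)"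
    using reads_pos[of 0] by (simp add: instance_nats_def)
  from reads_unique[OF this assms] show "nverts \<Gamma> = n" "source \<Gamma> = s" "target \<Gamma> = t" "p = pos 0"
    by simp_all
qed

lemma sound_parse: "\<forall>rl \<in> set parse_rules. sound rl" "\<forall>rl \<in> set (constant_rules j). sound rl"
  unfolding parse_rules_def constant_rules_def preserves_def meaning_def instance_meaning_def
  using header_unique by auto

lemma sound_edge: "\<forall>rl \<in> set (edge_rules j). sound rl"
proof -
  have "\<exists>i \<le> length (edges \<Gamma>). q = pos i" if "reads x (pos i) [u, j, v] q" "i \<le> length (edges \<Gamma>)"
    for i u v q
    using edge_at_pos(1,2)[OF that] by (intro exI[of _ "Suc i"]) simp
  then show ?thesis unfolding edge_rules_def preserves_def meaning_def instance_meaning_def by auto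
qed

lemma groundedI:
  assumes "\<forall>i < length (edges \<Gamma>). fst (edges \<Gamma> ! i) = v \<longrightarrow> snd (snd (edges \<Gamma> ! i)) \<in> grounded"
  shows "v \<in> grounded"
  unfolding grounded_def
proof (rule accI)
  fix u assume "(u, v) \<in> (edge_rel \<Gamma>)\<inverse>"
  then obtain l where "(v, l, u) \<in> set (edges \<Gamma>)" by (auto simp: edge_rel_def)
  then show "u \<in> Wellfounded.acc ((edge_rel \<Gamma>)\<inverse>)"
    using assms unfolding grounded_def[symmetric] by (metis fst_conv in_set_conv_nth snd_conv)
qed

lemma pos_beyond:
  assumes "length x < pos j" "j \<le> length (edges \<Gamma>)"
  shows "j = length (edges \<Gamma>)"
proof (rule ccontr)
  assume "j \<noteq> length (edges \<Gamma>)"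
  then have "pos j < pos (Suc j)" "pos (Suc j) \<le> Suc (length x)"
    using assms(2) pos_less[of j] pos_le[of "Suc j"] by auto
  then show False using assms(1) by linarith
qed

lemma sound_grounded: "\<forall>rl \<in> set grounded_rules. sound rl"
proof -
  have "sound (grounded_rules ! 0)"
    unfolding grounded_rules_def preserves_def meaning_def instance_meaning_def using header_unique(4) by auto
  moreover have "v \<in> grounded" if "length x < pos j" "j \<le> length (edges \<Gamma>)"
    "\<forall>i<j. fst (edges \<Gamma> ! i) = v \<longrightarrow> snd (snd (edges \<Gamma> ! i)) \<in> grounded" for v j
    using groundedI[of v] pos_beyond[OF that(1,2)] that(3) by simp
  then have "sound (grounded_rules ! 1)"
    unfolding grounded_rules_def preserves_def instance_meaning_def
    by (auto simp: input_symbol_cases(4))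
  moreover have "sound (grounded_rules ! 2)" "sound (grounded_rules ! 3)"
    unfolding grounded_rules_def preserves_def instance_meaning_def
    by (auto simp: input_symbol_cases(3)[unfolded One_nat_def] less_Suc_eq)
  ultimately show ?thesis by (simp add: grounded_rules_def numeral_2_eq_2 numeral_3_eq_3)
qed

lemma sound_scan: "\<forall>rl \<in> set (scan_rules j). sound rl"
proof -
  have scan: "\<exists>i \<le> length (edges \<Gamma>). q = pos i \<and>
      (\<forall>i'<i. fst (edges \<Gamma> ! i') = v \<longrightarrow> snd (snd (edges \<Gamma> ! i')) \<in> grounded)"
    if "i \<le> length (edges \<Gamma>)" "p = pos i" "reads x p [u, j, w] q" "u = v \<Longrightarrow> w \<in> grounded"
      "\<forall>i'<i. fst (edges \<Gamma> ! i') = v \<longrightarrow> snd (snd (edges \<Gamma> ! i')) \<in> grounded" for i p q u v w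
  proof -
    note e = edge_at_pos[OF that(3)[unfolded that(2)] that(1)]
    then show ?thesis using that(4,5) by (intro exI[of _ "Suc i"]) (auto simp: less_Suc_eq)
  qed
  show ?thesis
    unfolding scan_rules_def preserves_def meaning_def instance_meaning_def
    by (auto intro: scan)
qed

lemma sound_times: "\<forall>rl \<in> set (times_rules \<beta>). sound rl"
  unfolding times_rules_def preserves_def instance_meaning_def
  by (auto simp: input_symbol_cases(3)[unfolded One_nat_def])

lemma edge_label:
  assumes "(u, l, v) \<in> set (edges \<Gamma>)"
  shows "u < nverts \<Gamma>" "v < nverts \<Gamma>" "label_code l \<le> c" "label_val l \<in> carrier G" "len (label_val l) \<le> R"
  using assms well_formed label_val_cases by (auto simp: well_formed_def edges_ok_def)

lemma the_inv_label_code: "the_inv label_code (label_code l) = l"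
  by (rule the_inv_f_f) (auto intro: injI label_code_inject)

lemma sound_link: "\<forall>rl \<in> set (link_rules \<beta> ones invs labs mults). sound rl"
proof -
  have 1: "\<exists>k g. walk (edge \<Gamma>) u k g u \<and> \<one> = inv (place s) \<otimes> g \<otimes> place s" for u s
    using walk.walk_Nil[of "edge \<Gamma>" u] place_carrier by (intro exI[of _ 0] exI[of _ \<one>]) simp
  have 2: "\<exists>k g. walk (edge \<Gamma>) u k g u \<and> ball ! b = inv (place s) \<otimes> g \<otimes> place (Suc (\<beta> * s + b))"
    if "b < \<beta>" for u s b
    using walk.walk_Nil[of "edge \<Gamma>" u] place_carrier[of s] ball_nth[OF that] that
    by (intro exI[of _ 0] exI[of _ \<one>]) (simp add: place_extend m_assoc[symmetric] del: place.simps)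
  have 3: "\<exists>k g. walk (edge \<Gamma>) u k g u \<and> inv (ball ! b) = inv (place (Suc (\<beta> * s + b))) \<otimes> g \<otimes> place s"
    if "b < \<beta>" for u s b
    using walk.walk_Nil[of "edge \<Gamma>" u] place_carrier[of s] ball_nth[OF that] that
    by (intro exI[of _ 0] exI[of _ \<one>]) (simp add: place_extend inv_mult_group m_assoc del: place.simps)
  have 4: "\<exists>k g. walk (edge \<Gamma>) u k g v \<and> label_val (the_inv label_code a) = inv (place 0) \<otimes> g \<otimes> place 0"
    if r: "reads x (pos j) [u, a, v] q" "j \<le> length (edges \<Gamma>)" for u v a q j
  proof -
    obtain l where l: "edges \<Gamma> ! j = (u, l, v)" "label_code l = a"
      using edge_at_pos(3)[OF r] by blast
    then have e: "(u, l, v) \<in> set (edges \<Gamma>)" using edge_at_pos(1)[OF r] by (metis nth_mem)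
    then have "walk (edge \<Gamma>) u (Suc 0) (label_val l \<otimes> \<one>) v"
      using edge_label(4)[OF e] walk.walk_Nil[of "edge \<Gamma>" v]
      by (intro walk.walk_Cons) (auto simp: edge_def)
    then show ?thesis using e edge_label(4) l(2) the_inv_label_code
      by (intro exI[of _ "Suc 0"] exI[of _ "label_val l"]) auto
  qed
  have 5: "\<exists>k g. walk (edge \<Gamma>) u k g w \<and> a \<otimes> b = inv (place s) \<otimes> g \<otimes> place r"
    if "walk (edge \<Gamma>) u k1 g1 v" "walk (edge \<Gamma>) v k2 g2 w" "a = inv (place s) \<otimes> g1 \<otimes> place t"
      "b = inv (place t) \<otimes> g2 \<otimes> place r" for u v w s t r k1 k2 g1 g2 a b
  proof (intro exI conjI)
    show "walk (edge \<Gamma>) u (k1 + k2) (g1 \<otimes> g2) w" using that(1,2) by (rule walk_append)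
    have g: "g1 \<in> carrier G" "g2 \<in> carrier G" using that(1,2) walk_carrier by auto
    have "place t \<otimes> (inv (place t) \<otimes> (g2 \<otimes> place r)) = g2 \<otimes> place r"
      using g place_carrier by (simp add: m_assoc[symmetric])
    then show "a \<otimes> b = inv (place s) \<otimes> (g1 \<otimes> g2) \<otimes> place r"
      using g place_carrier by (simp add: that(3,4) m_assoc)
  qed
  show ?thesis
    unfolding link_rules_def
  proof (simp only: set_append ball_Un set_map ball_simps, intro conjI ballI)
    fix d assume "d \<in> set ones"
    then show "sound ((Link d, [Var 0, Var 1, Var 0, Var 1]), [], [])"
      using 1 by (auto simp: preserves_def instance_meaning_def ones_def)
  next
    fix d assume "d \<in> set [0..<\<beta>]"
    then show "sound ((Link d, [Var 0, Var 1, Var 0, Var 2]), [], [(Times (Suc d), [Var 1, Var 2])])"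
      using 2 by (auto simp: preserves_def instance_meaning_def simp del: place.simps)
  next
    fix bd assume "bd \<in> set invs"
    then show "sound (case bd of (b, d) \<Rightarrow>
        ((Link d, [Var 0, Var 2, Var 0, Var 1]), [], [(Times (Suc b), [Var 1, Var 2])]))"
      using 3 by (auto simp: preserves_def instance_meaning_def invs_def simp del: place.simps)
  next
    fix jd assume "jd \<in> set labs"
    then show "sound (case jd of (j, d) \<Rightarrow> ((Link d, [Var 1, Var 4, Var 2, Var 4]), [(1, 4)],
       [(Parsed, [Var 5, Var 6, Var 7, Var 0]), (Edge j, [Var 0, Var 1, Var 2, Var 3])]))"
      using 4 by (auto simp: preserves_def meaning_def instance_meaning_def labs_def
          input_symbol_cases(3)[unfolded One_nat_def] simp del: place.simps upt_Suc)
  next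
    fix m assume "m \<in> set mults"
    then show "sound (case m of (d, g, f) \<Rightarrow> ((Link f, [Var 0, Var 1, Var 4, Var 5]), [],
       [(Link d, [Var 0, Var 1, Var 2, Var 3]), (Link g, [Var 2, Var 3, Var 4, Var 5])]))"
      using 5 by (auto simp: preserves_def instance_meaning_def mults_def simp del: place.simps)
  qed
qed

lemma sound_accept: "\<forall>rl \<in> set (accept_rules ones). sound rl"
proof -
  have "\<exists>k. walk (edge \<Gamma>) u k \<one> v"
    if "walk (edge \<Gamma>) u k g v" "\<one> = inv (place 0) \<otimes> g \<otimes> place 0" for u v k g
    using that walk_carrier[OF that(1)] by auto
  then show ?thesis
    unfolding accept_rules_def preserves_def instance_meaning_def
    by (auto simp: ones_def input_symbol_cases(3)[unfolded One_nat_def] simp del: place.simps)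
qed

lemma derives_instance_meaning:
  assumes "derives rules N (input_symbol x) r ys"
  shows "instance_meaning r ys"
proof (rule derives_sound[OF assms])
  show "\<forall>rl \<in> set rules. sound rl"
    unfolding rules_def ball_program
    by (intro conjI allI impI sound_parse sound_edge sound_grounded sound_scan sound_times sound_link
        sound_accept)
  show "meaning x c r ys" if "derives rules N (input_symbol x) r ys" for r ys
    using derives_meaning that unfolding rules_def by blast
qed

lemma grounded_wf:
  assumes "\<forall>v < nverts \<Gamma>. v \<in> grounded"
  shows "wf ((edge_rel \<Gamma>)\<inverse>)"
proof (rule acc_wfI, rule allI)
  fix v
  show "v \<in> Wellfounded.acc ((edge_rel \<Gamma>)\<inverse>)"
  proof (rule accI)
    fix u assume "(u, v) \<in> (edge_rel \<Gamma>)\<inverse>"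
    then have "u < nverts \<Gamma>" using edge_label(2) by (auto simp: edge_rel_def)
    then show "u \<in> Wellfounded.acc ((edge_rel \<Gamma>)\<inverse>)" using assms by (simp add: grounded_def)
  qed
qed

end

section \<open>Acyclic instances\<close>

lemma arcs_ends_digraph_of: "arcs_ends (digraph_of \<Gamma>) = edge_rel \<Gamma>"
proof (intro equalityI subsetI)
  fix uv assume "uv \<in> arcs_ends (digraph_of \<Gamma>)"
  then obtain e where "e < length (edges \<Gamma>)" "uv = (fst (edges \<Gamma> ! e), snd (snd (edges \<Gamma> ! e)))"
    by (auto simp: arcs_ends_conv digraph_of_def)
  moreover from this have "edges \<Gamma> ! e \<in> set (edges \<Gamma>)" by simp
  ultimately show "uv \<in> edge_rel \<Gamma>"
    by (cases "edges \<Gamma> ! e") (auto simp: edge_rel_def)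
next
  fix uv assume "uv \<in> edge_rel \<Gamma>"
  then obtain u l v where "uv = (u, v)" "(u, l, v) \<in> set (edges \<Gamma>)" by (auto simp: edge_rel_def)
  then obtain e where "e < length (edges \<Gamma>)" "edges \<Gamma> ! e = (u, l, v)" "uv = (u, v)"
    by (metis in_set_conv_nth)
  then show "uv \<in> arcs_ends (digraph_of \<Gamma>)"
    by (auto simp: arcs_ends_conv digraph_of_def intro!: image_eqI[of _ _ e])
qed

text \<open>
  Well-foundedness is what the program establishes: the grounded vertices are the accessible part of
  the reversed edge relation.
\<close>

lemma no_cycle_iff_wf:
  assumes "fin_digraph (digraph_of \<Gamma>)"
  shows "(\<nexists>p. pre_digraph.cycle (digraph_of \<Gamma>) p) \<longleftrightarrow> wf ((edge_rel \<Gamma>)\<inverse>)"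
proof
  interpret fin_digraph "digraph_of \<Gamma>" by fact
  assume no_cycle: "\<nexists>p. cycle p"
  have "acyclic (edge_rel \<Gamma>)"
    unfolding acyclic_def
  proof (intro allI notI)
    fix u assume "(u, u) \<in> (edge_rel \<Gamma>)\<^sup>+"
    then obtain p where "awalk u p u" "p \<noteq> []"
      using reachable1_awalk unfolding arcs_ends_digraph_of by blast
    then have "closed_w p" by (auto simp: closed_w_def)
    then show False using closed_w_imp_cycle no_cycle by blast
  qed
  moreover have "finite (edge_rel \<Gamma>)"
    unfolding arcs_ends_digraph_of[symmetric] arcs_ends_def by simp
  ultimately show "wf ((edge_rel \<Gamma>)\<inverse>)" by (intro finite_acyclic_wf_converse)
next
  interpret fin_digraph "digraph_of \<Gamma>" by fact
  assume "wf ((edge_rel \<Gamma>)\<inverse>)"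
  then have ac: "acyclic (edge_rel \<Gamma>)" using wf_acyclic acyclic_converse by blast
  show "\<nexists>p. cycle p"
  proof
    assume "\<exists>p. cycle p"
    then obtain u p where "awalk u p u" "p \<noteq> []" by (auto simp: cycle_def)
    then have "(u, u) \<in> (edge_rel \<Gamma>)\<^sup>+"
      using reachable1_awalk unfolding arcs_ends_digraph_of by blast
    then show False using ac by (auto simp: acyclic_def)
  qed
qed

lemma label_code_le_iff: "label_code l \<le> 2 * m \<longleftrightarrow> (\<forall>a. l = Some a \<longrightarrow> letter_index a < m)"
  by (cases l rule: label_code.cases) auto

lemma valid_instance_iff:
  "valid_instance m \<Gamma> \<longleftrightarrow> well_formed (2 * m) \<Gamma> \<and> wf ((edge_rel \<Gamma>)\<inverse>)"
proof -
  have "(\<forall>(u, l, v) \<in> set (edges \<Gamma>). Q u l v) \<longleftrightarrow>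
      (\<forall>e < length (edges \<Gamma>). Q (fst (edges \<Gamma> ! e)) (arc_label \<Gamma> e) (snd (snd (edges \<Gamma> ! e))))" for Q
    by (auto simp: all_set_conv_all_nth case_prod_beta arc_label_def)
  then have "edges_ok (2 * m) (nverts \<Gamma>) (edges \<Gamma>) \<longleftrightarrow> (\<forall>e < length (edges \<Gamma>).
      fst (edges \<Gamma> ! e) < nverts \<Gamma> \<and> snd (snd (edges \<Gamma> ! e)) < nverts \<Gamma> \<and>
      (\<forall>a. arc_label \<Gamma> e = Some a \<longrightarrow> letter_index a < m))"
    unfolding edges_ok_def label_code_le_iff .
  moreover have "fin_digraph (digraph_of \<Gamma>) \<longleftrightarrow> (\<forall>e < length (edges \<Gamma>).
      fst (edges \<Gamma> ! e) < nverts \<Gamma> \<and> snd (snd (edges \<Gamma> ! e)) < nverts \<Gamma>)"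
    by (auto simp: fin_digraph_def fin_digraph_axioms_def wf_digraph_def digraph_of_def)
  ultimately show ?thesis
    using no_cycle_iff_wf[of \<Gamma>] unfolding valid_instance_def well_formed_def
    by (auto simp: digraph_of_def)
qed

text \<open>A path in an acyclic graph repeats no vertex, so it has fewer arcs than there are vertices.\<close>

lemma length_path_acyclic:
  assumes "valid_instance m \<Gamma>" "pre_digraph.awalk (digraph_of \<Gamma>) u p v"
  shows "length p < nverts \<Gamma>"
proof -
  interpret fin_digraph "digraph_of \<Gamma>" using assms(1) by (simp add: valid_instance_def)
  have "distinct (awalk_verts u p)"
  proof (rule ccontr)
    assume "\<not> ?thesis"
    then obtain r w where "0 < length r" "awalk w r w"
      using awalk_not_distinct_decomp[OF assms(2)] by blast
    then have "closed_w r" by (auto simp: closed_w_def)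
    then show False
      using closed_w_imp_cycle assms(1) unfolding valid_instance_def by blast
  qed
  then have "apath u p v" using assms(2) by (simp add: apath_def)
  from length_apath_less[OF this] show ?thesis by (simp add: digraph_of_def)
qed

context acyclic_graph_word_problem begin

lemma path_word_Cons:
  "word_val G xs (path_word \<Gamma> (e # p)) =
     (case arc_label \<Gamma> e of None \<Rightarrow> word_val G xs (path_word \<Gamma> p)
      | Some a \<Rightarrow> letter_val G xs a \<otimes> word_val G xs (path_word \<Gamma> p))"
  by (auto simp: path_word_def word_val_def split: option.split)

lemma label_val_simps:
  "label_val None = \<one>" "label_code (Some a) \<le> c \<Longrightarrow> label_val (Some a) = letter_val G xs a"
proof -
  show "label_val None = \<one>" by (simp add: label_val_def word_val_def)
  assume "label_code (Some a) \<le> c"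
  then have "letter_index a < length xs" by (cases a) (auto simp: c_def)
  then have "xs ! letter_index a \<in> carrier G" using xs_carrier nth_mem by blast
  then have "letter_val G xs a \<in> carrier G" by (cases a) auto
  then show "label_val (Some a) = letter_val G xs a" by (simp add: label_val_def word_val_def)
qed

lemma path_word_step:
  assumes "label_code (arc_label \<Gamma> e) \<le> c" "word_val G xs (path_word \<Gamma> p) \<in> carrier G"
  shows "word_val G xs (path_word \<Gamma> (e # p)) =
    label_val (arc_label \<Gamma> e) \<otimes> word_val G xs (path_word \<Gamma> p)"
  using assms by (cases "arc_label \<Gamma> e") (simp_all add: path_word_Cons label_val_simps)

lemma nth_edges: "edges \<Gamma> ! e = (fst (edges \<Gamma> ! e), arc_label \<Gamma> e, snd (snd (edges \<Gamma> ! e)))"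
  by (simp add: arc_label_def)

lemma walk_of_path:
  assumes "well_formed c \<Gamma>" "set p \<subseteq> arcs (digraph_of \<Gamma>)" "pre_digraph.cas (digraph_of \<Gamma>) u p v"
  shows "walk (edge \<Gamma>) u (length p) (word_val G xs (path_word \<Gamma> p)) v"
  using assms(2,3)
proof (induction p arbitrary: u)
  case Nil
  then show ?case using walk.walk_Nil[of "edge \<Gamma>" u]
    by (simp add: pre_digraph.cas.simps path_word_def word_val_def)
next
  case (Cons e p)
  have e: "e < length (edges \<Gamma>)" using Cons.prems by (simp add: digraph_of_def)
  have cas: "fst (edges \<Gamma> ! e) = u" "pre_digraph.cas (digraph_of \<Gamma>) (snd (snd (edges \<Gamma> ! e))) p v"
    using Cons.prems(2) by (simp_all add: pre_digraph.cas.simps) (simp_all add: digraph_of_def)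
  have IH: "walk (edge \<Gamma>) (snd (snd (edges \<Gamma> ! e))) (length p) (word_val G xs (path_word \<Gamma> p)) v"
    using Cons.IH[OF _ cas(2)] Cons.prems(1) by simp
  have in_edges: "(u, arc_label \<Gamma> e, snd (snd (edges \<Gamma> ! e))) \<in> set (edges \<Gamma>)"
    using nth_mem[OF e] nth_edges[of \<Gamma> e] cas(1) by simp
  then have le: "label_code (arc_label \<Gamma> e) \<le> c"
    using assms(1) by (auto simp: well_formed_def edges_ok_def)
  have "walk (edge \<Gamma>) u (Suc (length p)) (label_val (arc_label \<Gamma> e) \<otimes> word_val G xs (path_word \<Gamma> p)) v"
    using in_edges label_val_cases[OF le] IH by (intro walk.walk_Cons) (auto simp: edge_def)
  then show ?case using path_word_step[OF le] walk_carrier[OF IH] by simp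
qed

lemma path_of_walk:
  assumes "well_formed c \<Gamma>" "walk (edge \<Gamma>) u n g v"
  shows "\<exists>p. set p \<subseteq> arcs (digraph_of \<Gamma>) \<and> pre_digraph.cas (digraph_of \<Gamma>) u p v \<and>
    word_val G xs (path_word \<Gamma> p) = g"
  using assms(2)
proof (induction rule: walk.induct)
  case (walk_Nil u)
  show ?case
    by (rule exI[of _ "[]"]) (simp add: pre_digraph.cas.simps path_word_def word_val_def)
next
  case (walk_Cons u g v n h w)
  then obtain p where p: "set p \<subseteq> arcs (digraph_of \<Gamma>)" "pre_digraph.cas (digraph_of \<Gamma>) v p w"
    "word_val G xs (path_word \<Gamma> p) = h" by blast
  obtain l where l: "(u, l, v) \<in> set (edges \<Gamma>)" "g = label_val l"
    using walk_Cons.hyps(1) by (auto simp: edge_def)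
  then obtain e where e: "e < length (edges \<Gamma>)" "edges \<Gamma> ! e = (u, l, v)" by (metis in_set_conv_nth)
  have le: "label_code (arc_label \<Gamma> e) \<le> c"
    using assms(1) l e by (auto simp: well_formed_def edges_ok_def arc_label_def)
  have "h \<in> carrier G" using walk_Cons.hyps(3) by (rule walk_carrier)
  then have "word_val G xs (path_word \<Gamma> (e # p)) = g \<otimes> h"
    using path_word_step[OF le] p(3) e l by (simp add: arc_label_def)
  moreover have "set (e # p) \<subseteq> arcs (digraph_of \<Gamma>)" using p e by (simp add: digraph_of_def)
  moreover have "pre_digraph.cas (digraph_of \<Gamma>) u (e # p) w"
    using p(2) e by (simp add: pre_digraph.cas.simps) (simp add: digraph_of_def)
  ultimately show ?case by blast
qed

lemma yes_instance_iff:
  assumes "well_formed c \<Gamma>"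
  shows "yes_instance G xs \<Gamma> \<longleftrightarrow> (\<exists>n. walk (edge \<Gamma>) (source \<Gamma>) n \<one> (target \<Gamma>))"
  unfolding yes_instance_def pre_digraph.awalk_def
proof
  assume "\<exists>p. (source \<Gamma> \<in> verts (digraph_of \<Gamma>) \<and> set p \<subseteq> arcs (digraph_of \<Gamma>) \<and>
    pre_digraph.cas (digraph_of \<Gamma>) (source \<Gamma>) p (target \<Gamma>)) \<and> word_val G xs (path_word \<Gamma> p) = \<one>"
  then show "\<exists>n. walk (edge \<Gamma>) (source \<Gamma>) n \<one> (target \<Gamma>)" using walk_of_path[OF assms] by metis
next
  assume "\<exists>n. walk (edge \<Gamma>) (source \<Gamma>) n \<one> (target \<Gamma>)"
  then show "\<exists>p. (source \<Gamma> \<in> verts (digraph_of \<Gamma>) \<and> set p \<subseteq> arcs (digraph_of \<Gamma>) \<and>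
    pre_digraph.cas (digraph_of \<Gamma>) (source \<Gamma>) p (target \<Gamma>)) \<and> word_val G xs (path_word \<Gamma> p) = \<one>"
    using path_of_walk[OF assms] assms by (auto simp: well_formed_def digraph_of_def)
qed

lemma short_walk:
  assumes "valid_instance (length xs) \<Gamma>" "yes_instance G xs \<Gamma>"
  shows "\<exists>n. n \<le> nverts \<Gamma> \<and> walk (edge \<Gamma>) (source \<Gamma>) n \<one> (target \<Gamma>)"
proof -
  obtain p where p: "pre_digraph.awalk (digraph_of \<Gamma>) (source \<Gamma>) p (target \<Gamma>)"
    "word_val G xs (path_word \<Gamma> p) = \<one>"
    using assms(2) by (auto simp: yes_instance_def)
  have "well_formed c \<Gamma>" using assms(1) by (simp add: valid_instance_iff c_def)
  from walk_of_path[OF this, of p] have "walk (edge \<Gamma>) (source \<Gamma>) (length p) \<one> (target \<Gamma>)"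
    using p by (simp add: pre_digraph.awalk_def)
  then show ?thesis using length_path_acyclic[OF assms(1) p(1)] less_imp_le by blast
qed

end


section \<open>Completeness: yes-instances are accepted\<close>

definition assign :: "nat list \<Rightarrow> nat \<Rightarrow> nat" where
  "assign ys v = (if v < length ys then ys ! v else 0)"

lemma derives_assign:
  assumes "((r, ts), ins, body) \<in> set P" "\<forall>y \<in> set ys. y < N" "0 < N"
    and "\<forall>(s, v) \<in> set ins. inp (assign ys v) = s"
    and "\<forall>b \<in> set body. derives P N inp (fst b) (map (tval (assign ys)) (snd b))"
  shows "derives P N inp r (map (tval (assign ys)) ts)"
  by (rule derives.rule[OF assms(1)]) (use assms(2-) in \<open>auto simp: assign_def\<close>)

context agwp_instance begin

text \<open>
  As \<open>\<beta> + 1 \<le> 2 ^ \<beta>\<close>, all words of the logarithmic length that is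
  required have numbers below \<open>N\<close>.
\<close>

definition e :: nat where "e = 2 * \<beta> + 1"

definition N :: nat where "N = (length x + 2) ^ e"

abbreviation der :: "rel \<Rightarrow> nat list \<Rightarrow> bool" where
  "der \<equiv> derives rules N (input_symbol x)"

lemma N_ge: "length x + 2 \<le> N"
proof -
  have "(length x + 2) ^ 1 \<le> (length x + 2) ^ e" by (rule power_increasing) (auto simp: e_def)
  then show ?thesis by (simp add: N_def)
qed

lemma rule_sets:
  "set parse_rules \<subseteq> set rules" "set (constant_rules c) \<subseteq> set rules"
  "j \<le> c \<Longrightarrow> set (edge_rules j) \<subseteq> set rules" "set grounded_rules \<subseteq> set rules"
  "j \<le> c \<Longrightarrow> set (scan_rules j) \<subseteq> set rules" "set (times_rules \<beta>) \<subseteq> set rules"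
  "set (link_rules \<beta> ones invs labs mults) \<subseteq> set rules" "set (accept_rules ones) \<subseteq> set rules"
proof -
  have "\<forall>rl \<in> set rules. rl \<in> set rules" by blast
  from this[unfolded rules_def ball_program, folded rules_def]
  show "set parse_rules \<subseteq> set rules" "set (constant_rules c) \<subseteq> set rules"
    "j \<le> c \<Longrightarrow> set (edge_rules j) \<subseteq> set rules" "set grounded_rules \<subseteq> set rules"
    "j \<le> c \<Longrightarrow> set (scan_rules j) \<subseteq> set rules" "set (times_rules \<beta>) \<subseteq> set rules"
    "set (link_rules \<beta> ones invs labs mults) \<subseteq> set rules" "set (accept_rules ones) \<subseteq> set rules"
    by blast+
qed

text \<open>A rule is applied by giving the values of its variables as a list.\<close>

lemma der_rule:
  assumes "((r, ts), ins, body) \<in> rs" "rs \<subseteq> set rules" "\<forall>y \<in> set ys. y < N"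
    and "\<forall>(s, v) \<in> set ins. input_symbol x (assign ys v) = s"
    and "\<forall>b \<in> set body. der (fst b) (map (tval (assign ys)) (snd b))"
    and "zs = map (tval (assign ys)) ts"
  shows "der r zs"
  unfolding assms(6) by (rule derives_assign) (use assms N_ge in auto)

lemma symbol_zero: "input_symbol x 0 = Suc 0"
  by (simp add: input_symbol_cases(3)[unfolded One_nat_def])

lemma symbol_end: "input_symbol x (Suc (length x)) = 0"
  by (simp add: input_symbol_cases)

lemma der_Count:
  assumes "\<And>i. p \<le> i \<Longrightarrow> i < p + k \<Longrightarrow> input_symbol x i = 3" "p + k < N"
  shows "der Count [p, k, p + k]"
  using assms
proof (induction k)
  case 0
  show ?case
    by (rule der_rule[of _ "[Var 0, Var 1, Var 0]" "[(1, 1)]" "[]" _ "[p, 0]", OF _ rule_sets(1)])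
      (use 0 in \<open>auto simp: parse_rules_def assign_def symbol_zero\<close>)
next
  case (Suc k)
  have "der Count [p, k, p + k]" using Suc by simp
  then show ?case
    by (intro der_rule[of _ "[Var 0, Succ 1, Succ 2]" "[(3, 2)]" "[(Count, [Var 0, Var 1, Var 2])]"
        _ "[p, k, p + k]", OF _ rule_sets(1)])
      (use Suc.prems in \<open>auto simp: parse_rules_def assign_def\<close>)
qed

lemma reads_bounds:
  assumes "reads x p [k] q"
  shows "p < N" "k < N" "q < N" "p + k < N" "q = Suc (p + k)"
  using reads_le[OF assms] N_ge assms by (auto simp: reads_def)

lemma der_Number:
  assumes "reads x p [k] q"
  shows "der Number [p, k, q]"
proof -
  note b = reads_bounds[OF assms]
  have "der Count [p, k, p + k]"
    using assms b by (intro der_Count) (auto simp: reads_number)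
  moreover have "input_symbol x (p + k) = 2" using assms by (simp add: reads_number)
  ultimately show ?thesis
    by (intro der_rule[of _ "[Var 0, Var 1, Succ 2]" "[(2, 2)]" "[(Count, [Var 0, Var 1, Var 2])]"
        _ "[p, k, p + k]", OF _ rule_sets(1)])
      (use b in \<open>auto simp: parse_rules_def assign_def\<close>)
qed

lemma der_Less: "a < b \<Longrightarrow> b < N \<Longrightarrow> der Less [a, b]"
proof (induction b)
  case (Suc b)
  show ?case
  proof (cases "a = b")
    case True
    show ?thesis
      by (rule der_rule[of _ "[Var 0, Succ 0]" "[]" "[]" _ "[a]", OF _ rule_sets(1)])
        (use Suc.prems True in \<open>auto simp: parse_rules_def assign_def\<close>)
  next
    case False
    then have "der Less [a, b]" using Suc by simp
    then show ?thesis
      by (intro der_rule[of _ "[Var 0, Succ 1]" "[]" "[(Less, [Var 0, Var 1])]" _ "[a, b]",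
          OF _ rule_sets(1)])
        (use Suc.prems in \<open>auto simp: parse_rules_def assign_def\<close>)
  qed
qed simp

lemma der_Constant: "j \<le> c \<Longrightarrow> j < N \<Longrightarrow> der (Constant j) [j]"
proof (induction j)
  case 0
  show ?case
    by (rule der_rule[of _ "[Var 0]" "[(1, 0)]" "[]" _ "[0]", OF _ rule_sets(1)])
      (use 0 in \<open>auto simp: parse_rules_def assign_def symbol_zero\<close>)
next
  case (Suc j)
  then have "der (Constant j) [j]" by simp
  then show ?case
    by (intro der_rule[of _ "[Succ 0]" "[]" "[(Constant j, [Var 0])]" _ "[j]", OF _ rule_sets(2)])
      (use Suc.prems in \<open>auto simp: constant_rules_def assign_def\<close>)
qed

lemma reads3D:
  assumes "reads x p [i, j, k] q"
  shows "\<exists>a b. reads x p [i] a \<and> reads x a [j] b \<and> reads x b [k] q"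
  using reads_appendD[of x p "[i]" "[j, k]" q] reads_appendD[of x _ "[j]" "[k]" q] assms by auto

lemma pos_N: "j \<le> length (edges \<Gamma>) \<Longrightarrow> pos j < N"
  using pos_le N_ge by fastforce

lemma verts_N: "source \<Gamma> < nverts \<Gamma>" "target \<Gamma> < nverts \<Gamma>" "nverts \<Gamma> < N"
  using well_formed length_encode_instance[of \<Gamma>] N_ge by (auto simp: well_formed_def)

lemma der_Header: "der Header [nverts \<Gamma>, source \<Gamma>, target \<Gamma>, pos 0]"
proof -
  have "reads x 1 [nverts \<Gamma>, source \<Gamma>, target \<Gamma>] (pos 0)"
    using reads_pos[of 0] by (simp add: instance_nats_def)
  then obtain a b where r: "reads x 1 [nverts \<Gamma>] a" "reads x a [source \<Gamma>] b" "reads x b [target \<Gamma>] (pos 0)"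
    using reads3D by blast
  note d = der_Number[OF r(1)] der_Number[OF r(2)] der_Number[OF r(3)]
    der_Less[OF verts_N(1,3)] der_Less[OF verts_N(2,3)]
  show ?thesis
    by (rule der_rule[of _ "[Var 0, Var 1, Var 2, Var 3]" "[(1, 4)]"
        "[(Number, [Succ 4, Var 0, Var 5]), (Number, [Var 5, Var 1, Var 6]),
          (Number, [Var 6, Var 2, Var 3]), (Less, [Var 1, Var 0]), (Less, [Var 2, Var 0])]"
        _ "[nverts \<Gamma>, source \<Gamma>, target \<Gamma>, pos 0, 0, a, b]", OF _ rule_sets(1)])
      (use d reads_bounds[OF r(1)] reads_bounds[OF r(2)] reads_bounds[OF r(3)] verts_N in
        \<open>auto simp: parse_rules_def assign_def symbol_zero\<close>)
qed

lemma der_Edge: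
  assumes "reads x p [u, j, v] q" "j \<le> c"
  shows "der (Edge j) [p, u, v, q]"
proof -
  obtain a b where r: "reads x p [u] a" "reads x a [j] b" "reads x b [v] q"
    using reads3D[OF assms(1)] by blast
  note d = der_Number[OF r(1)] der_Number[OF r(2)] der_Number[OF r(3)]
    der_Constant[OF assms(2) reads_bounds(2)[OF r(2)]]
  show ?thesis
    by (rule der_rule[of _ "[Var 0, Var 1, Var 2, Var 3]" "[]"
        "[(Number, [Var 0, Var 1, Var 4]), (Number, [Var 4, Var 5, Var 6]),
          (Number, [Var 6, Var 2, Var 3]), (Constant j, [Var 5])]"
        _ "[p, u, v, q, a, j, b]", OF _ rule_sets(3)[OF assms(2)]])
      (use d reads_bounds[OF r(1)] reads_bounds[OF r(2)] reads_bounds[OF r(3)] in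
        \<open>auto simp: edge_rules_def assign_def\<close>)
qed

lemma der_Edge_pos:
  assumes "j < length (edges \<Gamma>)" "edges \<Gamma> ! j = (u, l, v)"
  shows "der (Edge (label_code l)) [pos j, u, v, pos (Suc j)]"
    and "u < nverts \<Gamma>" "v < nverts \<Gamma>" "label_code l \<le> c"
proof -
  have "(u, l, v) \<in> set (edges \<Gamma>)" using assms by (metis nth_mem)
  note * = edge_label(1,2,3)[OF this]
  then show "u < nverts \<Gamma>" "v < nverts \<Gamma>" "label_code l \<le> c" by auto
  show "der (Edge (label_code l)) [pos j, u, v, pos (Suc j)]"
    by (rule der_Edge[OF reads_edge[OF assms] *(3)])
qed

lemma der_Parsed:
  "j \<le> length (edges \<Gamma>) \<Longrightarrow> der Parsed [nverts \<Gamma>, source \<Gamma>, target \<Gamma>, pos j]"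
proof (induction j)
  case 0
  show ?case
    by (rule der_rule[of _ "[Var 0, Var 1, Var 2, Var 3]" "[]" "[(Header, [Var 0, Var 1, Var 2, Var 3])]"
        _ "[nverts \<Gamma>, source \<Gamma>, target \<Gamma>, pos 0]", OF _ rule_sets(1)])
      (use der_Header verts_N pos_N[of 0] in \<open>auto simp: parse_rules_def assign_def\<close>)
next
  case (Suc j)
  obtain u l v where l: "edges \<Gamma> ! j = (u, l, v)" by (metis prod.collapse)
  have j: "j < length (edges \<Gamma>)" using Suc.prems by simp
  note d = der_Edge_pos[OF j l]
  have IH: "der Parsed [nverts \<Gamma>, source \<Gamma>, target \<Gamma>, pos j]" using Suc by simp
  show ?case
    by (rule der_rule[of _ "[Var 0, Var 1, Var 2, Var 6]" "[]"
        "[(Parsed, [Var 0, Var 1, Var 2, Var 3]), (Edge (label_code l), [Var 3, Var 4, Var 5, Var 6]),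
          (Less, [Var 4, Var 0]), (Less, [Var 5, Var 0])]"
        _ "[nverts \<Gamma>, source \<Gamma>, target \<Gamma>, pos j, u, v, pos (Suc j)]", OF _ rule_sets(3)[OF d(4)]])
      (use d IH verts_N pos_N[of j] pos_N[of "Suc j"] j der_Less[OF d(2)] der_Less[OF d(3)] in
        \<open>auto simp: edge_rules_def assign_def\<close>)
qed

lemma der_Scanned:
  assumes "v < nverts \<Gamma>" "j \<le> length (edges \<Gamma>)"
    and "\<And>i. i < j \<Longrightarrow> fst (edges \<Gamma> ! i) = v \<Longrightarrow> der Grounded [snd (snd (edges \<Gamma> ! i))]"
  shows "der Scanned [v, pos j]"
  using assms(2,3)
proof (induction j)
  case 0
  show ?case
    by (rule der_rule[of _ "[Var 4, Var 3]" "[]" "[(Header, [Var 0, Var 1, Var 2, Var 3])]"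
        _ "[nverts \<Gamma>, source \<Gamma>, target \<Gamma>, pos 0, v]", OF _ rule_sets(4)])
      (use der_Header verts_N pos_N[of 0] assms(1) in \<open>auto simp: grounded_rules_def assign_def\<close>)
next
  case (Suc j)
  obtain u l w where l: "edges \<Gamma> ! j = (u, l, w)" by (metis prod.collapse)
  have j: "j < length (edges \<Gamma>)" using Suc.prems by simp
  note d = der_Edge_pos[OF j l]
  have IH: "der Scanned [v, pos j]" using Suc by simp
  have N: "pos j < N" "pos (Suc j) < N" "u < N" "v < N" "w < N"
    using pos_N[of j] pos_N[of "Suc j"] j d assms(1) verts_N by auto
  consider "v < u" | "u < v" | "u = v" by linarith
  then show ?case
  proof cases
    case 1
    show ?thesis
      by (rule der_rule[of _ "[Var 0, Var 4]" "[]"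
          "[(Scanned, [Var 0, Var 1]), (Edge (label_code l), [Var 1, Var 2, Var 3, Var 4]),
            (Less, [Var 0, Var 2])]"
          _ "[v, pos j, u, w, pos (Suc j)]", OF _ rule_sets(5)[OF d(4)]])
        (use d(1) IH N der_Less[OF 1] in \<open>auto simp: scan_rules_def assign_def\<close>)
  next
    case 2
    show ?thesis
      by (rule der_rule[of _ "[Var 0, Var 4]" "[]"
          "[(Scanned, [Var 0, Var 1]), (Edge (label_code l), [Var 1, Var 2, Var 3, Var 4]),
            (Less, [Var 2, Var 0])]"
          _ "[v, pos j, u, w, pos (Suc j)]", OF _ rule_sets(5)[OF d(4)]])
        (use d(1) IH N der_Less[OF 2] in \<open>auto simp: scan_rules_def assign_def\<close>)
  next
    case 3
    have "der Grounded [w]" using Suc.prems(2)[of j] l 3 by simp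
    then show ?thesis
      by (intro der_rule[of _ "[Var 0, Var 4]" "[]"
          "[(Scanned, [Var 0, Var 1]), (Edge (label_code l), [Var 1, Var 0, Var 3, Var 4]),
            (Grounded, [Var 3])]"
          _ "[v, pos j, u, w, pos (Suc j)]", OF _ rule_sets(5)[OF d(4)]])
        (use d(1) IH N 3 in \<open>auto simp: scan_rules_def assign_def\<close>)
  qed
qed

lemma der_Grounded:
  assumes "wf ((edge_rel \<Gamma>)\<inverse>)"
  shows "v < nverts \<Gamma> \<Longrightarrow> der Grounded [v]"
  using assms
proof (induction v rule: wf_induct_rule)
  case (less v)
  let ?n = "length (edges \<Gamma>)"
  have "der Scanned [v, pos ?n]"
  proof (rule der_Scanned)
    fix i assume i: "i < ?n" "fst (edges \<Gamma> ! i) = v"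
    obtain l w where l: "edges \<Gamma> ! i = (v, l, w)" using i(2) by (metis prod.collapse)
    then have "(v, l, w) \<in> set (edges \<Gamma>)" using i(1) by (metis nth_mem)
    then have "(w, v) \<in> (edge_rel \<Gamma>)\<inverse>" "w < nverts \<Gamma>"
      using edge_label(2) by (auto simp: edge_rel_def)
    then show "der Grounded [snd (snd (edges \<Gamma> ! i))]" using less.IH l by simp
  qed (use less.prems in auto)
  then show ?case
    by (intro der_rule[of _ "[Var 0]" "[(0, 4)]"
        "[(Scanned, [Var 0, Var 4]), (Parsed, [Var 1, Var 2, Var 3, Var 4])]"
        _ "[v, nverts \<Gamma>, source \<Gamma>, target \<Gamma>, pos ?n]", OF _ rule_sets(4)])
      (use der_Parsed[of ?n] less.prems verts_N pos_N[of ?n] symbol_end in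
        \<open>auto simp: grounded_rules_def assign_def pos_end\<close>)
qed

lemma der_Below:
  assumes "wf ((edge_rel \<Gamma>)\<inverse>)"
  shows "v \<le> nverts \<Gamma> \<Longrightarrow> der Below [v]"
proof (induction v)
  case 0
  show ?case
    by (rule der_rule[of _ "[Var 0]" "[(1, 0)]" "[]" _ "[0]", OF _ rule_sets(4)])
      (use verts_N in \<open>auto simp: grounded_rules_def assign_def symbol_zero\<close>)
next
  case (Suc v)
  then have "der Below [v]" "der Grounded [v]" using der_Grounded[OF assms] by auto
  then show ?case
    by (intro der_rule[of _ "[Succ 0]" "[]" "[(Below, [Var 0]), (Grounded, [Var 0])]" _ "[v]",
        OF _ rule_sets(4)])
      (use verts_N Suc.prems in \<open>auto simp: grounded_rules_def assign_def\<close>)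
qed

lemma der_Times: "j \<le> \<beta> \<Longrightarrow> \<beta> * a + j < N \<Longrightarrow> der (Times j) [a, \<beta> * a + j]"
proof (induction a arbitrary: j)
  case 0
  then show ?case
  proof (induction j)
    case 0
    show ?case
      by (rule der_rule[of _ "[Var 0, Var 0]" "[(1, 0)]" "[]" _ "[0]", OF _ rule_sets(6)])
        (use 0 in \<open>auto simp: times_rules_def assign_def symbol_zero\<close>)
  next
    case (Suc j)
    then have "der (Times j) [0, j]" by simp
    then show ?case
      by (intro der_rule[of _ "[Var 0, Succ 1]" "[]" "[(Times j, [Var 0, Var 1])]" _ "[0, j]",
          OF _ rule_sets(6)])
        (use Suc.prems in \<open>auto simp: times_rules_def assign_def\<close>)
  qed
next
  case (Suc a)
  have "1 * Suc a \<le> \<beta> * Suc a" using \<beta>_pos by (intro mult_right_mono) auto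
  then have "Suc a \<le> \<beta> * Suc a + j" by (simp only: mult_1 trans_le_add1)
  then have Suc_a: "Suc a < N" using Suc.prems(2) by (rule le_less_trans)
  then have a: "a < N" by simp
  from Suc.prems show ?case
  proof (induction j)
    case 0
    have "der (Times \<beta>) [a, \<beta> * a + \<beta>]" using Suc.IH[of \<beta>] 0 by (simp add: add.commute)
    then show ?case
      by (intro der_rule[of _ "[Succ 0, Var 1]" "[]" "[(Times \<beta>, [Var 0, Var 1])]"
          _ "[a, \<beta> * a + \<beta>]", OF _ rule_sets(6)])
        (use 0 a in \<open>auto simp: times_rules_def assign_def\<close>)
  next
    case (Suc j)
    then have "der (Times j) [Suc a, \<beta> * Suc a + j]" by simp
    then show ?case
      by (intro der_rule[of _ "[Var 0, Succ 1]" "[]" "[(Times j, [Var 0, Var 1])]"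
          _ "[Suc a, \<beta> * Suc a + j]", OF _ rule_sets(6)])
        (use Suc.prems Suc_a in \<open>auto simp: times_rules_def assign_def\<close>)
  qed
qed

lemma link_rules_mem:
  "(b, d) \<in> set invs \<Longrightarrow> ((Link d, [Var 0, Var 2, Var 0, Var 1]), [], [(Times (Suc b), [Var 1, Var 2])]) \<in>
     set (link_rules \<beta> ones invs labs mults)"
  "(j, d) \<in> set labs \<Longrightarrow> ((Link d, [Var 1, Var 4, Var 2, Var 4]), [(1, 4)],
     [(Parsed, [Var 5, Var 6, Var 7, Var 0]), (Edge j, [Var 0, Var 1, Var 2, Var 3])]) \<in>
     set (link_rules \<beta> ones invs labs mults)"
  "(d, g, f) \<in> set mults \<Longrightarrow> ((Link f, [Var 0, Var 1, Var 4, Var 5]), [],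
     [(Link d, [Var 0, Var 1, Var 2, Var 3]), (Link g, [Var 2, Var 3, Var 4, Var 5])]) \<in>
     set (link_rules \<beta> ones invs labs mults)"
proof -
  let ?inv = "\<lambda>(b, d). ((Link d, [Var 0, Var 2, Var 0, Var 1]), [], [(Times (Suc b), [Var 1, Var 2])])"
  let ?lab = "\<lambda>(j, d). ((Link d, [Var 1, Var 4, Var 2, Var 4]), [(1, 4)],
     [(Parsed, [Var 5, Var 6, Var 7, Var 0]), (Edge j, [Var 0, Var 1, Var 2, Var 3])])"
  let ?mult = "\<lambda>(d, g, f). ((Link f, [Var 0, Var 1, Var 4, Var 5]), [],
     [(Link d, [Var 0, Var 1, Var 2, Var 3]), (Link g, [Var 2, Var 3, Var 4, Var 5])])"
  have sub: "?inv ` set invs \<subseteq> set (link_rules \<beta> ones invs labs mults)"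
    "?lab ` set labs \<subseteq> set (link_rules \<beta> ones invs labs mults)"
    "?mult ` set mults \<subseteq> set (link_rules \<beta> ones invs labs mults)"
    unfolding link_rules_def set_append set_map by blast+
  show "(b, d) \<in> set invs \<Longrightarrow> ((Link d, [Var 0, Var 2, Var 0, Var 1]), [],
      [(Times (Suc b), [Var 1, Var 2])]) \<in> set (link_rules \<beta> ones invs labs mults)"
    using subsetD[OF sub(1) imageI[of "(b, d)"]] by simp
  show "(j, d) \<in> set labs \<Longrightarrow> ((Link d, [Var 1, Var 4, Var 2, Var 4]), [(1, 4)],
      [(Parsed, [Var 5, Var 6, Var 7, Var 0]), (Edge j, [Var 0, Var 1, Var 2, Var 3])]) \<in>
      set (link_rules \<beta> ones invs labs mults)"
    using subsetD[OF sub(2) imageI[of "(j, d)"]] by simp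
  show "(d, g, f) \<in> set mults \<Longrightarrow> ((Link f, [Var 0, Var 1, Var 4, Var 5]), [],
      [(Link d, [Var 0, Var 1, Var 2, Var 3]), (Link g, [Var 2, Var 3, Var 4, Var 5])]) \<in>
      set (link_rules \<beta> ones invs labs mults)"
    using subsetD[OF sub(3) imageI[of "(d, g, f)"]] by simp
qed

definition number :: "'a \<Rightarrow> nat" where
  "number g = (SOME d. d < \<beta> \<and> ball ! d = g)"

definition code :: "'a list \<Rightarrow> nat" where
  "code s = foldl (\<lambda>i b. Suc (\<beta> * i + number b)) 0 s"

lemma code_simps [simp]: "code [] = 0" "code (s @ [b]) = Suc (\<beta> * code s + number b)"
  by (simp_all add: code_def)

lemma number: "g \<in> set ball \<Longrightarrow> number g < \<beta> \<and> ball ! number g = g"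
  unfolding number_def by (rule someI_ex) (auto simp: in_set_conv_nth \<beta>_def)

lemma number_nth: "d < \<beta> \<Longrightarrow> number (ball ! d) = d"
  using number[of "ball ! d"] ball(1) nth_eq_iff_index_eq[of ball] by (auto simp: \<beta>_def)

lemma code_less: "set s \<subseteq> set ball \<Longrightarrow> code s < Suc \<beta> ^ length s"
proof (induction s rule: rev_induct)
  case (snoc b s)
  have "Suc (\<beta> * code s + number b) \<le> \<beta> * code s + \<beta>" using number[of b] snoc.prems by simp
  also have "\<dots> = \<beta> * Suc (code s)" by simp
  also have "\<dots> \<le> \<beta> * Suc \<beta> ^ length s" using snoc by (intro mult_left_mono) auto
  also have "\<dots> < Suc \<beta> * Suc \<beta> ^ length s" by (intro mult_strict_right_mono) auto
  finally show ?case by simp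
qed simp

lemma linked_length: "linked E R' l a g b \<Longrightarrow> length (snd a) \<le> l \<and> length (snd b) \<le> l"
  by (induction rule: linked.induct) auto

lemma linked_ball: "linked E R l a g b \<Longrightarrow> g \<in> set ball"
  by (induction rule: linked.induct) (auto simp: ball(2) len_inv)

text \<open>
  The bound on \<open>N\<close> ensures that all words of length at most \<open>l\<close> have numbers below \<open>N\<close>, so each rule
  for \<open>linked\<close> is an instance of a rule of the program.
\<close>

lemma der_Link:
  assumes "linked (edge \<Gamma>) R l a g b" "Suc \<beta> ^ l \<le> N" "fst a < nverts \<Gamma>" "set (snd a) \<subseteq> set ball"
  shows "fst b < nverts \<Gamma> \<and> set (snd b) \<subseteq> set ball \<and>
    (\<forall>d < \<beta>. ball ! d = g \<longrightarrow> der (Link d) [fst a, code (snd a), fst b, code (snd b)])"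
proof -
  have codeN: "code s < N" if "set s \<subseteq> set ball" "length s \<le> l" for s
  proof -
    have "code s < Suc \<beta> ^ length s" by (rule code_less[OF that(1)])
    also have "\<dots> \<le> Suc \<beta> ^ l" using that(2) by (intro power_increasing) auto
    finally show ?thesis using assms(2) by simp
  qed
  note vN = less_trans[OF _ verts_N(3)]
  have timesN: "der (Times (Suc (number b))) [code s, code (s @ [b])]"
    if "set (s @ [b]) \<subseteq> set ball" "length s < l" for s b
    using der_Times[of "Suc (number b)" "code s"] number[of b] that codeN[of "s @ [b]"] by simp
  from assms(1,3,4) show ?thesis
  proof (induction rule: linked.induct)
    case (stay s u)
    have "der (Link d) [u, code s, u, code s]" if "d < \<beta>" "ball ! d = \<one>" for d
      by (rule der_rule[of _ "[Var 0, Var 1, Var 0, Var 1]" "[]" "[]" _ "[u, code s]", OF _ rule_sets(7)])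
        (use that vN[of u] codeN[of s] stay in \<open>auto simp: link_rules_def ones_def assign_def\<close>)
    then show ?case using stay by simp
  next
    case (push s b u)
    have s: "set (s @ [b]) \<subseteq> set ball" using push ball(2) by auto
    have "der (Link d) [u, code s, u, code (s @ [b])]" if "d < \<beta>" "ball ! d = b" for d
      by (rule der_rule[of _ "[Var 0, Var 1, Var 0, Var 2]" "[]" "[(Times (Suc d), [Var 1, Var 2])]"
            _ "[u, code s, code (s @ [b])]", OF _ rule_sets(7)])
        (use that vN[of u] codeN[of s] codeN[of "s @ [b]"] push s number_nth[of d] timesN[OF s] in
          \<open>auto simp: link_rules_def assign_def simp del: code_simps\<close>)
    then show ?case using push s by simp
  next
    case (pop s b u)
    have s: "set (s @ [b]) \<subseteq> set ball" using pop by simp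
    then have b: "number b < \<beta>" "ball ! number b = b" using number[of b] by auto
    have "der (Link d) [u, code (s @ [b]), u, code s]" if "d < \<beta>" "ball ! d = inv b" for d
    proof -
      have "(number b, d) \<in> set invs" using that b by (simp add: invs_def)
      from link_rules_mem(1)[OF this] show ?thesis
        by (rule der_rule[OF _ rule_sets(7), where ys = "[u, code s, code (s @ [b])]"])
          (use that vN[of u] codeN[of s] codeN[of "s @ [b]"] pop s timesN[OF s] in
            \<open>auto simp: assign_def simp del: code_simps\<close>)
    qed
    then show ?case using pop s by simp
  next
    case (arc u g v)
    then obtain la where la: "(u, la, v) \<in> set (edges \<Gamma>)" "g = label_val la" by (auto simp: edge_def)
    then obtain i where i: "i < length (edges \<Gamma>)" "edges \<Gamma> ! i = (u, la, v)"
      by (metis in_set_conv_nth)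
    note d = der_Edge_pos[OF i]
    have "der (Link d) [u, 0, v, 0]" if "d < \<beta>" "ball ! d = g" for d
    proof -
      have "(label_code la, d) \<in> set labs"
        using that la d(4) by (simp add: labs_def the_inv_label_code del: upt_Suc)
      from link_rules_mem(2)[OF this] show ?thesis
        by (rule der_rule[OF _ rule_sets(7),
            where ys = "[pos i, u, v, pos (Suc i), 0, nverts \<Gamma>, source \<Gamma>, target \<Gamma>]"])
          (use d(1) der_Parsed[of i] i pos_N[of i] pos_N[of "Suc i"] verts_N vN[OF d(2)] vN[OF d(3)]
            in \<open>auto simp: assign_def symbol_zero\<close>)
    qed
    then show ?case using d(3) by simp
  next
    case (comp a g b h c')
    then have b: "fst b < nverts \<Gamma>" "set (snd b) \<subseteq> set ball" by auto
    have c': "fst c' < nverts \<Gamma>" "set (snd c') \<subseteq> set ball" using comp.IH(2)[OF b] by auto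
    have len: "length (snd a) \<le> l" "length (snd b) \<le> l" "length (snd c') \<le> l"
      using linked_length comp.hyps(1,2) by blast+
    have "der (Link d) [fst a, code (snd a), fst c', code (snd c')]" if d: "d < \<beta>" "ball ! d = g \<otimes> h" for d
    proof -
      let ?g = "number g" and ?h = "number h"
      have g: "?g < \<beta>" "ball ! ?g = g" "?h < \<beta>" "ball ! ?h = h"
        using number linked_ball[OF comp.hyps(1)] linked_ball[OF comp.hyps(2)] by auto
      have 1: "der (Link ?g) [fst a, code (snd a), fst b, code (snd b)]"
        using comp.IH(1) comp.prems g by blast
      have 2: "der (Link ?h) [fst b, code (snd b), fst c', code (snd c')]"
        using comp.IH(2)[OF b] g by blast
      have "(?g, ?h, d) \<in> set mults" using d g by (simp add: mults_def)
      from link_rules_mem(3)[OF this] show ?thesis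
        by (rule der_rule[OF _ rule_sets(7), where
            ys = "[fst a, code (snd a), fst b, code (snd b), fst c', code (snd c')]"])
          (use 1 2 vN[OF comp.prems(1)] vN[OF b(1)] vN[OF c'(1)] codeN[OF comp.prems(2) len(1)]
            codeN[OF b(2) len(2)] codeN[OF c'(2) len(3)] in \<open>auto simp: assign_def\<close>)
    qed
    then show ?case using c' by simp
  qed
qed

lemma der_Accept:
  assumes "wf ((edge_rel \<Gamma>)\<inverse>)" "walk (edge \<Gamma>) (source \<Gamma>) n \<one> (target \<Gamma>)" "n \<le> length x"
  shows "der Accept []"
proof -
  obtain k where k: "n \<le> 2 ^ k" "2 ^ k \<le> 2 * n + 1"
  proof (cases "n = 0")
    case True
    then show thesis using that[of 0] by simp
  next
    case False
    then obtain k where "2 ^ k \<le> n" "n < 2 ^ (k + 1)"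
      using ex_power_ivl1[of 2 n] by auto
    then show thesis using that[of "Suc k"] by simp
  qed
  \<comment> \<open>Words of length at most \<open>k + 1\<close> suffice; since \<open>k\<close> is logarithmic in \<open>n\<close>, there are
    polynomially many of them.\<close>
  have "Suc \<beta> ^ Suc k \<le> (2 ^ \<beta>) ^ Suc k"
    using Suc_leI[OF less_exp[of \<beta>]] by (intro power_mono) auto
  also have "\<dots> = (2 * 2 ^ k) ^ \<beta>" by (metis mult.commute power_Suc power_mult)
  also have "\<dots> \<le> ((length x + 2) ^ 2) ^ \<beta>"
  proof (rule power_mono)
    have "2 * 2 ^ k \<le> 4 * length x + 2" using k(2) assms(3) by linarith
    then show "2 * 2 ^ k \<le> (length x + 2) ^ 2" by (simp add: power2_eq_square algebra_simps)
  qed simp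
  also have "\<dots> = (length x + 2) ^ (2 * \<beta>)" by (simp add: power_mult)
  also have "\<dots> \<le> N" unfolding N_def e_def by (intro power_increasing) auto
  finally have N: "Suc \<beta> ^ Suc k \<le> N" .
  have "linked (edge \<Gamma>) R (Suc k) (source \<Gamma>, []) \<one> (target \<Gamma>, [])"
  proof (rule linked_trivial_walk)
    show "2 * thin + 3 \<le> R" by (simp add: R_def)
    show "len g \<le> R" if "edge \<Gamma> u g v" for u g v
      using that edge_label(5) by (auto simp: edge_def)
  qed (use assms(2) k(1) in auto)
  from der_Link[OF this N] have link: "der (Link d) [source \<Gamma>, 0, target \<Gamma>, 0]"
    if "d < \<beta>" "ball ! d = \<one>" for d
    using that verts_N by simp
  define d where "d = number \<one>"
  have d: "d < \<beta>" "ball ! d = \<one>" using number[of \<one>] ball(2) by (auto simp: d_def)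
  let ?n = "length (edges \<Gamma>)"
  have "d \<in> set ones" using d by (simp add: ones_def)
  then show ?thesis
    by (intro der_rule[of _ "[]" "[(0, 3), (1, 4)]"
        "[(Parsed, [Var 0, Var 1, Var 2, Var 3]), (Below, [Var 0]), (Link d, [Var 1, Var 4, Var 2, Var 4])]"
        _ "[nverts \<Gamma>, source \<Gamma>, target \<Gamma>, pos ?n, 0]", OF _ rule_sets(8)])
      (use der_Parsed[of ?n] der_Below[OF assms(1), of "nverts \<Gamma>"] link[OF d] verts_N pos_N[of ?n]
          symbol_end in \<open>auto simp: accept_rules_def assign_def symbol_zero pos_end\<close>)
qed

end

context acyclic_graph_word_problem begin

lemma AGWP_eq:
  "AGWP G xs = {x. derives rules ((length x + 2) ^ (2 * \<beta> + 1)) (input_symbol x) Accept []}"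
proof (intro equalityI subsetI)
  fix x assume "x \<in> AGWP G xs"
  then obtain \<Gamma> where \<Gamma>: "x = encode_instance \<Gamma>" "valid_instance (length xs) \<Gamma>" "yes_instance G xs \<Gamma>"
    by (auto simp: AGWP_def)
  then have wf: "well_formed c \<Gamma>" "wf ((edge_rel \<Gamma>)\<inverse>)" by (auto simp: valid_instance_iff c_def)
  interpret agwp_instance G S \<delta> xs \<Gamma> by unfold_locales (rule wf(1))
  obtain n where n: "n \<le> nverts \<Gamma>" "walk (edge \<Gamma>) (source \<Gamma>) n \<one> (target \<Gamma>)"
    using short_walk[OF \<Gamma>(2,3)] by blast
  have "nverts \<Gamma> \<le> length x" by (simp add: \<Gamma>(1) length_encode_instance)
  then have "n \<le> length (encode_instance \<Gamma>)" using \<Gamma>(1) n(1) by simp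
  then have "der Accept []" by (rule der_Accept[OF wf(2) n(2)])
  then show "x \<in> {x. derives rules ((length x + 2) ^ (2 * \<beta> + 1)) (input_symbol x) Accept []}"
    by (simp add: \<Gamma>(1) N_def e_def)
next
  fix x assume "x \<in> {x. derives rules ((length x + 2) ^ (2 * \<beta> + 1)) (input_symbol x) Accept []}"
  then have d: "derives rules ((length x + 2) ^ (2 * \<beta> + 1)) (input_symbol x) Accept []" by simp
  then have "meaning x c Accept []" unfolding rules_def by (rule derives_meaning)
  then obtain \<Gamma> where \<Gamma>: "well_formed c \<Gamma>" "x = encode_instance \<Gamma>" by (auto simp: meaning_def)
  interpret agwp_instance G S \<delta> xs \<Gamma> by unfold_locales (rule \<Gamma>(1))
  have "instance_meaning Accept []" using derives_instance_meaning d \<Gamma>(2) by blast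
  then have "\<forall>v < nverts \<Gamma>. v \<in> grounded" "\<exists>k. walk (edge \<Gamma>) (source \<Gamma>) k \<one> (target \<Gamma>)"
    by (auto simp: instance_meaning_def)
  then have "valid_instance (length xs) \<Gamma>" "yes_instance G xs \<Gamma>"
    using grounded_wf \<Gamma>(1) yes_instance_iff[OF \<Gamma>(1)] by (auto simp: valid_instance_iff c_def)
  then show "x \<in> AGWP G xs" using \<Gamma>(2) by (auto simp: AGWP_def)
qed

lemma AGWP_in_class_P: "AGWP G xs \<in> class_P"
proof -
  interpret horn_machine rules Accept arity "2 * \<beta> + 1" 8 4
    unfolding rules_def by (rule horn_machine_program) simp
  show ?thesis unfolding AGWP_eq by (rule derivable_in_class_P)
qed

end

theorem proposition3:
  fixes G :: "('a, 'b) monoid_scheme" and xs :: "'a list"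
  assumes "hyperbolic_group G"
    and "distinct xs" and "set xs \<subseteq> carrier G" and "generate G (set xs) = carrier G"
  shows "AGWP G xs \<in> class_P"
proof -
  obtain S \<delta> where S: "group G" "finite S" "S \<subseteq> carrier G" "generate G S = carrier G"
    "gromov_hyperbolic (carrier G) (word_dist G S) \<delta>"
    using assms(1) by (auto simp: hyperbolic_group_def)
  interpret acyclic_graph_word_problem G S \<delta> xs
    using S assms(3)
    by (intro acyclic_graph_word_problem.intro hyperbolic_word_metric.intro word_metric.intro
        word_metric_axioms.intro hyperbolic_word_metric_axioms.intro
        acyclic_graph_word_problem_axioms.intro)
  show ?thesis by (rule AGWP_in_class_P)
qed

end
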